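(* Let $B=(l_1,l_2,l_3)$ be a 3-component link in $\mathbb{R}^3$ (such as the Borromean rings) all of whose pairwise linking numbers are $0$ and whose Milnor invariant satisfies $\overline{\mu}_{123}(B)\not\equiv 0 \pmod 3$. For $\epsilon>0$ let $n_B(\epsilon)$ be the largest $n$ for which $B^n$ can be embedded in the unit cube $I^3=[0,1]^3$ satisfying the diagonal-$\epsilon$-condition (with $n_B(\epsilon)=\infty$ if there is no such bound). Then for all $\epsilon>0$, $n_B(\epsilon)$ is a finite integer, and $n_B(\epsilon)=O(e^{a\epsilon^{-9}})$ for some constant $a>0$; that is, there are constants $a,C,\epsilon_0>0$ with $n_B(\epsilon)\le C e^{a\epsilon^{-9}}$ for all $0<\epsilon<\epsilon_0$.
   Context: Links are smooth, oriented, with ordered components. $B^n$ denotes the link type that is the split union of $n$ copies $B_j=(l_{j1},l_{j2},l_{j3})$, $1\le j\le n$, of $B$: the copies are separated from one another by smoothly embedded 2-spheres. A link of type $B^n$ contained in $I^3$ satisfies the diagonal-$\epsilon$-condition if for each $1\le j\le n$, $\operatorname{dist}(l_{ji},l_{ji'})\ge\epsilon$ whenever $i\ne i'$ (Euclidean distance between sets); no distance condition is imposed between components of different copies. $\overline{\mu}_{123}$ is Milnor's triple linking number. For a 3-component link with vanishing linking numbers it is an integer: it is the coefficient of $x_1x_2$ in the Magnus expansion ($m_i\mapsto 1+x_i$, $m_i^{-1}\mapsto 1-x_i$, in noncommuting variables $x_1,x_2$, modulo monomials in which a variable repeats) of a word in meridians $m_1,m_2$ of $l_1,l_2$ representing $l_3$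 in the Milnor link group of $l_1\cup l_2$ (the quotient of $\pi_1$ of the complement of $l_1\cup l_2$ in which each meridian commutes with all its conjugates). *)

theory Defs
  imports
    "HOL-Analysis.Analysis"
    "HOL-Algebra.Generated_Groups"
    "HOL-Number_Theory.Cong"
begin

section \<open>Smooth maps\<close>

primrec C_k :: "nat \<Rightarrow> ('a::euclidean_space \<Rightarrow> 'b::real_normed_vector) \<Rightarrow> bool" where
  "C_k 0 = (\<lambda>f. continuous_on UNIV f)"
| "C_k (Suc k) =
     (\<lambda>f. \<exists>f'. (\<forall>x. (f has_derivative f' x) (at x)) \<and> (\<forall>v. C_k k (\<lambda>x. f' x v)))"

definition smooth :: "('a::euclidean_space \<Rightarrow> 'b::real_normed_vector) \<Rightarrow> bool" where
  "smooth f \<longleftrightarrow> (\<forall>k. C_k k f)"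

definition diffeomorphism :: "('a::euclidean_space \<Rightarrow> 'a) \<Rightarrow> bool" where
  "diffeomorphism f \<longleftrightarrow> smooth f \<and> (\<exists>g. smooth g \<and> (\<forall>x. g (f x) = x) \<and> (\<forall>x. f (g x) = x))"


section \<open>Links and isotopy\<close>

text \<open>An oriented component is given by a parametrization of period \<open>1\<close>; as a set it is the
  range of the parametrization. A link is an indexed family, so its components are ordered.\<close>

definition smooth_knot :: "(real \<Rightarrow> real^3) \<Rightarrow> bool" where
  "smooth_knot K \<longleftrightarrow>
     smooth K \<and> (\<forall>t. K (t + 1) = K t) \<and> inj_on K {0..<1} \<and>
     (\<forall>t. vector_derivative K (at t) \<noteq> 0)"

definition smooth_link :: "'i set \<Rightarrow> ('i \<Rightarrow> real \<Rightarrow> real^3) \<Rightarrow> bool" where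
  "smooth_link I L \<longleftrightarrow>
     (\<forall>i\<in>I. smooth_knot (L i)) \<and> disjoint_family_on (\<lambda>i. range (L i)) I"

definition same_oriented_curve :: "(real \<Rightarrow> real^3) \<Rightarrow> (real \<Rightarrow> real^3) \<Rightarrow> bool" where
  "same_oriented_curve K K' \<longleftrightarrow>
     (\<exists>\<phi>::real \<Rightarrow> real. smooth \<phi> \<and> (\<forall>t. vector_derivative \<phi> (at t) > 0) \<and>
        (\<forall>t. \<phi> (t + 1) = \<phi> t + 1) \<and> (\<forall>t. K t = K' (\<phi> t)))"

text \<open>Smooth ambient isotopy. Taking the time parameter in all of \<open>\<real>\<close> rather than in \<open>[0,1]\<close> does
  not change the relation: precompose with a smooth monotone function that is \<open>0\<close> near
  \<open>t \<le> 0\<close> and \<open>1\<close> near \<open>t \<ge> 1\<close>.\<close>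

definition isotopic_links ::
    "'i set \<Rightarrow> ('i \<Rightarrow> real \<Rightarrow> real^3) \<Rightarrow> ('i \<Rightarrow> real \<Rightarrow> real^3) \<Rightarrow> bool" where
  "isotopic_links I L L' \<longleftrightarrow>
     (\<exists>H :: real \<times> (real^3) \<Rightarrow> real^3.
        smooth H \<and> (\<forall>t. diffeomorphism (\<lambda>x. H (t, x))) \<and> (\<forall>x. H (0, x) = x) \<and>
        (\<forall>i\<in>I. same_oriented_curve (\<lambda>s. H (1, L i s)) (L' i)))"

definition link_complement :: "'i set \<Rightarrow> ('i \<Rightarrow> real \<Rightarrow> real^3) \<Rightarrow> (real^3) set" where
  "link_complement I L = - (\<Union>i\<in>I. range (L i))"


section \<open>The fundamental group\<close>

definition loop_class :: "'a::topological_space set \<Rightarrow> (real \<Rightarrow> 'a) \<Rightarrow> (real \<Rightarrow> 'a) set" where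
  "loop_class S f = {g. homotopic_paths S f g}"

definition loops_at :: "'a::topological_space set \<Rightarrow> 'a \<Rightarrow> (real \<Rightarrow> 'a) set" where
  "loops_at S p = {f. path f \<and> path_image f \<subseteq> S \<and> pathstart f = p \<and> pathfinish f = p}"

definition fundamental_group ::
    "'a::topological_space set \<Rightarrow> 'a \<Rightarrow> (real \<Rightarrow> 'a) set monoid" where
  "fundamental_group S p =
     \<lparr>carrier = loop_class S ` loops_at S p,
      monoid.mult = (\<lambda>A B. {h. \<exists>f\<in>A. \<exists>g\<in>B. homotopic_paths S (f +++ g) h}),
      one = loop_class S (\<lambda>_. p)\<rparr>"

lemma loop_class_eq:
  assumes "homotopic_paths S f g"
  shows "loop_class S f = loop_class S g"
  using assms homotopic_paths_sym homotopic_paths_trans unfolding loop_class_def by blast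

lemma mult_fundamental_group:
  fixes S :: "'a::topological_space set"
  assumes "f \<in> loops_at S p" "g \<in> loops_at S p"
  shows "loop_class S f \<otimes>\<^bsub>fundamental_group S p\<^esub> loop_class S g = loop_class S (f +++ g)"
proof -
  have fg: "pathfinish f = pathstart g"
    using assms by (simp add: loops_at_def)
  have *: "homotopic_paths S (f +++ g) h"
    if "homotopic_paths S f f'" "homotopic_paths S g g'" "homotopic_paths S (f' +++ g') h"
    for f' g' h
    using homotopic_paths_trans[OF homotopic_paths_join[OF that(1,2) fg] that(3)] .
  have "homotopic_paths S f f" "homotopic_paths S g g"
    using assms by (simp_all add: loops_at_def)
  with * have "(\<exists>f'. homotopic_paths S f f' \<and> (\<exists>g'. homotopic_paths S g g' \<and>
      homotopic_paths S (f' +++ g') h)) \<longleftrightarrow> homotopic_paths S (f +++ g) h" for h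
    by blast
  then show ?thesis
    by (simp add: fundamental_group_def loop_class_def)
qed

lemma group_fundamental_group:
  fixes S :: "'a::real_normed_vector set"
  assumes "p \<in> S"
  shows "group (fundamental_group S p)"
proof -
  let ?G = "fundamental_group S p"
  have carr: "carrier ?G = loop_class S ` loops_at S p"
    by (simp add: fundamental_group_def)
  have lin: "linepath p p = (\<lambda>_. p)"
    by (simp add: linepath_def fun_eq_iff flip: scaleR_add_left)
  have one: "\<one>\<^bsub>?G\<^esub> = loop_class S (linepath p p)"
    by (simp add: fundamental_group_def lin)
  have p: "linepath p p \<in> loops_at S p"
    using assms by (simp add: loops_at_def)
  have join: "f +++ g \<in> loops_at S p" if "f \<in> loops_at S p" "g \<in> loops_at S p" for f g
    using that by (auto simp: loops_at_def path_image_join)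
  have rev: "reversepath f \<in> loops_at S p" if "f \<in> loops_at S p" for f
    using that by (auto simp: loops_at_def)
  show ?thesis
  proof (rule groupI)
    fix x y assume "x \<in> carrier ?G" "y \<in> carrier ?G"
    then show "x \<otimes>\<^bsub>?G\<^esub> y \<in> carrier ?G"
      using join by (auto simp: carr mult_fundamental_group)
  next
    show "\<one>\<^bsub>?G\<^esub> \<in> carrier ?G"
      using p by (simp add: carr one)
  next
    fix x y z assume "x \<in> carrier ?G" "y \<in> carrier ?G" "z \<in> carrier ?G"
    then obtain f g h where fgh: "f \<in> loops_at S p" "g \<in> loops_at S p" "h \<in> loops_at S p"
      and xyz: "x = loop_class S f" "y = loop_class S g" "z = loop_class S h"
      by (auto simp: carr)
    have "homotopic_paths S (f +++ g +++ h) ((f +++ g) +++ h)"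
      using fgh by (intro homotopic_paths_assoc) (auto simp: loops_at_def)
    then show "x \<otimes>\<^bsub>?G\<^esub> y \<otimes>\<^bsub>?G\<^esub> z = x \<otimes>\<^bsub>?G\<^esub> (y \<otimes>\<^bsub>?G\<^esub> z)"
      using fgh by (simp add: xyz mult_fundamental_group join loop_class_eq)
  next
    fix x assume "x \<in> carrier ?G"
    then obtain f where f: "f \<in> loops_at S p" and x: "x = loop_class S f"
      by (auto simp: carr)
    have "homotopic_paths S (linepath p p +++ f) f"
      using f by (intro homotopic_paths_lid') (auto simp: loops_at_def)
    then show "\<one>\<^bsub>?G\<^esub> \<otimes>\<^bsub>?G\<^esub> x = x"
      using f p by (simp add: x one mult_fundamental_group loop_class_eq)
    have "homotopic_paths S (reversepath f +++ f) (linepath p p)"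
      using f homotopic_paths_linv[of f S] by (auto simp: loops_at_def)
    then show "\<exists>y\<in>carrier ?G. y \<otimes>\<^bsub>?G\<^esub> x = \<one>\<^bsub>?G\<^esub>"
      using f rev[OF f]
      by (intro bexI[of _ "loop_class S (reversepath f)"])
         (auto simp: x one carr mult_fundamental_group loop_class_eq)
  qed
qed

text \<open>The elements of the fundamental group at \<open>p\<close> obtained from a closed curve \<open>c\<close> by choosing an
  arc from \<open>p\<close> to the starting point of \<open>c\<close>: a conjugacy class if \<open>S\<close> is path-connected.\<close>

definition based_classes ::
    "'a::topological_space set \<Rightarrow> 'a \<Rightarrow> (real \<Rightarrow> 'a) \<Rightarrow> (real \<Rightarrow> 'a) set set" where
  "based_classes S p c =
     {loop_class S (\<alpha> +++ c +++ reversepath \<alpha>) | \<alpha>.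
        path \<alpha> \<and> path_image \<alpha> \<subseteq> S \<and> pathstart \<alpha> = p \<and> pathfinish \<alpha> = pathstart c}"


section \<open>Meridians and linking numbers\<close>

text \<open>A meridian of \<open>K\<close> bounds a round disc perpendicular to \<open>K\<close> at its centre which meets the link
  (the complement of \<open>S\<close>) in that centre only. It is oriented by the right-hand rule.\<close>

definition meridian_curves :: "(real^3) set \<Rightarrow> (real \<Rightarrow> real^3) \<Rightarrow> (real \<Rightarrow> real^3) set" where
  "meridian_curves S K =
     {(\<lambda>s. K t + (r * cos (2 * pi * s)) *\<^sub>R u + (r * sin (2 * pi * s)) *\<^sub>R v) | t r u v.
        r > 0 \<and> norm u = 1 \<and> norm v = 1 \<and> orthogonal u v \<and>
        orthogonal u (vector_derivative K (at t)) \<and> orthogonal v (vector_derivative K (at t)) \<and>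
        cross3 u v \<bullet> vector_derivative K (at t) > 0 \<and>
        (\<forall>a b. 0 < a\<^sup>2 + b\<^sup>2 \<and> a\<^sup>2 + b\<^sup>2 \<le> r\<^sup>2 \<longrightarrow> K t + a *\<^sub>R u + b *\<^sub>R v \<in> S)}"

definition meridians :: "(real^3) set \<Rightarrow> real^3 \<Rightarrow> (real \<Rightarrow> real^3) \<Rightarrow> (real \<Rightarrow> real^3) set set" where
  "meridians S p K = (\<Union>c\<in>meridian_curves S K. based_classes S p c)"

text \<open>The linking number of \<open>K\<close> and \<open>J\<close> is the \<open>k\<close> such that \<open>[J] = k [m]\<close> in the first homology of
  the complement of \<open>K\<close>, for \<open>m\<close> a meridian of \<open>K\<close>; here the first homology group is the
  abelianized fundamental group.\<close>

definition has_linking_number :: "(real \<Rightarrow> real^3) \<Rightarrow> (real \<Rightarrow> real^3) \<Rightarrow> int \<Rightarrow> bool" where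
  "has_linking_number K J k \<longleftrightarrow>
     (\<exists>p\<in>- range K. \<exists>m\<in>meridians (- range K) p K. \<exists>l\<in>based_classes (- range K) p J.
        let G = fundamental_group (- range K) p; D = derived G (carrier G)
        in D #>\<^bsub>G\<^esub> l = D #>\<^bsub>G\<^esub> (m [^]\<^bsub>G\<^esub> k))"


section \<open>The Milnor link group and the Magnus expansion\<close>

definition normal_closure :: "('a, 'b) monoid_scheme \<Rightarrow> 'a set \<Rightarrow> 'a set" where
  "normal_closure G A =
     generate G {g \<otimes>\<^bsub>G\<^esub> a \<otimes>\<^bsub>G\<^esub> inv\<^bsub>G\<^esub> g | g a. g \<in> carrier G \<and> a \<in> A}"

text \<open>The Milnor link group is the quotient \<open>fundamental_group (link_complement I L) p Mod
  milnor_kernel I L p\<close>.\<close>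

definition milnor_kernel ::
    "'i set \<Rightarrow> ('i \<Rightarrow> real \<Rightarrow> real^3) \<Rightarrow> real^3 \<Rightarrow> (real \<Rightarrow> real^3) set set" where
  "milnor_kernel I L p =
     (let S = link_complement I L; G = fundamental_group S p
      in normal_closure G
        {m \<otimes>\<^bsub>G\<^esub> m' \<otimes>\<^bsub>G\<^esub> inv\<^bsub>G\<^esub> m \<otimes>\<^bsub>G\<^esub> inv\<^bsub>G\<^esub> m' | m m' g.
           m \<in> (\<Union>i\<in>I. meridians S p (L i)) \<and> g \<in> carrier G \<and>
           m' = g \<otimes>\<^bsub>G\<^esub> m \<otimes>\<^bsub>G\<^esub> inv\<^bsub>G\<^esub> g})"

text \<open>Words are lists of letters \<open>(i, b)\<close>, standing for the \<open>i\<close>-th generator if \<open>b\<close> and for its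
  inverse otherwise.\<close>

definition eval_word ::
    "('a, 'b) monoid_scheme \<Rightarrow> (nat \<Rightarrow> 'a) \<Rightarrow> (nat \<times> bool) list \<Rightarrow> 'a" where
  "eval_word G m w =
     foldr (\<lambda>(i, b) a. (if b then m i else inv\<^bsub>G\<^esub> m i) \<otimes>\<^bsub>G\<^esub> a) w \<one>\<^bsub>G\<^esub>"

text \<open>A noncommutative polynomial modulo monomials with a repeated variable is represented by its
  coefficient function on monomials \<open>x\<^bsub>i\<^esub> x\<^bsub>j\<^esub> \<dots>\<close>, given as lists \<open>[i, j, \<dots>]\<close>; it vanishes on
  monomials that are not distinct.\<close>

definition nc_one :: "nat list \<Rightarrow> int" where
  "nc_one u = (if u = [] then 1 else 0)"

definition nc_var :: "nat \<Rightarrow> nat list \<Rightarrow> int" where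
  "nc_var i u = (if u = [i] then 1 else 0)"

definition nc_mult :: "(nat list \<Rightarrow> int) \<Rightarrow> (nat list \<Rightarrow> int) \<Rightarrow> nat list \<Rightarrow> int" where
  "nc_mult P Q u =
     (if distinct u then \<Sum>k\<le>length u. P (take k u) * Q (drop k u) else 0)"

definition magnus_letter :: "nat \<times> bool \<Rightarrow> nat list \<Rightarrow> int" where
  "magnus_letter = (\<lambda>(i, b) u. if b then nc_one u + nc_var i u else nc_one u - nc_var i u)"

definition magnus :: "(nat \<times> bool) list \<Rightarrow> nat list \<Rightarrow> int" where
  "magnus w = foldr (\<lambda>x. nc_mult (magnus_letter x)) w nc_one"

text \<open>Milnor's \<open>\<mu>(123)\<close>. The value \<open>k\<close> is independent of the choices when the linking numbers
  vanish.\<close>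

definition has_triple_linking_number :: "(nat \<Rightarrow> real \<Rightarrow> real^3) \<Rightarrow> int \<Rightarrow> bool" where
  "has_triple_linking_number L k \<longleftrightarrow>
     (let S = link_complement {1, 2} L in
      \<exists>p\<in>S. \<exists>m. \<exists>l\<in>based_classes S p (L 3). \<exists>w.
        let G = fundamental_group S p; N = milnor_kernel {1, 2} L p in
        (\<forall>i\<in>{1, 2}. m i \<in> meridians S p (L i)) \<and>
        fst ` set w \<subseteq> {1, 2} \<and>
        N #>\<^bsub>G\<^esub> eval_word G m w = N #>\<^bsub>G\<^esub> l \<and>
        k = magnus w [1, 2])"


section \<open>Packing copies of a link in the unit cube\<close>

text \<open>The component \<open>l\<^bsub>ji\<^esub>\<close> of a link of type \<open>B\<^sup>n\<close> has index \<open>(j, i)\<close>. In a split union the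
  copies lie in disjoint round balls; an ambient isotopy carries the boundary spheres of
  these to the smoothly embedded spheres that separate the copies.\<close>

definition has_split_type ::
    "nat \<Rightarrow> (nat \<Rightarrow> real \<Rightarrow> real^3) \<Rightarrow> (nat \<times> nat \<Rightarrow> real \<Rightarrow> real^3) \<Rightarrow> bool" where
  "has_split_type n B L \<longleftrightarrow>
     (\<exists>L' c r.
        smooth_link ({1..n} \<times> {1, 2, 3}) L' \<and>
        isotopic_links ({1..n} \<times> {1, 2, 3}) L L' \<and>
        disjoint_family_on (\<lambda>j. cball (c j) (r j)) {1..n} \<and>
        (\<forall>j\<in>{1..n}. \<forall>i\<in>{1, 2, 3}. range (L' (j, i)) \<subseteq> ball (c j) (r j)) \<and>
        (\<forall>j\<in>{1..n}. isotopic_links {1, 2, 3} (\<lambda>i. L' (j, i)) B))"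

definition diagonal_condition ::
    "nat \<Rightarrow> real \<Rightarrow> (nat \<times> nat \<Rightarrow> real \<Rightarrow> real^3) \<Rightarrow> bool" where
  "diagonal_condition n \<epsilon> L \<longleftrightarrow>
     (\<forall>j\<in>{1..n}. \<forall>i\<in>{1, 2, 3}. \<forall>i'\<in>{1, 2, 3}. i \<noteq> i' \<longrightarrow>
        setdist (range (L (j, i))) (range (L (j, i'))) \<ge> \<epsilon>)"

definition packs_in_cube :: "(nat \<Rightarrow> real \<Rightarrow> real^3) \<Rightarrow> real \<Rightarrow> nat \<Rightarrow> bool" where
  "packs_in_cube B \<epsilon> n \<longleftrightarrow>
     (\<exists>L. smooth_link ({1..n} \<times> {1, 2, 3}) L \<and> has_split_type n B L \<and>
        (\<forall>c\<in>{1..n} \<times> {1, 2, 3}. range (L c) \<subseteq> cbox 0 One) \<and>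
        diagonal_condition n \<epsilon> L)"

definition packing_number :: "(nat \<Rightarrow> real \<Rightarrow> real^3) \<Rightarrow> real \<Rightarrow> enat" where
  "packing_number B \<epsilon> = Sup (enat ` {n. packs_in_cube B \<epsilon> n})"

end

theory Submission
  imports Defs
begin

text \<open>Since the linking number of \<open>B 1\<close> and \<open>B 2\<close> vanishes, smearing the two curves yields a flat connection
  with values in the real Heisenberg group on the complement of a small neighbourhood of \<open>B 1 \<union> B 2\<close>:
  its entries above the diagonal are two forms dual to the curves, and the corner is a primitive of
  their product. The holonomy of \<open>B 3\<close> is central, and it is a nonzero multiple of the coefficient
  of \<open>x\<^sub>1 x\<^sub>2\<close> in the Magnus expansion.

  Given a packing of \<open>n\<close> copies, pull the connection back along the diffeomorphism that carries the
  \<open>j\<close>-th copy to \<open>B\<close>. The third component of the \<open>k\<close>-th copy has nontrivial holonomy for \<open>k = j\<close>, and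
  trivial holonomy for \<open>k \<noteq> j\<close>, because it then lies in a ball disjoint from the \<open>j\<close>-th copy. Cover
  the cube by \<open>O(\<epsilon>\<^sup>-\<^sup>3)\<close> balls of radius \<open>\<epsilon> / 3\<close>. Those met by a third component miss the first two
  components of its copy. Among the copies whose third components meet the same set of balls, the
  holonomy of the \<open>k\<close>-th loop under the \<open>j\<close>-th connection pairs a vector that depends on \<open>j\<close> with one
  that depends on \<open>k\<close>, in a space whose dimension is polynomial in the number of balls. A diagonal
  matrix of this kind has bounded size, and there are at most \<open>2 ^ O(\<epsilon>\<^sup>-\<^sup>3)\<close> sets of balls.\<close>


section \<open>Holonomy of locally flat transports\<close>

text \<open>The fundamental group consists of merely continuous loops, and a copy is carried to
  \<open>B\<close> by a map of which only continuity and injectivity are used. Connections are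
  therefore local cocycles \<open>T x y\<close>, which can be developed along any continuous map;
  integrals of forms enter only where a holonomy has to be computed. The transition words have
  unbounded length. They still give vectors in a fixed space because the Heisenberg group has
  nilpotency class 2: the corner of a product is linear in the corners of the factors plus bilinear
  in their other two entries. Centrality of the holonomies is what makes the corner insensitive to
  base points and conjugation. The forms are closed only off a \<open>d\<close>-neighbourhood of the
  curves, so every statement about a given loop or homotopy holds for small \<open>d\<close> only,
  with a bound that depends on it. The final rank argument involves finitely many such statements,
  and one \<open>d\<close> serves them all. The resulting count is exp(O(1/\<epsilon>^3)), which for
  \<epsilon> < 1 lies below the required bound.\<close>

text \<open>\<open>T x y\<close> is a transport from \<open>x\<close> to \<open>y\<close>, significant for nearby points only, with values in a
  group that is written additively without being commutative. A development \<open>q\<close> is a primitive of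
  \<open>T\<close> along \<open>F\<close>.\<close>

definition flat_on :: "'a::metric_space set \<Rightarrow> ('a \<Rightarrow> 'a \<Rightarrow> 'h::group_add) \<Rightarrow> bool" where
  "flat_on U T \<longleftrightarrow>
     (\<forall>x\<in>U. \<exists>r>0. \<forall>y\<in>ball x r. \<forall>z\<in>ball x r. \<forall>w\<in>ball x r. T y z + T z w = T y w)"

definition develops ::
    "('a \<Rightarrow> 'a \<Rightarrow> 'h::group_add) \<Rightarrow> ('b::metric_space \<Rightarrow> 'a) \<Rightarrow> 'b set \<Rightarrow> ('b \<Rightarrow> 'h) \<Rightarrow> bool" where
  "develops T F C q \<longleftrightarrow> (\<forall>z\<in>C. \<exists>d>0. \<forall>z'\<in>C. dist z z' < d \<longrightarrow> q z' = q z + T (F z) (F z'))"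

lemma flat_on_refl:
  assumes "flat_on U T" "x \<in> U"
  shows "T x x = 0"
proof -
  obtain r where "r > 0" "\<forall>y\<in>ball x r. \<forall>z\<in>ball x r. \<forall>w\<in>ball x r. T y z + T z w = T y w"
    using assms unfolding flat_on_def by blast
  then have "T x x + T x x = T x x + 0" by simp
  then show ?thesis by (rule add_left_imp_eq)
qed

lemma develops_subset: "develops T F C q \<Longrightarrow> D \<subseteq> C \<Longrightarrow> develops T F D q"
  unfolding develops_def by (meson subsetD)

lemma develops_cong:
  "(\<And>z. z \<in> C \<Longrightarrow> F z = F' z) \<Longrightarrow> develops T F C q \<longleftrightarrow> develops T F' C q"
  unfolding develops_def by (intro ball_cong ex_cong1) auto

lemma develops_compose:
  assumes "develops T F C q" "continuous_on D \<phi>" "\<phi> ` D \<subseteq> C"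
  shows "develops T (\<lambda>t. F (\<phi> t)) D (\<lambda>t. q (\<phi> t))"
  unfolding develops_def
proof
  fix t assume t: "t \<in> D"
  then have "\<phi> t \<in> C" using assms by blast
  then obtain d where d: "d > 0" "\<And>z'. z' \<in> C \<Longrightarrow> dist (\<phi> t) z' < d \<Longrightarrow> q z' = q (\<phi> t) + T (F (\<phi> t)) (F z')"
    using assms unfolding develops_def by blast
  obtain e where e: "e > 0" "\<And>t'. t' \<in> D \<Longrightarrow> dist t' t < e \<Longrightarrow> dist (\<phi> t') (\<phi> t) < d"
    using assms(2) d(1) t unfolding continuous_on_iff by blast
  show "\<exists>e>0. \<forall>t'\<in>D. dist t t' < e \<longrightarrow> q (\<phi> t') = q (\<phi> t) + T (F (\<phi> t)) (F (\<phi> t'))"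
    using e d assms(3) by (intro exI[of _ e]) (auto simp: dist_commute)
qed

lemma develops_hom:
  assumes "develops T F C q" and "\<And>x y. \<phi> (x + y) = \<phi> x + \<phi> y"
  shows "develops (\<lambda>x y. \<phi> (T x y)) F C (\<lambda>z. \<phi> (q z))"
  using assms(1) unfolding develops_def by (metis assms(2))

text \<open>Near any point both developments are multiplied on the right by the same transport,
  which cancels in \<open>q - q'\<close> taken in this order. Hence this quotient is locally
  constant, and developments differ by a left translation.\<close>

lemma develops_unique:
  assumes "develops T F C q" "develops T F C q'" "connected C" "z \<in> C" "w \<in> C"
  shows "q z - q' z = q w - q' w"
proof (rule connected_local_const[OF assms(3-5)])
  show "\<forall>a\<in>C. \<forall>\<^sub>F b in at a within C. q a - q' a = q b - q' b"
  proof
    fix a assume a: "a \<in> C"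
    obtain d where d: "d > 0" "\<And>z'. z' \<in> C \<Longrightarrow> dist a z' < d \<Longrightarrow> q z' = q a + T (F a) (F z')"
      using assms a unfolding develops_def by blast
    obtain d' where d': "d' > 0" "\<And>z'. z' \<in> C \<Longrightarrow> dist a z' < d' \<Longrightarrow> q' z' = q' a + T (F a) (F z')"
      using assms a unfolding develops_def by blast
    have "q a - q' a = q b - q' b" if "b \<in> C" "dist b a < min d d'" for b
      using d(2)[of b] d'(2)[of b] that
      by (simp add: dist_commute diff_conv_add_uminus minus_add add.assoc del: add_uminus_conv_diff)
    then show "\<forall>\<^sub>F b in at a within C. q a - q' a = q b - q' b"
      using d d' by (auto simp: eventually_at intro!: exI[of _ "min d d'"])
  qed
qed

text \<open>The monodromy principle on a convex set: \<open>q z\<close> is the ordered sum of the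
  transports along a fine subdivision of the segment from a base point to \<open>z\<close>, and
  nearby segments are compared rung by rung.\<close>

lemma develops_exists:
  fixes F :: "'b::real_normed_vector \<Rightarrow> 'a::metric_space"
  assumes flat: "flat_on U T" and C: "compact C" "convex C" and F: "continuous_on C F" "F ` C \<subseteq> U"
  shows "\<exists>q. develops T F C q"
proof (cases "C = {}")
  case True
  then show ?thesis by (simp add: develops_def)
next
  case False
  then obtain z0 where z0: "z0 \<in> C" by blast
  define good where "good W \<longleftrightarrow> open W \<and>
      (\<forall>y\<in>W \<inter> C. \<forall>z\<in>W \<inter> C. \<forall>w\<in>W \<inter> C. T (F y) (F z) + T (F z) (F w) = T (F y) (F w))" for W
  have "C \<subseteq> \<Union>{W. good W}"
  proof
    fix z assume z: "z \<in> C"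
    then obtain r where r: "r > 0" "\<forall>y\<in>ball (F z) r. \<forall>u\<in>ball (F z) r. \<forall>w\<in>ball (F z) r. T y u + T u w = T y w"
      using flat F unfolding flat_on_def by blast
    obtain d where d: "d > 0" "\<And>z'. z' \<in> C \<Longrightarrow> dist z' z < d \<Longrightarrow> dist (F z') (F z) < r"
      using F(1) r(1) z unfolding continuous_on_iff by blast
    have "good (ball z d)"
      unfolding good_def using r(2) d(2) by (auto simp: dist_commute)
    then show "z \<in> \<Union>{W. good W}" using d(1) by auto
  qed
  \<comment> \<open>\<open>e\<close> is a Lebesgue number for the cover by sets on which the cocycle
    identity holds.\<close>
  then obtain e where e: "e > 0" "\<And>z. z \<in> C \<Longrightarrow> \<exists>W\<in>{W. good W}. ball z e \<subseteq> W"
    using Heine_Borel_lemma[OF C(1), of "{W. good W}"] unfolding good_def by blast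
  have coc: "T (F y) (F z) + T (F z) (F w) = T (F y) (F w)"
    if x: "x \<in> C" and yzw: "y \<in> C" "z \<in> C" "w \<in> C" "dist x y < e" "dist x z < e" "dist x w < e" for x y z w
  proof -
    obtain W where "good W" "ball x e \<subseteq> W" using e(2)[OF x] by blast
    then show ?thesis using x yzw unfolding good_def by (auto simp: subset_eq)
  qed
  have T0: "T (F z) (F z) = 0" if "z \<in> C" for z
    using flat_on_refl[OF flat] F that by auto
  obtain R where R: "R > 0" "\<And>z. z \<in> C \<Longrightarrow> norm (z - z0) \<le> R"
  proof -
    have "bounded ((\<lambda>z. z - z0) ` C)"
      using compact_imp_bounded[OF C(1)] bounded_translation_minus by blast
    then show ?thesis using that by (auto simp: bounded_pos)
  qed
  \<comment> \<open>Steps along one segment and distances between corresponding points of two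
    segments both stay below \<open>e / 2\<close>, so each small quadrilateral fits into one ball of
    radius \<open>e\<close>.\<close>
  obtain N :: nat where N: "N > 0" "R / N < e / 2"
  proof -
    obtain N :: nat where "2 * R / e < N" using reals_Archimedean2 by blast
    then show ?thesis using that[of N] e(1) R(1) by (cases "N = 0") (auto simp: field_simps)
  qed
  define p where "p i z = z0 + (i / N) *\<^sub>R (z - z0)" for i :: nat and z
  have p_in: "p i z \<in> C" if "z \<in> C" "i \<le> N" for i z
  proof -
    have "p i z = (1 - i / N) *\<^sub>R z0 + (i / N) *\<^sub>R z" by (simp add: p_def algebra_simps)
    then show ?thesis using C(2) z0 that N by (auto intro!: convexD_alt)
  qed
  have p_step: "dist (p i z) (p (Suc i) z) < e / 2" if "z \<in> C" for i z
  proof -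
    have "p (Suc i) z - p i z = (1 / N) *\<^sub>R (z - z0)"
      by (simp add: p_def algebra_simps add_divide_distrib)
    then have "dist (p (Suc i) z) (p i z) = norm (z - z0) / N"
      by (simp add: dist_norm)
    then have "dist (p i z) (p (Suc i) z) = norm (z - z0) / N"
      by (simp add: dist_commute)
    also have "\<dots> \<le> R / N" using R(2)[OF that] by (simp add: divide_right_mono)
    finally show ?thesis using N(2) by linarith
  qed
  have p_close: "dist (p i z) (p i z') \<le> dist z z'" if "i \<le> N" for i z z'
  proof -
    have "p i z - p i z' = (i / N) *\<^sub>R (z - z')" by (simp add: p_def algebra_simps)
    then have "dist (p i z) (p i z') = i / N * dist z z'" by (simp add: dist_norm)
    also have "\<dots> \<le> 1 * dist z z'" using that N(1) by (intro mult_right_mono) auto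
    finally show ?thesis by simp
  qed
  define q where "q i z = sum_list (map (\<lambda>i. T (F (p i z)) (F (p (Suc i) z))) [0..<i])" for i z
  have q_Suc: "q (Suc i) z = q i z + T (F (p i z)) (F (p (Suc i) z))" for i z
    by (simp add: q_def)
  have key: "q i z' = q i z + T (F (p i z)) (F (p i z'))"
    if z: "z \<in> C" "z' \<in> C" "dist z z' < e / 2" and "i \<le> N" for i z z'
    using \<open>i \<le> N\<close>
  proof (induction i)
    case 0
    then show ?case using z0 by (simp add: q_def p_def T0)
  next
    case (Suc i)
    have in_C: "p i z \<in> C" "p i z' \<in> C" "p (Suc i) z \<in> C" "p (Suc i) z' \<in> C"
      using p_in z Suc.prems by auto
    have d1: "dist (p i z) (p i z') < e / 2" using p_close[of i z z'] z Suc.prems by auto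
    have d2: "dist (p i z) (p (Suc i) z') < e"
      using dist_triangle[of "p i z" "p (Suc i) z'" "p i z'"] d1 p_step[of z' i] z by linarith
    have d3: "dist (p i z) (p (Suc i) z) < e" using p_step[of z i] z e(1) by linarith
    \<comment> \<open>Both ways round the quadrilateral from \<open>p i z\<close> to
      \<open>p (Suc i) z'\<close> equal the transport along its diagonal.\<close>
    have "q (Suc i) z' = q i z + (T (F (p i z)) (F (p i z')) + T (F (p i z')) (F (p (Suc i) z')))"
      using Suc by (simp add: q_Suc add.assoc)
    also have "\<dots> = q i z + T (F (p i z)) (F (p (Suc i) z'))"
      using coc[of "p i z" "p i z" "p i z'" "p (Suc i) z'"] in_C d1 d2 e(1) by simp
    also have "\<dots> = q i z + (T (F (p i z)) (F (p (Suc i) z)) + T (F (p (Suc i) z)) (F (p (Suc i) z')))"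
      using coc[of "p i z" "p i z" "p (Suc i) z" "p (Suc i) z'"] in_C d3 d2 e(1) by simp
    also have "\<dots> = q (Suc i) z + T (F (p (Suc i) z)) (F (p (Suc i) z'))"
      by (simp add: q_Suc add.assoc)
    finally show ?case .
  qed
  have pN: "p N z = z" for z using N(1) by (simp add: p_def)
  have "q N z' = q N z + T (F z) (F z')" if "z \<in> C" "z' \<in> C" "dist z z' < e / 2" for z z'
    using key[OF that order_refl] unfolding pN .
  then have "develops T F C (q N)"
    unfolding develops_def using e(1) half_gt_zero by blast
  then show ?thesis by blast
qed

text \<open>A left translation of \<open>q\<close> cancels in \<open>- q 0 + q 1\<close>, so the
  value does not depend on the development; it is unspecified where there is none.\<close>

definition hol :: "('a \<Rightarrow> 'a \<Rightarrow> 'h::group_add) \<Rightarrow> (real \<Rightarrow> 'a) \<Rightarrow> 'h" where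
  "hol T g = (THE h. \<exists>q. develops T g {0..1} q \<and> h = - q 0 + q 1)"

lemma hol_eq:
  assumes "develops T g {0..1} q"
  shows "hol T g = - q 0 + q 1"
  unfolding hol_def
proof (rule the_equality)
  fix h assume "\<exists>q'. develops T g {0..1} q' \<and> h = - q' 0 + q' 1"
  then obtain q' where q': "develops T g {0..1} q'" "h = - q' 0 + q' 1" by blast
  have "q 0 - q' 0 = q 1 - q' 1"
    using develops_unique[OF assms q'(1)] by auto
  then have "q 1 = q 0 - q' 0 + q' 1" by (metis diff_add_cancel)
  then have "- q 0 + q 1 = - q 0 + (q 0 + (- q' 0 + q' 1))"
    by (simp only: diff_conv_add_uminus add.assoc)
  then show "h = - q 0 + q 1"
    using q' by simp
qed (use assms in auto)

lemma path_develops: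
  fixes g :: "real \<Rightarrow> 'a::metric_space"
  assumes "flat_on U T" "path g" "path_image g \<subseteq> U"
  shows "\<exists>q. develops T g {0..1} q"
  by (rule develops_exists[OF assms(1)]) (use assms in \<open>auto simp: path_def path_image_def\<close>)

lemma hol_compose:
  assumes "develops T F C q" "path g" "path_image g \<subseteq> C"
  shows "hol T (F \<circ> g) = - q (pathstart g) + q (pathfinish g)"
proof -
  have "develops T (\<lambda>t. F (g t)) {0..1} (\<lambda>t. q (g t))"
    by (rule develops_compose[OF assms(1)]) (use assms in \<open>auto simp: path_def path_image_def\<close>)
  from hol_eq[OF this] show ?thesis by (simp add: o_def pathstart_def pathfinish_def)
qed

text \<open>Applied to \<open>hx\<close> and \<open>hy\<close>, it reduces the abelian part of a
  Heisenberg holonomy to two real-valued transports.\<close>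

lemma hol_hom:
  fixes g :: "real \<Rightarrow> 'a::metric_space"
  assumes "flat_on U T" "path g" "path_image g \<subseteq> U" and hom: "\<And>x y. \<phi> (x + y) = \<phi> x + \<phi> y"
  shows "hol (\<lambda>x y. \<phi> (T x y)) g = \<phi> (hol T g)"
proof -
  obtain q where q: "develops T g {0..1} q" using path_develops[OF assms(1-3)] by blast
  have "\<phi> 0 + \<phi> 0 = \<phi> 0 + 0" using hom[of 0 0] by simp
  then have "\<phi> 0 = 0" by (rule add_left_imp_eq)
  then have minus: "\<phi> (- x) = - \<phi> x" for x
    using hom[of "-x" x] by (metis add.left_inverse add_eq_0_iff2)
  show ?thesis using hol_eq[OF q] hol_eq[OF develops_hom[OF q hom]] by (simp add: hom minus)
qed

lemma hol_join:
  fixes f g :: "real \<Rightarrow> 'a::metric_space"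
  assumes "flat_on U T" "path f" "path_image f \<subseteq> U" "path g" "path_image g \<subseteq> U"
    and fg: "pathfinish f = pathstart g"
  shows "hol T (f +++ g) = hol T f + hol T g"
proof -
  have "path (f +++ g)" "path_image (f +++ g) \<subseteq> U"
    using assms by (auto simp: path_image_join)
  then obtain q where q: "develops T (f +++ g) {0..1} q"
    using path_develops[OF assms(1)] by blast
  have "develops T (\<lambda>t. (f +++ g) (t / 2)) {0..1} (\<lambda>t. q (t / 2))"
    by (intro develops_compose[OF q] continuous_intros) auto
  then have 1: "develops T f {0..1} (\<lambda>t. q (t / 2))"
    by (subst develops_cong[of _ f "\<lambda>t. (f +++ g) (t / 2)"]) (auto simp: joinpaths_def)
  have "develops T (\<lambda>t. (f +++ g) ((1 + t) / 2)) {0..1} (\<lambda>t. q ((1 + t) / 2))"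
    by (intro develops_compose[OF q] continuous_intros) auto
  moreover have "g t = (f +++ g) ((1 + t) / 2)" if "t \<in> {0..1}" for t
    using that fg by (auto simp: joinpaths_def pathfinish_def pathstart_def add_divide_distrib)
  ultimately have 2: "develops T g {0..1} (\<lambda>t. q ((1 + t) / 2))"
    by (subst develops_cong[of _ g "\<lambda>t. (f +++ g) ((1 + t) / 2)"]) auto
  show ?thesis
    using hol_eq[OF q] hol_eq[OF 1] hol_eq[OF 2]
    by (simp add: add.assoc flip: add.assoc[of "q (1/2)"])
qed

lemma hol_reversepath:
  fixes g :: "real \<Rightarrow> 'a::metric_space"
  assumes "flat_on U T" "path g" "path_image g \<subseteq> U"
  shows "hol T (reversepath g) = - hol T g"
proof -
  obtain q where q: "develops T g {0..1} q" using path_develops[OF assms(1-3)] by blast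
  have "develops T (\<lambda>t. g (1 - t)) {0..1} (\<lambda>t. q (1 - t))"
    by (intro develops_compose[OF q] continuous_intros) auto
  then have "develops T (reversepath g) {0..1} (\<lambda>t. q (1 - t))" by (simp add: reversepath_def)
  from hol_eq[OF this] hol_eq[OF q] show ?thesis by (simp add: minus_add)
qed

lemma hol_const:
  assumes "T x x = 0"
  shows "hol T (\<lambda>_. x) = 0"
proof -
  have "develops T (\<lambda>_. x) {0..1} (\<lambda>_. 0)"
    using assms unfolding develops_def by (auto intro: exI[of _ 1])
  from hol_eq[OF this] show ?thesis by simp
qed

text \<open>A homotopy is a map on the unit square, which is compact and convex, so it has a
  development there. The two sides on which the end points stay fixed have trivial holonomy, and the
  other two sides must then agree.\<close>

lemma hol_homotopic:
  fixes f g :: "real \<Rightarrow> 'a::metric_space"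
  assumes flat: "flat_on U T" and hom: "homotopic_paths U f g"
  shows "hol T f = hol T g"
proof -
  obtain h where h: "continuous_on ({0..1} \<times> {0..1}) h" "h ` ({0..1} \<times> {0..1}) \<subseteq> U"
    and h0: "\<forall>x\<in>{0..1}. h (0, x) = f x" and h1: "\<forall>x\<in>{0..1}. h (1, x) = g x"
    and ends: "\<forall>t\<in>{0..1::real}. pathstart (h \<circ> Pair t) = pathstart f \<and> pathfinish (h \<circ> Pair t) = pathfinish f"
    using hom unfolding homotopic_paths by (auto simp flip: image_subset_iff_funcset)
  have hs: "h (t, 0) = f 0" and hf: "h (t, 1) = f 1" if "t \<in> {0..1}" for t
    using ends that by (auto simp: pathstart_def pathfinish_def)
  obtain q where q: "develops T h ({0..1} \<times> {0..1}) q"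
    using develops_exists[OF flat _ _ h] by (auto intro!: compact_Times convex_Times)
  have sub: "develops T (\<lambda>t. h (\<phi> t)) {0..1} (\<lambda>t. q (\<phi> t))"
    if "continuous_on {0..1} \<phi>" "\<phi> ` {0..1} \<subseteq> {0..1} \<times> {0..1}" for \<phi> :: "real \<Rightarrow> real \<times> real"
    by (rule develops_compose[OF q that])
  have cong: "hol T f' = - q (\<phi> 0) + q (\<phi> 1)"
    if "continuous_on {0..1} \<phi>" "\<phi> ` {0..1} \<subseteq> {0..1} \<times> {0..1}"
      "\<And>t. t \<in> {0..1} \<Longrightarrow> h (\<phi> t) = f' t" for \<phi> and f' :: "real \<Rightarrow> 'a"
  proof -
    have "develops T f' {0..1} (\<lambda>t. q (\<phi> t))"
      using sub[OF that(1,2)] develops_cong[of "{0..1}" "\<lambda>t. h (\<phi> t)" f'] that(3) by blast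
    from hol_eq[OF this] show ?thesis .
  qed
  have f: "hol T f = - q (0, 0) + q (0, 1)"
    by (rule cong[of "\<lambda>t. (0, t)"]) (auto simp: h0 intro!: continuous_intros)
  have g: "hol T g = - q (1, 0) + q (1, 1)"
    by (rule cong[of "\<lambda>t. (1, t)"]) (auto simp: h1 intro!: continuous_intros)
  have U: "f 0 \<in> U" "f 1 \<in> U"
    using homotopic_paths_imp_subset[OF hom] by (auto simp: path_image_def)
  have "hol T (\<lambda>_. f 0) = - q (0, 0) + q (1, 0)"
    by (rule cong[of "\<lambda>t. (t, 0)"]) (auto simp: hs intro!: continuous_intros)
  then have "q (1, 0) = q (0, 0)"
    using hol_const[of T "f 0", OF flat_on_refl[OF flat U(1)]] by (metis add.inverse_inverse minus_unique)
  moreover have "hol T (\<lambda>_. f 1) = - q (0, 1) + q (1, 1)"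
    by (rule cong[of "\<lambda>t. (t, 1)"]) (auto simp: hf intro!: continuous_intros)
  then have "q (1, 1) = q (0, 1)"
    using hol_const[of T "f 1", OF flat_on_refl[OF flat U(2)]] by (metis add.inverse_inverse minus_unique)
  ultimately show ?thesis using f g by simp
qed

text \<open>The contractibility criterion used below: for the meridian of one component, whose disc
  misses another component, and for a loop that lies in a ball of the split picture.\<close>

lemma hol_convex_loop:
  fixes F :: "'b::real_normed_vector \<Rightarrow> 'a::metric_space"
  assumes "flat_on U T" "compact C" "convex C" "continuous_on C F" "F ` C \<subseteq> U"
    and "path g" "path_image g \<subseteq> C" "pathstart g = pathfinish g"
  shows "hol T (F \<circ> g) = 0"
proof -
  obtain q where "develops T F C q" using develops_exists[OF assms(1-5)] by blast
  from hol_compose[OF this assms(6,7)] show ?thesis by (simp add: assms(8))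
qed

text \<open>A degree-one reparametrization moves the base point of the loop, which conjugates the
  holonomy by the transport from parameter 0 to parameter \<open>\<phi> 0\<close>.\<close>

lemma hol_reparametrize:
  fixes K :: "real \<Rightarrow> 'a::metric_space" and \<phi> :: "real \<Rightarrow> real"
  assumes flat: "flat_on U T" and K: "continuous_on UNIV K" "range K \<subseteq> U" "\<And>t. K (t + 1) = K t"
    and \<phi>: "continuous_on UNIV \<phi>" "\<phi> 1 = \<phi> 0 + 1"
  shows "\<exists>x. hol T (\<lambda>t. K (\<phi> t)) = - x + hol T K + x"
proof -
  define M where "M = \<bar>\<phi> 0\<bar> + 1"
  obtain b where b: "\<And>t. t \<in> {0..1} \<Longrightarrow> \<bar>\<phi> t\<bar> \<le> b"
  proof -
    have "compact (\<phi> ` {0..1})"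
      by (intro compact_continuous_image continuous_on_subset[OF \<phi>(1)]) auto
    then have "bounded (\<phi> ` {0..1})" by (rule compact_imp_bounded)
    then obtain a where "\<forall>x\<in>\<phi> ` {0..1}. norm x \<le> a" unfolding bounded_iff by blast
    then show ?thesis using that[of a] by auto
  qed
  define I where "I = {-(\<bar>b\<bar> + M)..\<bar>b\<bar> + M + 1}"
  obtain q where q: "develops T K I q"
    using develops_exists[OF flat, of I K] K by (auto simp: I_def intro: continuous_on_subset)
  have shift: "develops T (\<lambda>t. K (t + 1)) {-(\<bar>b\<bar> + M)..\<bar>b\<bar> + M} (\<lambda>t. q (t + 1))"
    by (intro develops_compose[OF q] continuous_intros) (auto simp: I_def)
  then have 1: "develops T K {-(\<bar>b\<bar> + M)..\<bar>b\<bar> + M} (\<lambda>t. q (t + 1))" by (simp add: K(3))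
  have 2: "develops T K {-(\<bar>b\<bar> + M)..\<bar>b\<bar> + M} q"
    using develops_subset[OF q] by (auto simp: I_def)
  \<comment> \<open>Shifting by a period gives another development of \<open>K\<close>, so
    \<open>q (t + 1) - q t\<close> is independent of \<open>t\<close>.\<close>
  have "q (0 + 1) - q 0 = q (\<phi> 0 + 1) - q (\<phi> 0)"
    by (rule develops_unique[OF 1 2]) (auto simp: M_def)
  then have *: "q (\<phi> 0 + 1) = q 1 - q 0 + q (\<phi> 0)" by (metis add_0 diff_add_cancel)
  have "develops T (\<lambda>t. K (\<phi> t)) {0..1} (\<lambda>t. q (\<phi> t))"
    proof (rule develops_compose[OF q])
    show "continuous_on {0..1} \<phi>" using \<phi>(1) by (rule continuous_on_subset) auto
    show "\<phi> ` {0..1} \<subseteq> I"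
    proof
      fix y assume "y \<in> \<phi> ` {0..1}"
      then have "\<bar>y\<bar> \<le> b" using b by auto
      then show "y \<in> I" by (auto simp: I_def M_def)
    qed
  qed
  from hol_eq[OF this] have h1: "hol T (\<lambda>t. K (\<phi> t)) = - q (\<phi> 0) + (q 1 - q 0 + q (\<phi> 0))"
    using * \<phi>(2) by simp
  have h2: "hol T K = - q 0 + q 1"
    by (rule hol_eq) (auto intro!: develops_subset[OF q] simp: I_def M_def)
  have "- (- q 0 + q (\<phi> 0)) + hol T K + (- q 0 + q (\<phi> 0)) = - q (\<phi> 0) + (q 1 - q 0 + q (\<phi> 0))"
    unfolding h2 by (simp add: minus_add diff_conv_add_uminus add.assoc del: add_uminus_conv_diff)
  then show ?thesis using h1 by metis
qed

text \<open>The domains of the transports eventually contain each compact subset of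
  \<open>S\<close>, but need never contain \<open>S\<close>; a homotopy has to be confined to a
  compact set before \<open>hol_homotopic\<close> applies.\<close>

lemma homotopic_paths_compact:
  fixes f g :: "real \<Rightarrow> 'a::topological_space"
  assumes "homotopic_paths S f g"
  shows "\<exists>C. compact C \<and> C \<subseteq> S \<and> homotopic_paths C f g"
proof -
  obtain h where h: "continuous_on ({0..1} \<times> {0..1}) h" "h ` ({0..1} \<times> {0..1}) \<subseteq> S"
    and "\<forall>x \<in> {0..1}. h (0, x) = f x" "\<forall>x \<in> {0..1}. h (1, x) = g x"
    "\<forall>t \<in> {0..1::real}. pathstart (h \<circ> Pair t) = pathstart f \<and> pathfinish (h \<circ> Pair t) = pathfinish f"
    using assms unfolding homotopic_paths by (auto simp: image_subset_iff_funcset)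
  then have "homotopic_paths (h ` ({0..1} \<times> {0..1})) f g"
    unfolding homotopic_paths by (intro exI[of _ h]) auto
  moreover have "compact (h ` ({0..1} \<times> {0..1}))"
    using h by (intro compact_continuous_image compact_Times) auto
  ultimately show ?thesis using h by blast
qed


section \<open>The real Heisenberg group\<close>

text \<open>\<open>Heis x y z\<close> is the upper unitriangular 3 by 3 matrix with
  \<open>x\<close>, \<open>y\<close> above the diagonal and \<open>z\<close> in the corner. Its
  product is written as a sum so that it fits \<open>group_add\<close>.\<close>

datatype heis = Heis (hx: real) (hy: real) (hz: real)

instantiation heis :: group_add
begin

definition "0 = Heis 0 0 0"
definition "x + y = Heis (hx x + hx y) (hy x + hy y) (hz x + hz y + hx x * hy y)"
definition "- x = Heis (- hx x) (- hy x) (- hz x + hx x * hy x)"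
definition "x - y = x + - (y :: heis)"

instance
  by standard
    (auto simp: zero_heis_def plus_heis_def uminus_heis_def minus_heis_def algebra_simps intro: heis.expand)

end

lemma heis_sel [simp]:
  "hx 0 = 0" "hy 0 = 0" "hz 0 = 0"
  "hx (x + y) = hx x + hx y" "hy (x + y) = hy x + hy y" "hz (x + y) = hz x + hz y + hx x * hy y"
  "hx (- x) = - hx x" "hy (- x) = - hy x" "hz (- x) = - hz x + hx x * hy x"
  by (simp_all add: zero_heis_def plus_heis_def uminus_heis_def)

lemma heis_central: "hx x = 0 \<Longrightarrow> hy x = 0 \<Longrightarrow> x + y = y + x"
  by (rule heis.expand) simp

lemma heis_commute: "hx x * hy y = hx y * hy x \<Longrightarrow> x + y = y + x"
  by (rule heis.expand) simp

lemma heis_minus_sel [simp]: "hx (x - y) = hx x - hx y" "hy (x - y) = hy x - hy y"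
  by (simp_all add: minus_heis_def del: add_uminus_conv_diff)

lemma heis_conj_central: "hx y = 0 \<Longrightarrow> hy y = 0 \<Longrightarrow> x + y - x = y"
  using heis_central[of y x] by (metis add_diff_cancel)

section \<open>Words in the Heisenberg group and their Magnus coefficients\<close>

lemma magnus_simps:
  "magnus w [] = 1"
  "magnus ((i, b) # w) [j] = magnus w [j] + (if i = j then (if b then 1 else -1) else 0)"
  "j \<noteq> k \<Longrightarrow> magnus ((i, b) # w) [j, k] =
     magnus w [j, k] + (if i = j then (if b then 1 else -1) * magnus w [k] else 0)"
proof -
  show nil: "magnus w [] = 1" for w
    by (induction w) (auto simp: magnus_def nc_one_def nc_mult_def magnus_letter_def nc_var_def)
  have Cons: "magnus (x # w) = nc_mult (magnus_letter x) (magnus w)" for x w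
    by (simp add: magnus_def)
  show "magnus ((i, b) # w) [j] = magnus w [j] + (if i = j then (if b then 1 else -1) else 0)"
    by (auto simp: Cons nc_mult_def nil magnus_letter_def nc_one_def nc_var_def)
  show "j \<noteq> k \<Longrightarrow> magnus ((i, b) # w) [j, k] =
     magnus w [j, k] + (if i = j then (if b then 1 else -1) * magnus w [k] else 0)"
    by (auto simp: Cons nc_mult_def nil magnus_letter_def nc_one_def nc_var_def numeral_2_eq_2 atMost_Suc)
qed

text \<open>Up to corner entries, the variables of the Magnus expansion are sent to multiples of the
  matrix units E12 and E23. Since E12 E23 = E13 and all other products of the two vanish, the corner
  sees the coefficient of \<open>[1, 2]\<close> and otherwise only the linear ones.\<close>

lemma heis_word:
  assumes m: "hy (M 1) = 0" "hx (M 2) = 0" and w: "fst ` set w \<subseteq> {1, 2 :: nat}"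
  defines "h \<equiv> foldr (\<lambda>(i, b) a. (if b then M i else - M i) + a) w 0"
  shows "hx h = hx (M 1) * magnus w [1]" "hy h = hy (M 2) * magnus w [2]"
    "hz h = hx (M 1) * hy (M 2) * magnus w [1, 2] + hz (M 1) * magnus w [1] + hz (M 2) * magnus w [2]"
  unfolding h_def using w
proof (induction w)
  case Nil
  { case 1 show ?case by (simp add: magnus_def nc_one_def) }
  { case 2 show ?case by (simp add: magnus_def nc_one_def) }
  { case 3 show ?case by (simp add: magnus_def nc_one_def) }
next
  case (Cons x w)
  obtain i b where x: "x = (i, b)" by force
  { case 1 then show ?case using Cons.IH m by (auto simp: x magnus_simps algebra_simps) }
  { case 2 then show ?case using Cons.IH m by (auto simp: x magnus_simps algebra_simps) }
  { case 3 then show ?case using Cons.IH m by (auto simp: x magnus_simps algebra_simps) }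
qed

text \<open>The coefficients depend on the word and not on \<open>E\<close>: \<open>n1\<close>
  counts the occurrences of a letter, \<open>n2\<close> the ordered pairs of positions. This
  separates the loop, which determines the word, from the transport, which determines
  \<open>E\<close>.\<close>

lemma heis_sum_list_bilinear:
  assumes "finite D" "set es \<subseteq> D"
  shows "\<exists>n1 n2. \<forall>E :: 'e \<Rightarrow> heis.
    hz (sum_list (map E es)) =
      (\<Sum>d\<in>D. n1 d * hz (E d)) + (\<Sum>d\<in>D. \<Sum>d'\<in>D. n2 d d' * (hx (E d) * hy (E d')))"
proof -
  \<comment> \<open>The formula for \<open>hy\<close> is carried along because a new first letter
    adds its \<open>hx\<close> times the \<open>hy\<close> of the tail to the corner.\<close>
  have "\<exists>n1 n2. \<forall>E :: 'e \<Rightarrow> heis. hy (sum_list (map E es)) = (\<Sum>d\<in>D. n1 d * hy (E d)) \<and>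
      hz (sum_list (map E es)) =
      (\<Sum>d\<in>D. n1 d * hz (E d)) + (\<Sum>d\<in>D. \<Sum>d'\<in>D. n2 d d' * (hx (E d) * hy (E d')))"
    using assms(2)
  proof (induction es)
    case Nil
    show ?case by (intro exI[of _ "\<lambda>_. 0"] exI[of _ "\<lambda>_ _. 0"]) simp
  next
    case (Cons e es)
    then obtain n1 n2 where n: "\<And>E :: 'e \<Rightarrow> heis. hy (sum_list (map E es)) = (\<Sum>d\<in>D. n1 d * hy (E d)) \<and>
      hz (sum_list (map E es)) =
      (\<Sum>d\<in>D. n1 d * hz (E d)) + (\<Sum>d\<in>D. \<Sum>d'\<in>D. n2 d d' * (hx (E d) * hy (E d')))"
      by auto
    have e: "e \<in> D" using Cons.prems by simp
    have delta: "(\<Sum>d\<in>D. (n1 d + (if d = e then 1 else 0)) * f d) = f e + (\<Sum>d\<in>D. n1 d * f d)"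
      for f :: "'e \<Rightarrow> real"
      using e assms(1) by (simp add: distrib_right sum.distrib if_distrib[of "\<lambda>x. x * _"] cong: if_cong)
    have "(\<Sum>d\<in>D. \<Sum>d'\<in>D. (n2 d d' + (if d = e then n1 d' else 0)) * (hx (E d) * hy (E d'))) =
        (\<Sum>d\<in>D. \<Sum>d'\<in>D. n2 d d' * (hx (E d) * hy (E d'))) +
        (\<Sum>d\<in>D. if d = e then \<Sum>d'\<in>D. n1 d' * (hx (E d) * hy (E d')) else 0)" for E :: "'e \<Rightarrow> heis"
      unfolding sum.distrib[symmetric] by (intro sum.cong) (auto simp: sum.distrib distrib_right)
    also have "(\<Sum>d\<in>D. if d = e then \<Sum>d'\<in>D. n1 d' * (hx (E d) * hy (E d')) else 0) =
        hx (E e) * (\<Sum>d'\<in>D. n1 d' * hy (E d'))" for E :: "'e \<Rightarrow> heis"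
      using e assms(1) by (simp add: sum_distrib_left algebra_simps)
    finally have delta2: "(\<Sum>d\<in>D. \<Sum>d'\<in>D. (n2 d d' + (if d = e then n1 d' else 0)) * (hx (E d) * hy (E d'))) =
        (\<Sum>d\<in>D. \<Sum>d'\<in>D. n2 d d' * (hx (E d) * hy (E d'))) +
        hx (E e) * (\<Sum>d'\<in>D. n1 d' * hy (E d'))" for E :: "'e \<Rightarrow> heis" .
    show ?case
      by (intro exI[of _ "\<lambda>d. n1 d + (if d = e then 1 else 0)"]
           exI[of _ "\<lambda>d d'. n2 d d' + (if d = e then n1 d' else 0)"] allI)
        (simp only: list.map sum_list.Cons heis_sel delta delta2 n add_ac simp_thms)
  qed
  then show ?thesis by blast
qed

section \<open>Rank bounds\<close>

lemma homogeneous_system: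
  fixes f :: "'j \<Rightarrow> 'd \<Rightarrow> 'k::field"
  assumes "finite D" "finite J" "card D < card J"
  shows "\<exists>x. (\<exists>j\<in>J. x j \<noteq> 0) \<and> (\<forall>d\<in>D. (\<Sum>j\<in>J. x j * f j d) = 0)"
  using assms
proof (induction D arbitrary: J f)
  case empty
  then obtain j where "j \<in> J" by force
  then show ?case by (intro exI[of _ "\<lambda>_. 1"]) auto
next
  case (insert d D)
  show ?case
  proof (cases "\<forall>j\<in>J. f j d = 0")
    case True
    then show ?thesis using insert.IH[of J f] insert.prems insert.hyps by auto
  next
    case False
    then obtain i where i: "i \<in> J" "f i d \<noteq> 0" by blast
    define J' where "J' = J - {i}"
    have J: "J = insert i J'" "i \<notin> J'" "finite J'" using i insert.prems by (auto simp: J'_def)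
    obtain x where x: "\<exists>j\<in>J'. x j \<noteq> 0"
      "\<And>e. e \<in> D \<Longrightarrow> (\<Sum>j\<in>J'. x j * (f j e - f j d / f i d * f i e)) = 0"
      using insert.IH[of J' "\<lambda>j e. f j e - f j d / f i d * f i e"] insert.prems insert.hyps J by auto
    \<comment> \<open>The reduced rows vanish at \<open>d\<close>; the coefficient of the pivot row
      \<open>i\<close> collects the multiples of it that were subtracted.\<close>
    define y where "y = (\<lambda>j. if j = i then - (\<Sum>j\<in>J'. x j * f j d / f i d) else x j)"
    have "(\<Sum>j\<in>J. y j * f j e) = (\<Sum>j\<in>J'. x j * (f j e - f j d / f i d * f i e))" for e
    proof -
      have "(\<Sum>j\<in>J'. y j * f j e) = (\<Sum>j\<in>J'. x j * f j e)"
        using J by (intro sum.cong) (auto simp: y_def)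
      moreover have "y i * f i e = - (\<Sum>j\<in>J'. x j * (f j d / f i d * f i e))"
        by (simp add: y_def sum_distrib_right mult.assoc)
      ultimately show ?thesis
        using J(2,3) by (simp add: J(1) sum_subtractf right_diff_distrib)
    qed
    moreover have "(\<Sum>j\<in>J'. x j * (f j d - f j d / f i d * f i d)) = 0" using i by simp
    ultimately have "\<forall>e\<in>insert d D. (\<Sum>j\<in>J. y j * f j e) = 0" using x by auto
    moreover have "\<exists>j\<in>J. y j \<noteq> 0" using x(1) J by (auto simp: y_def)
    ultimately show ?thesis by blast
  qed
qed

text \<open>The pairing matrix is diagonal with nonzero diagonal, hence of rank
  \<open>card J\<close>, and it factors through a space of dimension \<open>card D\<close>.
  Concretely, a relation between the rows of \<open>f\<close>, paired with \<open>g k\<close>,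
  isolates its coefficient at \<open>k\<close>.\<close>

lemma card_le_of_pairing:
  fixes f g :: "'j \<Rightarrow> 'd \<Rightarrow> 'k::field"
  assumes "finite D" "finite J"
    and pair: "\<And>j k. j \<in> J \<Longrightarrow> k \<in> J \<Longrightarrow> (\<Sum>d\<in>D. f j d * g k d) = 0 \<longleftrightarrow> j \<noteq> k"
  shows "card J \<le> card D"
proof (rule ccontr)
  assume "\<not> card J \<le> card D"
  then obtain x k where k: "k \<in> J" "x k \<noteq> 0" and x: "\<forall>d\<in>D. (\<Sum>j\<in>J. x j * f j d) = 0"
    using homogeneous_system[OF assms(1,2), of f] by auto
  have "0 = (\<Sum>d\<in>D. (\<Sum>j\<in>J. x j * f j d) * g k d)" using x by simp
  also have "\<dots> = (\<Sum>j\<in>J. x j * (\<Sum>d\<in>D. f j d * g k d))"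
    by (simp add: sum_distrib_left sum_distrib_right mult.assoc) (rule sum.swap)
  also have "\<dots> = (\<Sum>j\<in>{k}. x j * (\<Sum>d\<in>D. f j d * g k d))"
    using assms(2) k(1) pair by (intro sum.mono_neutral_right) auto
  finally show False using k pair by auto
qed

section \<open>Eventual homomorphisms\<close>

text \<open>The quantifiers matter: how far along the filter one has to go may depend on
  \<open>x\<close> and \<open>y\<close>, and no single \<open>h d\<close> need be a homomorphism.
  The usual consequences survive because each involves finitely many products.\<close>

definition eventual_hom :: "'d filter \<Rightarrow> ('g, 'b) monoid_scheme \<Rightarrow> ('d \<Rightarrow> 'g \<Rightarrow> 'h::group_add) \<Rightarrow> bool" where
  "eventual_hom \<FF> G h \<longleftrightarrow>
     (\<forall>x\<in>carrier G. \<forall>y\<in>carrier G. \<forall>\<^sub>F d in \<FF>. h d (x \<otimes>\<^bsub>G\<^esub> y) = h d x + h d y)"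

context
  fixes G :: "('g, 'b) monoid_scheme" (structure) and \<FF> :: "'d filter" and h :: "'d \<Rightarrow> 'g \<Rightarrow> 'h::group_add"
  assumes G: "group G" and h: "eventual_hom \<FF> G h"
begin

interpretation group G by (rule G)

lemma eventual_hom_mult:
  "x \<in> carrier G \<Longrightarrow> y \<in> carrier G \<Longrightarrow> \<forall>\<^sub>F d in \<FF>. h d (x \<otimes> y) = h d x + h d y"
  using h unfolding eventual_hom_def by blast

lemma eventual_hom_one: "\<forall>\<^sub>F d in \<FF>. h d \<one> = 0"
  using eventual_hom_mult[OF one_closed one_closed]
proof eventually_elim
  case (elim d)
  then have "h d \<one> + 0 = h d \<one> + h d \<one>" by simp
  then show ?case using add_left_imp_eq by metis
qed

lemma eventual_hom_inv:
  assumes "x \<in> carrier G"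
  shows "\<forall>\<^sub>F d in \<FF>. h d (inv x) = - h d x"
  using eventual_hom_mult[OF assms inv_closed[OF assms]] eventual_hom_one
  by eventually_elim (use assms in \<open>simp add: minus_unique\<close>)

lemma eventual_hom_conj:
  assumes "x \<in> carrier G" "y \<in> carrier G"
  shows "\<forall>\<^sub>F d in \<FF>. h d (x \<otimes> y \<otimes> inv x) = h d x + h d y - h d x"
proof -
  have "x \<otimes> y \<in> carrier G" "inv x \<in> carrier G" using assms by auto
  from eventual_hom_mult[OF this] eventual_hom_mult[OF assms] eventual_hom_inv[OF assms(1)]
  show ?thesis by eventually_elim simp
qed

lemma eventual_hom_commutator:
  assumes "x \<in> carrier G" "y \<in> carrier G" and comm: "\<forall>\<^sub>F d in \<FF>. h d x + h d y = h d y + h d x"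
  shows "\<forall>\<^sub>F d in \<FF>. h d (x \<otimes> y \<otimes> inv x \<otimes> inv y) = 0"
proof -
  have "x \<otimes> y \<otimes> inv x \<in> carrier G" "inv y \<in> carrier G" using assms by auto
  from eventual_hom_mult[OF this] eventual_hom_conj[OF assms(1,2)] eventual_hom_inv[OF assms(2)] comm
  show ?thesis by eventually_elim simp
qed

lemma eventual_hom_generate:
  assumes "A \<subseteq> carrier G" "\<And>a. a \<in> A \<Longrightarrow> \<forall>\<^sub>F d in \<FF>. h d a = 0" "x \<in> generate G A"
  shows "\<forall>\<^sub>F d in \<FF>. h d x = 0"
  using assms(3)
proof (induction rule: generate.induct)
  case one
  show ?case by (rule eventual_hom_one)
next
  case (incl a)
  then show ?case by (rule assms(2))
next
  case (inv a)
  then have "a \<in> carrier G" using assms(1) by blast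
  from eventual_hom_inv[OF this] assms(2)[OF inv] show ?case by eventually_elim simp
next
  case (eng a b)
  then have "a \<in> carrier G" "b \<in> carrier G" using generate_incl[OF assms(1)] by blast+
  from eventual_hom_mult[OF this] eng.IH show ?case by eventually_elim simp
qed

lemma normal_closure_carrier: "A \<subseteq> carrier G \<Longrightarrow> normal_closure G A \<subseteq> carrier G"
  unfolding normal_closure_def by (rule generate_incl) auto

lemma one_in_normal_closure: "\<one> \<in> normal_closure G A"
  unfolding normal_closure_def by (rule generate.one)

lemma eventual_hom_normal_closure:
  assumes "A \<subseteq> carrier G" "\<And>a. a \<in> A \<Longrightarrow> \<forall>\<^sub>F d in \<FF>. h d a = 0" "x \<in> normal_closure G A"
  shows "\<forall>\<^sub>F d in \<FF>. h d x = 0"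
proof (rule eventual_hom_generate[OF _ _ assms(3)[unfolded normal_closure_def]])
  fix c assume "c \<in> {g \<otimes> a \<otimes> inv g |g a. g \<in> carrier G \<and> a \<in> A}"
  then obtain g a where c: "c = g \<otimes> a \<otimes> inv g" "g \<in> carrier G" "a \<in> A" by blast
  then have "a \<in> carrier G" using assms(1) by blast
  from eventual_hom_conj[OF c(2) this] assms(2)[OF c(3)]
  show "\<forall>\<^sub>F d in \<FF>. h d c = 0" by eventually_elim (simp add: c)
qed (use assms in auto)

lemma eventual_hom_r_coset:
  assumes N: "N \<subseteq> carrier G" "\<one> \<in> N" "\<And>n. n \<in> N \<Longrightarrow> \<forall>\<^sub>F d in \<FF>. h d n = 0"
    and "x \<in> carrier G" "y \<in> carrier G" "N #> x = N #> y"
  shows "\<forall>\<^sub>F d in \<FF>. h d x = h d y"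
proof -
  have "x \<in> N #> x" using N(2) assms(4) by (force simp: r_coset_def)
  then obtain n where n: "n \<in> N" "x = n \<otimes> y" using assms(6) by (auto simp: r_coset_def)
  then have "n \<in> carrier G" using N by blast
  from eventual_hom_mult[OF this assms(5)] N(3)[OF n(1)]
  show ?thesis by eventually_elim (simp add: n)
qed

lemma eval_word_carrier:
  assumes "\<And>i. i \<in> fst ` set w \<Longrightarrow> m i \<in> carrier G"
  shows "eval_word G m w \<in> carrier G"
  using assms by (induction w) (auto simp: eval_word_def split: prod.splits)

lemma eventual_hom_eval_word:
  assumes "\<And>i. i \<in> fst ` set w \<Longrightarrow> m i \<in> carrier G"
  shows "\<forall>\<^sub>F d in \<FF>. h d (eval_word G m w) =
    foldr (\<lambda>(i, b) a. (if b then h d (m i) else - h d (m i)) + a) w 0"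
  using assms
proof (induction w)
  case Nil
  show ?case using eventual_hom_one by (simp add: eval_word_def)
next
  case (Cons x w)
  obtain i b where x: "x = (i, b)" by force
  have i: "m i \<in> carrier G" using Cons.prems[of i] by (simp add: x)
  define u where "u = (if b then m i else inv (m i))"
  have u: "u \<in> carrier G" "\<forall>\<^sub>F d in \<FF>. h d u = (if b then h d (m i) else - h d (m i))"
    using i eventual_hom_inv[OF i] by (auto simp: u_def)
  have w: "eval_word G m w \<in> carrier G" by (rule eval_word_carrier) (use Cons.prems in auto)
  have IH: "\<forall>\<^sub>F d in \<FF>. h d (eval_word G m w) =
    foldr (\<lambda>(i, b) a. (if b then h d (m i) else - h d (m i)) + a) w 0"
    by (rule Cons.IH) (use Cons.prems in auto)
  have *: "eval_word G m (x # w) = u \<otimes> eval_word G m w"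
    by (simp add: eval_word_def x u_def)
  show ?case
    using IH u(2) eventual_hom_mult[OF u(1) w] unfolding * by eventually_elim (simp add: x)
qed

end

lemma eventual_hom_derived:
  fixes h :: "'d \<Rightarrow> 'g \<Rightarrow> 'h::ab_group_add"
  assumes G: "group G" and h: "eventual_hom \<FF> G h" and x: "x \<in> derived G (carrier G)"
  shows "\<forall>\<^sub>F d in \<FF>. h d x = 0"
proof -
  interpret group G by (rule G)
  show ?thesis
  proof (rule eventual_hom_generate[OF G h _ _ x[unfolded derived_def]])
    show "\<forall>\<^sub>F d in \<FF>. h d a = 0" if "a \<in> (\<Union>h1\<in>carrier G. \<Union>h2\<in>carrier G. {h1 \<otimes>\<^bsub>G\<^esub> h2 \<otimes>\<^bsub>G\<^esub> inv\<^bsub>G\<^esub> h1 \<otimes>\<^bsub>G\<^esub> inv\<^bsub>G\<^esub> h2})" for a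
      using that by (auto intro!: eventual_hom_commutator[OF G h] simp: add.commute)
  qed auto
qed

section \<open>Holonomy on the fundamental group\<close>

text \<open>A flat transport is only available off a small neighbourhood of a link. As the neighbourhood
  shrinks, every compact set is eventually covered, and so holonomy becomes an eventual homomorphism.\<close>

locale flat_family =
  fixes S :: "'a::real_normed_vector set" and \<FF> :: "'d filter"
    and U :: "'d \<Rightarrow> 'a set" and T :: "'d \<Rightarrow> 'a \<Rightarrow> 'a \<Rightarrow> 'h::group_add"
  assumes flat: "\<forall>\<^sub>F d in \<FF>. flat_on (U d) (T d)"
    and exhaust: "compact C \<Longrightarrow> C \<subseteq> S \<Longrightarrow> \<forall>\<^sub>F d in \<FF>. C \<subseteq> U d"
begin

lemma eventually_hol_homotopic:
  assumes "homotopic_paths S f g"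
  shows "\<forall>\<^sub>F d in \<FF>. hol (T d) f = hol (T d) g"
proof -
  obtain C where C: "compact C" "C \<subseteq> S" "homotopic_paths C f g"
    using homotopic_paths_compact[OF assms] by blast
  show ?thesis
    using flat exhaust[OF C(1,2)]
    by eventually_elim (rule hol_homotopic, assumption, rule homotopic_paths_subset[OF C(3)])
qed

lemma eventually_path_image:
  "path f \<Longrightarrow> path_image f \<subseteq> S \<Longrightarrow> \<forall>\<^sub>F d in \<FF>. path_image f \<subseteq> U d"
  by (rule exhaust) (rule compact_path_image)

lemma eventually_hol_join:
  assumes "path f" "path_image f \<subseteq> S" "path g" "path_image g \<subseteq> S" "pathfinish f = pathstart g"
  shows "\<forall>\<^sub>F d in \<FF>. hol (T d) (f +++ g) = hol (T d) f + hol (T d) g"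
  using flat eventually_path_image[OF assms(1,2)] eventually_path_image[OF assms(3,4)]
  by eventually_elim (use assms in \<open>auto intro: hol_join\<close>)

lemma eventually_hol_reversepath:
  assumes "path f" "path_image f \<subseteq> S"
  shows "\<forall>\<^sub>F d in \<FF>. hol (T d) (reversepath f) = - hol (T d) f"
  using flat eventually_path_image[OF assms]
  by eventually_elim (use assms in \<open>auto intro: hol_reversepath\<close>)

text \<open>The representative is chosen once for all \<open>d\<close>. Homotopic loops have the
  same holonomy only eventually, so independence of the representative is an eventual statement
  too.\<close>

definition Hol :: "'d \<Rightarrow> (real \<Rightarrow> 'a) set \<Rightarrow> 'h" where
  "Hol d A = hol (T d) (SOME f. f \<in> A)"

lemma Hol_loop_class:
  assumes "f \<in> loops_at S p"
  shows "\<forall>\<^sub>F d in \<FF>. Hol d (loop_class S f) = hol (T d) f"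
proof -
  have "f \<in> loop_class S f" using assms by (simp add: loop_class_def loops_at_def)
  then have "(SOME g. g \<in> loop_class S f) \<in> loop_class S f"
    by (rule someI[where P = "\<lambda>g. g \<in> loop_class S f"])
  then have "homotopic_paths S f (SOME g. g \<in> loop_class S f)" by (simp add: loop_class_def)
  from eventually_hol_homotopic[OF this] show ?thesis
    unfolding Hol_def by eventually_elim simp
qed

lemma eventual_hom_Hol: "eventual_hom \<FF> (fundamental_group S p) Hol"
  unfolding eventual_hom_def
proof (intro ballI)
  fix x y assume "x \<in> carrier (fundamental_group S p)" "y \<in> carrier (fundamental_group S p)"
  then obtain f g where fg: "f \<in> loops_at S p" "g \<in> loops_at S p"
    and xy: "x = loop_class S f" "y = loop_class S g"
    by (auto simp: fundamental_group_def)
  have "f +++ g \<in> loops_at S p" using fg by (auto simp: loops_at_def path_image_join)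
  from Hol_loop_class[OF this] Hol_loop_class[OF fg(1)] Hol_loop_class[OF fg(2)]
  have "\<forall>\<^sub>F d in \<FF>. hol (T d) (f +++ g) = hol (T d) f + hol (T d) g \<longrightarrow>
     Hol d (loop_class S (f +++ g)) = Hol d x + Hol d y"
    by eventually_elim (simp add: xy)
  moreover have "\<forall>\<^sub>F d in \<FF>. hol (T d) (f +++ g) = hol (T d) f + hol (T d) g"
    using fg by (intro eventually_hol_join) (auto simp: loops_at_def)
  ultimately show "\<forall>\<^sub>F d in \<FF>. Hol d (x \<otimes>\<^bsub>fundamental_group S p\<^esub> y) = Hol d x + Hol d y"
    unfolding xy mult_fundamental_group[OF fg] by eventually_elim simp
qed

lemma based_class_Hol:
  assumes A: "A \<in> based_classes S p c" and c: "path c" "path_image c \<subseteq> S" "pathstart c = pathfinish c"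
  shows "A \<in> carrier (fundamental_group S p)"
    and "\<forall>\<^sub>F d in \<FF>. \<exists>x. Hol d A = x + hol (T d) c - x"
proof -
  obtain \<alpha> where A_eq: "A = loop_class S (\<alpha> +++ c +++ reversepath \<alpha>)"
    and \<alpha>: "path \<alpha>" "path_image \<alpha> \<subseteq> S" "pathstart \<alpha> = p" "pathfinish \<alpha> = pathstart c"
    using A unfolding based_classes_def by blast
  have loop: "\<alpha> +++ c +++ reversepath \<alpha> \<in> loops_at S p"
    using \<alpha> c by (auto simp: loops_at_def path_image_join)
  then show "A \<in> carrier (fundamental_group S p)" by (auto simp: A_eq fundamental_group_def)
  have "\<forall>\<^sub>F d in \<FF>. hol (T d) (\<alpha> +++ c +++ reversepath \<alpha>) = hol (T d) \<alpha> + hol (T d) (c +++ reversepath \<alpha>)"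
    using \<alpha> c by (intro eventually_hol_join) (auto simp: path_image_join)
  moreover have "\<forall>\<^sub>F d in \<FF>. hol (T d) (c +++ reversepath \<alpha>) = hol (T d) c + hol (T d) (reversepath \<alpha>)"
    using \<alpha> c by (intro eventually_hol_join) auto
  ultimately show "\<forall>\<^sub>F d in \<FF>. \<exists>x. Hol d A = x + hol (T d) c - x"
    using Hol_loop_class[OF loop] eventually_hol_reversepath[OF \<alpha>(1,2)]
  proof eventually_elim
    case (elim d)
    then have "Hol d A = hol (T d) \<alpha> + hol (T d) c - hol (T d) \<alpha>"
      by (simp add: A_eq add.assoc diff_conv_add_uminus del: add_uminus_conv_diff)
    then show ?case by blast
  qed
qed

end

text \<open>With abelian values, holonomy ignores conjugation and kills commutators, so it factors
  through first homology. This is how a vanishing linking number is used.\<close>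

lemma flat_family_null_homologous:
  fixes T :: "'d \<Rightarrow> 'a::real_normed_vector \<Rightarrow> 'a \<Rightarrow> 'h::ab_group_add"
  assumes "flat_family S \<FF> U T" and p: "p \<in> S" and A: "A \<in> based_classes S p c"
    and c: "path c" "path_image c \<subseteq> S" "pathstart c = pathfinish c"
    and D: "derived (fundamental_group S p) (carrier (fundamental_group S p)) #>\<^bsub>fundamental_group S p\<^esub> A =
      derived (fundamental_group S p) (carrier (fundamental_group S p)) #>\<^bsub>fundamental_group S p\<^esub> \<one>\<^bsub>fundamental_group S p\<^esub>"
  shows "\<forall>\<^sub>F d in \<FF>. hol (T d) c = 0"
proof -
  interpret flat_family S \<FF> U T by fact
  let ?G = "fundamental_group S p"
  interpret G: group ?G by (rule group_fundamental_group[OF p])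
  have hom: "eventual_hom \<FF> ?G Hol" by (rule eventual_hom_Hol)
  have G: "group ?G" by (rule group_fundamental_group[OF p])
  have "derived ?G (carrier ?G) \<subseteq> carrier ?G" by (simp add: G.derived_in_carrier)
  moreover have "\<one>\<^bsub>?G\<^esub> \<in> derived ?G (carrier ?G)" unfolding derived_def by (rule generate.one)
  ultimately have "\<forall>\<^sub>F d in \<FF>. Hol d A = Hol d \<one>\<^bsub>?G\<^esub>"
    using eventual_hom_r_coset[OF G hom _ _ eventual_hom_derived[OF G hom] _ _ D] based_class_Hol(1)[OF A c]
    by blast
  with eventual_hom_one[OF G hom] based_class_Hol(2)[OF A c]
  show ?thesis by eventually_elim auto
qed


section \<open>Continuously differentiable vector fields\<close>

text \<open>The derivative is an explicit argument because curl and divergence are read off from it.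
  In finite dimension it is enough to ask for continuity in each fixed direction
  \<open>u\<close>.\<close>

definition C1_on ::
    "'a::euclidean_space set \<Rightarrow> ('a \<Rightarrow> 'b::real_normed_vector) \<Rightarrow> ('a \<Rightarrow> 'a \<Rightarrow> 'b) \<Rightarrow> bool" where
  "C1_on U f f' \<longleftrightarrow>
     (\<forall>x\<in>U. (f has_derivative f' x) (at x)) \<and> (\<forall>u. continuous_on U (\<lambda>x. f' x u))"

lemma C1_onD: "C1_on U f f' \<Longrightarrow> x \<in> U \<Longrightarrow> (f has_derivative f' x) (at x)"
  unfolding C1_on_def by blast

lemma C1_on_linear: "C1_on U f f' \<Longrightarrow> x \<in> U \<Longrightarrow> linear (f' x)"
  using C1_onD has_derivative_linear by blast

lemma C1_on_subset: "C1_on U f f' \<Longrightarrow> V \<subseteq> U \<Longrightarrow> C1_on V f f'"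
  unfolding C1_on_def by (meson continuous_on_subset subsetD)

lemma C1_on_continuous: "C1_on U f f' \<Longrightarrow> continuous_on U f"
  by (meson C1_onD continuous_at_imp_continuous_on has_derivative_continuous)

lemma C1_on_continuous_compose:
  assumes "C1_on U f f'" "continuous_on S g" "g ` S \<subseteq> U"
  shows "continuous_on S (\<lambda>s. f (g s))"
  using continuous_on_compose2[OF C1_on_continuous[OF assms(1)] assms(2,3)] .

lemma C1_on_continuous_derivative:
  assumes f: "C1_on U f f'" and g: "continuous_on S g" "g ` S \<subseteq> U" and h: "continuous_on S h"
  shows "continuous_on S (\<lambda>s. f' (g s) (h s))"
proof -
  have *: "f' (g s) (h s) = (\<Sum>i\<in>Basis. (h s \<bullet> i) *\<^sub>R f' (g s) i)" if "s \<in> S" for s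
  proof -
    have "linear (f' (g s))" using C1_on_linear[OF f] g(2) that by blast
    then show ?thesis
      by (subst euclidean_representation[of "h s", symmetric])
        (simp only: linear_sum linear_cmul)
  qed
  have "continuous_on S (\<lambda>s. \<Sum>i\<in>Basis. (h s \<bullet> i) *\<^sub>R f' (g s) i)"
  proof (intro continuous_intros h)
    fix i :: 'a
    have "continuous_on U (\<lambda>x. f' x i)" using f unfolding C1_on_def by blast
    from continuous_on_compose2[OF this g] show "continuous_on S (\<lambda>s. f' (g s) i)" .
  qed
  then show ?thesis using * by (simp cong: continuous_on_cong)
qed

lemma C1_on_add:
  "C1_on U f f' \<Longrightarrow> C1_on U g g' \<Longrightarrow> C1_on U (\<lambda>x. f x + g x) (\<lambda>x u. f' x u + g' x u)"
  unfolding C1_on_def by (auto intro!: has_derivative_add continuous_intros)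

lemma C1_on_minus: "C1_on U f f' \<Longrightarrow> C1_on U (\<lambda>x. - f x) (\<lambda>x u. - f' x u)"
  unfolding C1_on_def by (auto intro!: has_derivative_minus continuous_intros)

lemma C1_on_bilinear:
  assumes "bounded_bilinear p" and f: "C1_on U f f'" and g: "C1_on U g g'"
  shows "C1_on U (\<lambda>x. p (f x) (g x)) (\<lambda>x u. p (f x) (g' x u) + p (f' x u) (g x))"
proof -
  interpret bounded_bilinear p by fact
  show ?thesis
    unfolding C1_on_def
  proof (intro conjI ballI allI)
    fix x assume "x \<in> U"
    then show "((\<lambda>x. p (f x) (g x)) has_derivative (\<lambda>u. p (f x) (g' x u) + p (f' x u) (g x))) (at x)"
      by (intro FDERIV C1_onD[OF f] C1_onD[OF g])
  next
    fix u show "continuous_on U (\<lambda>x. p (f x) (g' x u) + p (f' x u) (g x))"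
      using C1_on_continuous[OF f] C1_on_continuous[OF g] f g unfolding C1_on_def
      by (intro continuous_on_add continuous_on) auto
  qed
qed

lemma C1_on_integral:
  fixes f :: "'a::euclidean_space \<Rightarrow> real \<Rightarrow> 'b::euclidean_space"
  assumes U: "open U" "convex U"
    and deriv: "\<And>x t. x \<in> U \<Longrightarrow> t \<in> {0..1} \<Longrightarrow> ((\<lambda>x. f x t) has_derivative f' x t) (at x)"
    and cont': "\<And>u. continuous_on (U \<times> {0..1}) (\<lambda>(x, t). f' x t u)"
    and cont: "\<And>x. x \<in> U \<Longrightarrow> continuous_on {0..1} (f x)"
  shows "C1_on U (\<lambda>x. integral {0..1} (f x)) (\<lambda>x u. integral {0..1} (\<lambda>t. f' x t u))"
  unfolding C1_on_def
proof (intro conjI ballI allI)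
  \<comment> \<open>Packing the derivative into a bounded linear map turns continuity in each
    direction into continuity in norm, as \<open>leibniz_rule\<close> demands.\<close>
  define F where "F x t = Blinfun (f' x t)" for x t
  have F: "blinfun_apply (F x t) = f' x t" if "x \<in> U" "t \<in> {0..1}" for x t
    unfolding F_def by (rule bounded_linear_Blinfun_apply) (use deriv[OF that] has_derivative_bounded_linear in blast)
  have F_cont: "continuous_on (U \<times> {0..1}) (\<lambda>(x, t). F x t)"
  proof -
    have "continuous_on (U \<times> {0..1}) (\<lambda>z. F (fst z) (snd z))"
    proof (rule continuous_on_blinfun_componentwise)
      fix i :: 'a
      have "continuous_on (U \<times> {0..1}) (\<lambda>z. f' (fst z) (snd z) i)"
        using cont'[of i] by (simp add: case_prod_unfold)
      then show "continuous_on (U \<times> {0..1}) (\<lambda>z. blinfun_apply (F (fst z) (snd z)) i)"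
        by (rule continuous_on_eq) (auto simp: F)
    qed
    then show ?thesis by (simp add: case_prod_unfold)
  qed
  fix x assume x: "x \<in> U"
  have F_int: "F x integrable_on {0..1}"
  proof (rule integrable_continuous_real)
    show "continuous_on {0..1} (F x)"
      using continuous_on_compose2[OF F_cont continuous_on_Pair[OF continuous_on_const continuous_on_id, of "{0..1}" x]] x
      by auto
  qed
  have "((\<lambda>x. integral (cbox 0 1) (f x)) has_derivative blinfun_apply (integral (cbox 0 1) (F x))) (at x within U)"
  proof (rule leibniz_rule)
    show "((\<lambda>x. f x t) has_derivative blinfun_apply (F y t)) (at y within U)" if "y \<in> U" "t \<in> cbox 0 1" for y t
      using deriv[of y t] that by (auto simp: F intro: has_derivative_at_withinI)
    show "f y integrable_on cbox 0 1" if "y \<in> U" for y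
      using cont[OF that] by (auto intro: integrable_continuous_real)
  qed (use F_cont x U in auto)
  then have "((\<lambda>x. integral {0..1} (f x)) has_derivative blinfun_apply (integral {0..1} (F x))) (at x)"
    unfolding at_within_open[OF x U(1)] cbox_interval .
  moreover have "blinfun_apply (integral {0..1} (F x)) = (\<lambda>u. integral {0..1} (\<lambda>t. f' x t u))"
  proof
    fix u
    show "blinfun_apply (integral {0..1} (F x)) u = integral {0..1} (\<lambda>t. f' x t u)"
      unfolding blinfun_apply_integral[OF F_int]
      by (rule Henstock_Kurzweil_Integration.integral_cong) (simp add: F[OF x])
  qed
  ultimately show "((\<lambda>x. integral {0..1} (f x)) has_derivative (\<lambda>u. integral {0..1} (\<lambda>t. f' x t u))) (at x)"
    by simp
next
  fix u show "continuous_on U (\<lambda>x. integral {0..1} (\<lambda>t. f' x t u))"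
    using integral_continuous_on_param[of U 0 1 "\<lambda>x t. f' x t u"] cont'[of u] by simp
qed

section \<open>Line integrals\<close>

definition lint :: "('a::euclidean_space \<Rightarrow> 'a) \<Rightarrow> 'a \<Rightarrow> 'a \<Rightarrow> real" where
  "lint A x y = integral {0..1} (\<lambda>s. A (x + s *\<^sub>R (y - x)) \<bullet> (y - x))"

text \<open>Symmetry of the derivative says that the 1-form with coefficients \<open>A\<close> is
  closed.\<close>

definition sym_deriv_on :: "'a::euclidean_space set \<Rightarrow> ('a \<Rightarrow> 'a \<Rightarrow> 'a) \<Rightarrow> bool" where
  "sym_deriv_on U A' \<longleftrightarrow> (\<forall>x\<in>U. \<forall>u v. A' x u \<bullet> v = A' x v \<bullet> u)"

lemma segment_point_in_convex:
  "convex U \<Longrightarrow> x \<in> U \<Longrightarrow> y \<in> U \<Longrightarrow> s \<in> {0..1} \<Longrightarrow> x + s *\<^sub>R (y - x) \<in> U"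
  using convexD_alt[of U x y s] by (simp add: algebra_simps)

lemma lint_cong:
  assumes "convex U" "x \<in> U" "y \<in> U" "\<And>z. z \<in> U \<Longrightarrow> A z = B z"
  shows "lint A x y = lint B x y"
  unfolding lint_def using assms by (intro integral_cong) (auto simp: segment_point_in_convex)

lemma integral_along_curve:
  assumes f: "\<And>t. t \<in> {a..b} \<Longrightarrow> (f has_derivative (\<lambda>u. A (g t) \<bullet> u)) (at (g t))"
    and g: "\<And>t. t \<in> {a..b} \<Longrightarrow> (g has_vector_derivative g' t) (at t)" and "a \<le> b"
  shows "((\<lambda>t. A (g t) \<bullet> g' t) has_integral (f (g b) - f (g a))) {a..b}"
proof (rule fundamental_theorem_of_calculus[OF \<open>a \<le> b\<close>])
  fix t assume t: "t \<in> {a..b}"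
  have "((\<lambda>t. f (g t)) has_derivative (\<lambda>s. A (g t) \<bullet> (s *\<^sub>R g' t))) (at t)"
    using has_derivative_compose[OF g[OF t, unfolded has_vector_derivative_def] f[OF t]] .
  then show "((\<lambda>t. f (g t)) has_vector_derivative A (g t) \<bullet> g' t) (at t within {a..b})"
    by (auto simp: has_vector_derivative_def intro: has_derivative_at_withinI)
qed

lemma lint_primitive:
  assumes "convex U" "x \<in> U" "y \<in> U"
    and f: "\<And>z. z \<in> U \<Longrightarrow> (f has_derivative (\<lambda>u. A z \<bullet> u)) (at z)"
  shows "lint A x y = f y - f x"
proof -
  have "((\<lambda>s. A (x + s *\<^sub>R (y - x)) \<bullet> (y - x)) has_integral
      (f (x + 1 *\<^sub>R (y - x)) - f (x + 0 *\<^sub>R (y - x)))) {0..1}"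
  proof (rule integral_along_curve)
    fix t :: real assume "t \<in> {0..1}"
    then show "(f has_derivative (\<lambda>u. A (x + t *\<^sub>R (y - x)) \<bullet> u)) (at (x + t *\<^sub>R (y - x)))"
      using assms by (auto intro!: f segment_point_in_convex)
    show "((\<lambda>s. x + s *\<^sub>R (y - x)) has_vector_derivative (y - x)) (at t)"
      by (auto intro!: derivative_eq_intros)
  qed auto
  then show ?thesis unfolding lint_def by (simp add: integral_unique)
qed

text \<open>The Poincare lemma for 1-forms, by integration along the segments that start at
  \<open>p\<close>.\<close>

lemma lint_has_derivative:
  fixes A :: "'a::euclidean_space \<Rightarrow> 'a"
  assumes U: "open U" "convex U" and A: "C1_on U A A'" and sym: "sym_deriv_on U A'"
    and p: "p \<in> U" and x: "x \<in> U"
  shows "(lint A p has_derivative (\<lambda>u. A x \<bullet> u)) (at x)"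
proof -
  define f where "f x s = A (p + s *\<^sub>R (x - p)) \<bullet> (x - p)" for x s
  define f' where "f' x s u = A' (p + s *\<^sub>R (x - p)) (s *\<^sub>R u) \<bullet> (x - p) + A (p + s *\<^sub>R (x - p)) \<bullet> u" for x s u
  have seg: "p + s *\<^sub>R (y - p) \<in> U" if "y \<in> U" "s \<in> {0..1}" for y s
    using segment_point_in_convex[OF U(2) p that] .
  have pt: "continuous_on (U \<times> {0..1}) (\<lambda>z. p + snd z *\<^sub>R (fst z - p))"
    "(\<lambda>z. p + snd z *\<^sub>R (fst z - p)) ` (U \<times> {0..1}) \<subseteq> U"
    using seg by (auto intro!: continuous_intros)
  have "C1_on U (\<lambda>x. integral {0..1} (f x)) (\<lambda>x u. integral {0..1} (\<lambda>s. f' x s u))"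
  proof (rule C1_on_integral[OF U])
    fix y s assume "y \<in> U" and s: "s \<in> {0..1::real}"
    have "((\<lambda>y. p + s *\<^sub>R (y - p)) has_derivative (\<lambda>u. s *\<^sub>R u)) (at y)"
      by (auto intro!: derivative_eq_intros)
    from has_derivative_compose[OF this C1_onD[OF A seg[OF \<open>y \<in> U\<close> s]]]
    have "((\<lambda>y. A (p + s *\<^sub>R (y - p))) has_derivative (\<lambda>u. A' (p + s *\<^sub>R (y - p)) (s *\<^sub>R u))) (at y)" .
    moreover have "((\<lambda>y. y - p) has_derivative (\<lambda>u. u)) (at y)"
      by (auto intro!: derivative_eq_intros)
    ultimately show "((\<lambda>y. f y s) has_derivative f' y s) (at y)"
      unfolding f_def f'_def using has_derivative_inner by (fastforce simp: add.commute)
  next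
    fix u show "continuous_on (U \<times> {0..1}) (\<lambda>(y, s). f' y s u)"
      unfolding f'_def case_prod_unfold
      by (intro continuous_intros C1_on_continuous_derivative[OF A pt] C1_on_continuous_compose[OF A pt])
  next
    fix y assume "y \<in> U"
    then show "continuous_on {0..1} (f y)"
      unfolding f_def using seg
      by (intro continuous_intros C1_on_continuous_compose[OF A]) auto
  qed
  moreover have "integral {0..1} (\<lambda>s. f' x s u) = A x \<bullet> u" for u
  proof -
    \<comment> \<open>Closedness identifies the integrand with the derivative in \<open>s\<close> of
      \<open>s\<close> times \<open>A \<bullet> u\<close> along the segment.\<close>
    have "((\<lambda>s. f' x s u) has_integral (1 *\<^sub>R (A (p + 1 *\<^sub>R (x - p)) \<bullet> u) - 0 *\<^sub>R (A (p + 0 *\<^sub>R (x - p)) \<bullet> u))) {0..1}"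
    proof (rule fundamental_theorem_of_calculus)
      fix s :: real assume s: "s \<in> {0..1}"
      let ?z = "p + s *\<^sub>R (x - p)"
      have lin: "linear (A' ?z)" by (rule C1_on_linear[OF A seg[OF x s]])
      have "((\<lambda>s. p + s *\<^sub>R (x - p)) has_derivative (\<lambda>h. h *\<^sub>R (x - p))) (at s)"
        by (auto intro!: derivative_eq_intros)
      from has_derivative_compose[OF this C1_onD[OF A seg[OF x s]]]
      have "((\<lambda>s. A (p + s *\<^sub>R (x - p))) has_derivative (\<lambda>h. A' ?z (h *\<^sub>R (x - p)))) (at s)" .
      then have "((\<lambda>s. s *\<^sub>R (A (p + s *\<^sub>R (x - p)) \<bullet> u)) has_derivative
          (\<lambda>h. s *\<^sub>R (A' ?z (h *\<^sub>R (x - p)) \<bullet> u) + h *\<^sub>R (A ?z \<bullet> u))) (at s)"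
        by (auto intro!: derivative_eq_intros)
      moreover have "s *\<^sub>R (A' ?z (h *\<^sub>R (x - p)) \<bullet> u) + h *\<^sub>R (A ?z \<bullet> u) = h *\<^sub>R f' x s u" for h
      proof -
        have "A' ?z u \<bullet> (x - p) = A' ?z (x - p) \<bullet> u"
          using sym seg[OF x s] unfolding sym_deriv_on_def by blast
        then show ?thesis
          unfolding f'_def linear_cmul[OF lin] inner_scaleR_left real_scaleR_def by (simp only: distrib_left mult_ac)
      qed
      ultimately show "((\<lambda>s. s *\<^sub>R (A (p + s *\<^sub>R (x - p)) \<bullet> u)) has_vector_derivative f' x s u) (at s within {0..1})"
        by (auto simp: has_vector_derivative_def intro: has_derivative_at_withinI)
    qed simp
    then show ?thesis by (simp add: integral_unique)
  qed
  ultimately have "((\<lambda>x. integral {0..1} (f x)) has_derivative (\<lambda>u. A x \<bullet> u)) (at x)"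
    using C1_onD[OF _ x] by fastforce
  then show ?thesis by (simp add: f_def[abs_def] lint_def[abs_def])
qed

text \<open>On a ball about \<open>x\<close> the function \<open>lint A x\<close> is a primitive,
  and \<open>lint A y z\<close> is a difference of its values, whence the cocycle identity.\<close>

lemma flat_on_lint:
  assumes U: "open U" and A: "C1_on U A A'" and sym: "sym_deriv_on U A'"
  shows "flat_on U (lint A)"
  unfolding flat_on_def
proof
  fix x assume "x \<in> U"
  then obtain r where r: "r > 0" "ball x r \<subseteq> U" using U openE by blast
  have sub: "C1_on (ball x r) A A'" "sym_deriv_on (ball x r) A'"
    using r(2) C1_on_subset[OF A] sym unfolding sym_deriv_on_def by auto
  have *: "lint A y z = lint A x z - lint A x y" if "y \<in> ball x r" "z \<in> ball x r" for y z
    by (rule lint_primitive[of "ball x r"])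
      (use that r lint_has_derivative[OF open_ball convex_ball sub, of x] in auto)
  have "lint A y z + lint A z w = lint A y w" if "y \<in> ball x r" "z \<in> ball x r" "w \<in> ball x r" for y z w
    using *[OF that(1,2)] *[OF that(2,3)] *[OF that(1,3)] by linarith
  then show "\<exists>r>0. \<forall>y\<in>ball x r. \<forall>z\<in>ball x r. \<forall>w\<in>ball x r. lint A y z + lint A z w = lint A y w"
    using r(1) by blast
qed

text \<open>The running integral is a development, because over short times it is a difference of
  values of a local primitive.\<close>

lemma hol_lint:
  assumes U: "open U" and A: "C1_on U A A'" and sym: "sym_deriv_on U A'"
    and g: "\<And>t. t \<in> {0..1} \<Longrightarrow> (g has_vector_derivative g' t) (at t)" and g': "continuous_on {0..1} g'"
    and gU: "g ` {0..1} \<subseteq> U"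
  shows "hol (lint A) g = integral {0..1} (\<lambda>t. A (g t) \<bullet> g' t)"
proof -
  define q where "q t = integral {0..t} (\<lambda>t. A (g t) \<bullet> g' t)" for t
  have g_cont: "continuous_on {0..1} g"
    using g by (meson continuous_at_imp_continuous_on has_vector_derivative_continuous)
  have integrable: "(\<lambda>t. A (g t) \<bullet> g' t) integrable_on {a..b}" if "{a..b} \<subseteq> {0..1}" for a b
    by (rule integrable_continuous_real, rule continuous_on_subset[OF _ that])
      (intro continuous_intros g' C1_on_continuous_compose[OF A g_cont gU])
  have diff: "q t - q s = integral {s..t} (\<lambda>t. A (g t) \<bullet> g' t)" if "0 \<le> s" "s \<le> t" "t \<le> 1" for s t
    using Henstock_Kurzweil_Integration.integral_combine[OF that(1,2) integrable] that by (auto simp: q_def)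
  have "develops (lint A) g {0..1} q"
    unfolding develops_def
  proof
    fix s :: real assume s: "s \<in> {0..1}"
    then have "g s \<in> U" using gU by auto
    then obtain r where r: "r > 0" "ball (g s) r \<subseteq> U" using U openE by blast
    obtain d where d: "d > 0" "\<And>t. t \<in> {0..1} \<Longrightarrow> dist t s < d \<Longrightarrow> dist (g t) (g s) < r"
      using g_cont r(1) s unfolding continuous_on_iff by blast
    have sub: "C1_on (ball (g s) r) A A'" "sym_deriv_on (ball (g s) r) A'"
      using r(2) C1_on_subset[OF A] sym unfolding sym_deriv_on_def by auto
    have prim: "(lint A (g s) has_derivative (\<lambda>u. A x \<bullet> u)) (at x)" if "x \<in> ball (g s) r" for x
      using lint_has_derivative[OF open_ball convex_ball sub _ that] r(1) by simp
    have step: "integral {a..b} (\<lambda>t. A (g t) \<bullet> g' t) = lint A (g s) (g b) - lint A (g s) (g a)"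
      if "0 \<le> a" "a \<le> b" "b \<le> 1" "dist a s < d" "dist b s < d" for a b
    proof (rule integral_unique, rule integral_along_curve)
      fix t assume t: "t \<in> {a..b}"
      then have "dist t s < d" using that by (auto simp: dist_real_def)
      then have "dist (g t) (g s) < r" using d(2) t that by auto
      then show "(lint A (g s) has_derivative (\<lambda>u. A (g t) \<bullet> u)) (at (g t))"
        by (intro prim) (auto simp: dist_commute)
      show "(g has_vector_derivative g' t) (at t)" using g t that by auto
    qed (use that in auto)
    have lint_self: "lint A x x = 0" for x by (simp add: lint_def)
    have "q t = q s + lint A (g s) (g t)" if t: "t \<in> {0..1}" "dist s t < d" for t
    proof (cases "s \<le> t")
      case True
      then show ?thesis using diff[of s t] step[of s t] s t d(1) by (auto simp: dist_commute lint_self)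
    next
      case False
      then show ?thesis using diff[of t s] step[of t s] s t d(1) by (auto simp: dist_commute lint_self)
    qed
    then show "\<exists>d>0. \<forall>t\<in>{0..1}. dist s t < d \<longrightarrow> q t = q s + lint A (g s) (g t)"
      using d(1) by blast
  qed
  from hol_eq[OF this] show ?thesis by (simp add: q_def)
qed

section \<open>Vector potentials\<close>

lemma bounded_bilinear_cross3: "bounded_bilinear cross3"
  using bilinear_cross by (simp add: bilinear_conv_bounded_bilinear)

definition trace3 :: "(real^3 \<Rightarrow> real^3) \<Rightarrow> real" where
  "trace3 L = (\<Sum>i\<in>UNIV. L (axis i 1) $ i)"

lemma linear_components3:
  fixes L :: "real^3 \<Rightarrow> 'b::real_vector"
  assumes "linear L"
  shows "L x = x $ 1 *\<^sub>R L (axis 1 1) + x $ 2 *\<^sub>R L (axis 2 1) + x $ 3 *\<^sub>R L (axis 3 1)"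
proof -
  have "x = x $ 1 *\<^sub>R axis 1 1 + x $ 2 *\<^sub>R axis 2 1 + x $ 3 *\<^sub>R axis 3 1"
    by (simp add: vec_eq_iff forall_3 axis_def)
  then have "L x = L (x $ 1 *\<^sub>R axis 1 1 + x $ 2 *\<^sub>R axis 2 1 + x $ 3 *\<^sub>R axis 3 1)" by simp
  then show ?thesis using assms by (simp add: linear_add linear_cmul)
qed

text \<open>The derivative at t = 0 of det (1 + t L) times the determinant of \<open>a\<close>,
  \<open>b\<close>, \<open>c\<close>, computed in two ways.\<close>

lemma trace3_cyclic:
  assumes "linear L"
  shows "L a \<bullet> cross3 b c + L b \<bullet> cross3 c a + L c \<bullet> cross3 a b = trace3 L * (a \<bullet> cross3 b c)"
  unfolding trace3_def sum_3
  by (subst (1 2 3) linear_components3[OF assms]) (simp add: inner_vec_def sum_3 cross_components, algebra)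

text \<open>The homotopy operator of the Poincare lemma for 2-forms, centred at the origin.\<close>

definition vector_potential :: "(real^3 \<Rightarrow> real^3) \<Rightarrow> real^3 \<Rightarrow> real^3" where
  "vector_potential W x = integral {0..1} (\<lambda>s. s *\<^sub>R cross3 (W (s *\<^sub>R x)) x)"

definition vector_potential_deriv ::
    "(real^3 \<Rightarrow> real^3) \<Rightarrow> (real^3 \<Rightarrow> real^3 \<Rightarrow> real^3) \<Rightarrow> real^3 \<Rightarrow> real^3 \<Rightarrow> real^3" where
  "vector_potential_deriv W W' x u = integral {0..1}
     (\<lambda>s. s *\<^sub>R (cross3 (W (s *\<^sub>R x)) u + cross3 (W' (s *\<^sub>R x) (s *\<^sub>R u)) x))"

lemma C1_on_vector_potential:
  assumes W: "C1_on UNIV W W'"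
  shows "C1_on UNIV (vector_potential W) (vector_potential_deriv W W')"
  unfolding vector_potential_def[abs_def] vector_potential_deriv_def[abs_def]
proof (rule C1_on_integral)
  fix x :: "real^3" and s :: real
  have "((\<lambda>x. s *\<^sub>R x) has_derivative (\<lambda>u. s *\<^sub>R u)) (at x)"
    by (auto intro!: derivative_eq_intros)
  from has_derivative_compose[OF this C1_onD[OF W]]
  have "((\<lambda>x. W (s *\<^sub>R x)) has_derivative (\<lambda>u. W' (s *\<^sub>R x) (s *\<^sub>R u))) (at x)" by simp
  from bounded_bilinear.FDERIV[OF bounded_bilinear_cross3 this has_derivative_ident]
  show "((\<lambda>x. s *\<^sub>R cross3 (W (s *\<^sub>R x)) x) has_derivative
      (\<lambda>u. s *\<^sub>R (cross3 (W (s *\<^sub>R x)) u + cross3 (W' (s *\<^sub>R x) (s *\<^sub>R u)) x))) (at x)"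
    by (rule has_derivative_scaleR_right)
next
  fix u :: "real^3"
  show "continuous_on (UNIV \<times> {0..1})
      (\<lambda>(x, s). s *\<^sub>R (cross3 (W (s *\<^sub>R x)) u + cross3 (W' (s *\<^sub>R x) (s *\<^sub>R u)) x))"
    unfolding case_prod_unfold
    by (intro continuous_intros bounded_bilinear.continuous_on[OF bounded_bilinear_cross3]
        C1_on_continuous_derivative[OF W] C1_on_continuous_compose[OF W]) auto
next
  fix x
  show "continuous_on {0..1} (\<lambda>s. s *\<^sub>R cross3 (W (s *\<^sub>R x)) x)"
    by (intro continuous_intros bounded_bilinear.continuous_on[OF bounded_bilinear_cross3]
        C1_on_continuous_compose[OF W]) auto
qed auto

text \<open>Vector fields \<open>A\<close> and \<open>W\<close> stand for the 1-form
  \<open>u \<mapsto> A \<bullet> u\<close> and the 2-form \<open>(u, v) \<mapsto> W \<bullet> cross3 u v\<close>.\<close>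

lemma curl_vector_potential:
  assumes W: "C1_on UNIV W W'" and div: "\<And>x. trace3 (W' x) = 0"
  shows "vector_potential_deriv W W' x u \<bullet> v - vector_potential_deriv W W' x v \<bullet> u = W x \<bullet> cross3 u v"
proof -
  define f where "f u s = s *\<^sub>R (cross3 (W (s *\<^sub>R x)) u + cross3 (W' (s *\<^sub>R x) (s *\<^sub>R u)) x)" for u and s :: real
  have lin: "linear (W' y)" for y using C1_on_linear[OF W] by blast
  have int: "(\<lambda>s. f u s) integrable_on {0..1}" for u
    unfolding f_def
    by (intro integrable_continuous_real continuous_intros bounded_bilinear.continuous_on[OF bounded_bilinear_cross3]
        C1_on_continuous_derivative[OF W] C1_on_continuous_compose[OF W]) auto
  have int_inner: "((\<lambda>s. f u s \<bullet> v) has_integral (vector_potential_deriv W W' x u \<bullet> v)) {0..1}" for u v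
    using has_integral_linear[OF integrable_integral[OF int] bounded_linear_inner_left]
    by (simp add: f_def vector_potential_deriv_def o_def)
  have 1: "((\<lambda>s. f u s \<bullet> v - f v s \<bullet> u) has_integral
      (vector_potential_deriv W W' x u \<bullet> v - vector_potential_deriv W W' x v \<bullet> u)) {0..1}"
    by (intro has_integral_diff int_inner)
  \<comment> \<open>Vanishing divergence makes the integrand the derivative of \<open>s^2\<close>
    times \<open>W \<bullet> cross3 u v\<close> along the ray to \<open>x\<close>.\<close>
  have "((\<lambda>s. f u s \<bullet> v - f v s \<bullet> u) has_integral
      (1\<^sup>2 * (W (1 *\<^sub>R x) \<bullet> cross3 u v) - 0\<^sup>2 * (W (0 *\<^sub>R x) \<bullet> cross3 u v))) {0..1}"
  proof (rule fundamental_theorem_of_calculus)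
    fix s :: real assume "s \<in> {0..1}"
    have "((\<lambda>s. s *\<^sub>R x) has_derivative (\<lambda>h. h *\<^sub>R x)) (at s)"
      by (auto intro!: derivative_eq_intros)
    from has_derivative_compose[OF this C1_onD[OF W]]
    have "((\<lambda>s. W (s *\<^sub>R x)) has_derivative (\<lambda>h. W' (s *\<^sub>R x) (h *\<^sub>R x))) (at s)" by simp
    then have "((\<lambda>s. s\<^sup>2 * (W (s *\<^sub>R x) \<bullet> cross3 u v)) has_derivative
        (\<lambda>h. s\<^sup>2 * (W' (s *\<^sub>R x) (h *\<^sub>R x) \<bullet> cross3 u v) + 2 * s * h * (W (s *\<^sub>R x) \<bullet> cross3 u v))) (at s)"
      by (auto intro!: derivative_eq_intros simp: algebra_simps)
    moreover have "s\<^sup>2 * (W' (s *\<^sub>R x) (h *\<^sub>R x) \<bullet> cross3 u v) + 2 * s * h * (W (s *\<^sub>R x) \<bullet> cross3 u v)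
        = h *\<^sub>R (f u s \<bullet> v - f v s \<bullet> u)" for h
    proof -
      define L where "L = W' (s *\<^sub>R x)"
      define w where "w = W (s *\<^sub>R x)"
      have L: "linear L" by (simp add: L_def lin)
      have tr: "L x \<bullet> cross3 u v = - L u \<bullet> cross3 v x - L v \<bullet> cross3 x u"
        using trace3_cyclic[OF L, of x u v] div[of "s *\<^sub>R x"] by (simp add: L_def)
      have c1: "cross3 (L u) x \<bullet> v = - L u \<bullet> cross3 v x" "cross3 (L v) x \<bullet> u = L v \<bullet> cross3 x u"
        "cross3 w u \<bullet> v = w \<bullet> cross3 u v" "cross3 w v \<bullet> u = - w \<bullet> cross3 u v"
        by (simp_all add: inner_vec_def sum_3 cross_components algebra_simps)
      show ?thesis
        unfolding f_def L_def[symmetric] w_def[symmetric]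
        by (simp add: linear_cmul[OF L] tr c1 cross_mult_left inner_add_left algebra_simps power2_eq_square)
    qed
    ultimately show "((\<lambda>s. s\<^sup>2 * (W (s *\<^sub>R x) \<bullet> cross3 u v)) has_vector_derivative (f u s \<bullet> v - f v s \<bullet> u)) (at s within {0..1})"
      by (auto simp: has_vector_derivative_def intro: has_derivative_at_withinI)
  qed simp
  from has_integral_unique[OF 1 this] show ?thesis by simp
qed

section \<open>Smearing a closed curve\<close>

text \<open>The square of a positive part is continuously differentiable, which suffices for the
  fields built from it. It is left unnormalized, since only the vanishing of holonomies is at
  stake.\<close>

definition bump :: "real \<Rightarrow> 'a::real_inner \<Rightarrow> real" where
  "bump d x = (max 0 (d\<^sup>2 - x \<bullet> x))\<^sup>2"

definition bump_deriv :: "real \<Rightarrow> 'a::real_inner \<Rightarrow> 'a \<Rightarrow> real" where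
  "bump_deriv d x u = - 4 * max 0 (d\<^sup>2 - x \<bullet> x) * (x \<bullet> u)"

lemma bump_nonneg: "bump d x \<ge> 0"
  by (simp add: bump_def)

lemma bump_pos: "0 < d \<Longrightarrow> norm x < d \<Longrightarrow> bump d x > 0"
  by (simp add: bump_def dot_square_norm power_strict_mono)

lemma bump_eq_0: "0 < d \<Longrightarrow> d \<le> norm x \<Longrightarrow> bump d x = 0"
  by (simp add: bump_def dot_square_norm max_def)

lemma bump_continuous [continuous_intros]: "continuous_on S f \<Longrightarrow> continuous_on S (\<lambda>x. bump d (f x))"
  unfolding bump_def by (intro continuous_intros)

lemma has_derivative_bump: "(bump d has_derivative bump_deriv d x) (at x)"
proof -
  have "((\<lambda>y :: real. (max 0 y)\<^sup>2) has_real_derivative 2 * max 0 y) (at y)" for y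
  proof (cases y "0 :: real" rule: linorder_cases)
    case greater
    have "((\<lambda>y :: real. y\<^sup>2) has_real_derivative 2 * y) (at y)"
      by (auto intro!: derivative_eq_intros)
    then have "((\<lambda>y :: real. (max 0 y)\<^sup>2) has_real_derivative 2 * y) (at y)"
      by (rule has_field_derivative_transform_within_open[of _ _ _ "{0<..}"]) (use greater in auto)
    then show ?thesis using greater by simp
  next
    case less
    have "((\<lambda>y :: real. 0) has_real_derivative 0) (at y)" by simp
    then have "((\<lambda>y :: real. (max 0 y)\<^sup>2) has_real_derivative 0) (at y)"
      by (rule has_field_derivative_transform_within_open[of _ _ _ "{..<0}"]) (use less in auto)
    then show ?thesis using less by simp
  next
    case equal
    have "((\<lambda>h :: real. (max 0 (0 + h))\<^sup>2 / h) \<longlongrightarrow> 0) (at 0)"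
    proof (rule Lim_null_comparison[of _ "\<lambda>h. \<bar>h\<bar>"])
      show "\<forall>\<^sub>F h in at (0 :: real). norm ((max 0 (0 + h))\<^sup>2 / h) \<le> \<bar>h\<bar>"
        by (rule always_eventually) (auto simp: power2_eq_square max_def)
    qed (auto intro!: tendsto_eq_intros)
    then show ?thesis using equal by (simp add: DERIV_def)
  qed
  then have outer: "((\<lambda>y :: real. (max 0 y)\<^sup>2) has_derivative (\<lambda>h. 2 * max 0 y * h)) (at y)" for y
    by (simp add: has_field_derivative_def)
  have "((\<lambda>x. x \<bullet> x) has_derivative (\<lambda>u. x \<bullet> u + u \<bullet> x)) (at x)"
    by (rule has_derivative_inner[OF has_derivative_ident has_derivative_ident])
  from has_derivative_diff[OF has_derivative_const this, of "d\<^sup>2"]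
  have inner: "((\<lambda>x. d\<^sup>2 - x \<bullet> x) has_derivative (\<lambda>u. - 2 * (x \<bullet> u))) (at x)"
    by (simp add: inner_commute)
  have "((\<lambda>x. (max 0 (d\<^sup>2 - x \<bullet> x))\<^sup>2) has_derivative (\<lambda>u. 2 * max 0 (d\<^sup>2 - x \<bullet> x) * (- 2 * (x \<bullet> u)))) (at x)"
    by (rule has_derivative_compose[OF inner outer])
  moreover have "(\<lambda>u. 2 * max 0 (d\<^sup>2 - x \<bullet> x) * (- 2 * (x \<bullet> u))) = bump_deriv d x"
    by (simp add: bump_deriv_def fun_eq_iff)
  ultimately show ?thesis unfolding bump_def[abs_def] by simp
qed

text \<open>The convolution of the bump with the curve regarded as a current: for a closed curve, a
  closed 2-form dual to it and supported within distance \<open>d\<close>.\<close>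

definition smear :: "real \<Rightarrow> (real \<Rightarrow> real^3) \<Rightarrow> (real \<Rightarrow> real^3) \<Rightarrow> real^3 \<Rightarrow> real^3" where
  "smear d K K' x = integral {0..1} (\<lambda>t. bump d (x - K t) *\<^sub>R K' t)"

definition smear_deriv ::
    "real \<Rightarrow> (real \<Rightarrow> real^3) \<Rightarrow> (real \<Rightarrow> real^3) \<Rightarrow> real^3 \<Rightarrow> real^3 \<Rightarrow> real^3" where
  "smear_deriv d K K' x u = integral {0..1} (\<lambda>t. bump_deriv d (x - K t) u *\<^sub>R K' t)"

lemma C1_on_smear:
  assumes "continuous_on {0..1} K" "continuous_on {0..1} K'"
  shows "C1_on UNIV (smear d K K') (smear_deriv d K K')"
  unfolding smear_def[abs_def] smear_deriv_def[abs_def]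
proof (rule C1_on_integral)
  fix x and t :: real
  have "((\<lambda>x. x - K t) has_derivative (\<lambda>u. u)) (at x)" by (auto intro!: derivative_eq_intros)
  from has_derivative_compose[OF this has_derivative_bump]
  show "((\<lambda>x. bump d (x - K t) *\<^sub>R K' t) has_derivative (\<lambda>u. bump_deriv d (x - K t) u *\<^sub>R K' t)) (at x)"
    by (rule has_derivative_scaleR_left)
next
  fix u
  have "continuous_on (UNIV \<times> {0..1}) (\<lambda>z :: (real^3) \<times> real. K (snd z))"
    "continuous_on (UNIV \<times> {0..1}) (\<lambda>z :: (real^3) \<times> real. K' (snd z))"
    by (rule continuous_on_compose2[OF assms(1)] continuous_on_compose2[OF assms(2)]; force intro: continuous_intros)+
  then show "continuous_on (UNIV \<times> {0..1}) (\<lambda>(x, t). bump_deriv d (x - K t) u *\<^sub>R K' t)"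
    unfolding case_prod_unfold bump_deriv_def by (intro continuous_intros)
qed (use assms in \<open>auto intro!: continuous_intros\<close>)

lemma smear_eq_0:
  assumes "0 < d" "\<And>t. t \<in> {0..1} \<Longrightarrow> d \<le> dist x (K t)"
  shows "smear d K K' x = 0"
proof -
  have "smear d K K' x = integral {0..1} (\<lambda>_ :: real. 0)"
    unfolding smear_def using assms
    by (intro Henstock_Kurzweil_Integration.integral_cong) (auto simp: bump_eq_0 dist_norm)
  then show ?thesis by simp
qed

text \<open>The integrand is the rate of change of \<open>- bump d (x - K t)\<close> along the
  curve, so its integral telescopes to 0 on a closed curve.\<close>

lemma divergence_smear:
  assumes K: "\<And>t. t \<in> {0..1} \<Longrightarrow> (K has_vector_derivative K' t) (at t)"
    and K': "continuous_on {0..1} K'" and "K 1 = K 0"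
  shows "trace3 (smear_deriv d K K' x) = 0"
proof -
  have K_cont: "continuous_on {0..1} K"
    using K by (meson continuous_at_imp_continuous_on has_vector_derivative_continuous)
  have int: "(\<lambda>t. bump_deriv d (x - K t) u *\<^sub>R K' t) integrable_on {0..1}" for u
    unfolding bump_deriv_def by (intro integrable_continuous_real continuous_intros K_cont K')
  have comp: "((\<lambda>t. bump_deriv d (x - K t) (axis i 1) * K' t $ i) has_integral smear_deriv d K K' x (axis i 1) $ i) {0..1}" for i
    using has_integral_linear[OF integrable_integral[OF int] bounded_linear_inner_left, of "axis i 1" "axis i 1"]
    by (simp add: smear_deriv_def cart_eq_inner_axis o_def)
  have "((\<lambda>t. \<Sum>i\<in>UNIV. bump_deriv d (x - K t) (axis i 1) * K' t $ i) has_integral trace3 (smear_deriv d K K' x)) {0..1}"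
    unfolding trace3_def by (intro has_integral_sum comp) auto
  moreover have "(\<Sum>i\<in>UNIV. bump_deriv d (x - K t) (axis i 1) * K' t $ i) = bump_deriv d (x - K t) (K' t)" for t
    by (simp add: bump_deriv_def sum_distrib_left inner_vec_def[of "x - K t" "K' t"] inner_axis mult.assoc)
  ultimately have 1: "((\<lambda>t. bump_deriv d (x - K t) (K' t)) has_integral trace3 (smear_deriv d K K' x)) {0..1}"
    by simp
  have "((\<lambda>t. bump_deriv d (x - K t) (K' t)) has_integral (- bump d (x - K 1) - (- bump d (x - K 0)))) {0..1}"
  proof (rule fundamental_theorem_of_calculus)
    fix t :: real assume t: "t \<in> {0..1}"
    have "((\<lambda>t. x - K t) has_derivative (\<lambda>h. - (h *\<^sub>R K' t))) (at t)"
      using K[OF t] unfolding has_vector_derivative_def by (auto intro!: derivative_eq_intros)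
    from has_derivative_minus[OF has_derivative_compose[OF this has_derivative_bump]]
    have "((\<lambda>t. - bump d (x - K t)) has_derivative (\<lambda>h. - bump_deriv d (x - K t) (- (h *\<^sub>R K' t)))) (at t)" .
    moreover have "- bump_deriv d (x - K t) (- (h *\<^sub>R K' t)) = h *\<^sub>R bump_deriv d (x - K t) (K' t)" for h
      by (simp add: bump_deriv_def)
    ultimately show "((\<lambda>t. - bump d (x - K t)) has_vector_derivative bump_deriv d (x - K t) (K' t)) (at t within {0..1})"
      by (auto simp: has_vector_derivative_def intro: has_derivative_at_withinI)
  qed simp
  from has_integral_unique[OF 1 this] show ?thesis using assms(3) by simp
qed


section \<open>Closed curves and their neighbourhoods\<close>

lemma periodic_add_int:
  fixes f :: "real \<Rightarrow> 'b"
  assumes "\<And>t. f (t + 1) = f t"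
  shows "f (t + of_int n) = f t"
proof (induction n rule: int_induct[where k = 0])
  case (step1 i)
  then show ?case using assms[of "t + of_int i"] by (simp add: add.assoc)
next
  case (step2 i)
  then show ?case using assms[of "t + of_int (i - 1)"] by simp
qed simp

lemma periodic_frac:
  fixes f :: "real \<Rightarrow> 'b"
  assumes "\<And>t. f (t + 1) = f t"
  shows "f (frac t) = f t"
  using periodic_add_int[of f "frac t" "\<lfloor>t\<rfloor>", OF assms] by (simp add: frac_def)

lemma range_periodic:
  fixes f :: "real \<Rightarrow> 'b"
  assumes "\<And>t. f (t + 1) = f t"
  shows "range f = f ` {0..1}"
proof -
  have "f t \<in> f ` {0..1}" for t
    using periodic_frac[of f t, OF assms] frac_ge_0[of t] frac_lt_1[of t]
    by (intro image_eqI[of _ _ "frac t"]) auto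
  then show ?thesis by blast
qed

abbreviation velocity :: "(real \<Rightarrow> 'a::real_normed_vector) \<Rightarrow> real \<Rightarrow> 'a" where
  "velocity K t \<equiv> vector_derivative K (at t)"

lemma smooth_imp_continuous: "smooth f \<Longrightarrow> continuous_on UNIV f"
  unfolding smooth_def by (metis C_k.simps(1))

context
  fixes K :: "real \<Rightarrow> real^3"
  assumes K: "smooth_knot K"
begin

lemma knot_periodic: "K (t + 1) = K t"
  using K by (simp add: smooth_knot_def)

lemma knot_continuous: "continuous_on UNIV K"
  using K unfolding smooth_knot_def by (blast intro: smooth_imp_continuous)

lemma knot_velocity: "(K has_vector_derivative velocity K t) (at t)"
  and continuous_velocity: "continuous_on UNIV (velocity K)"
proof -
  have "C_k (Suc 0) K" using K unfolding smooth_knot_def smooth_def by blast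
  then obtain f' where f': "\<And>x. (K has_derivative f' x) (at x)" "\<And>v. continuous_on UNIV (\<lambda>x. f' x v)"
    by auto
  have "f' x h = h *\<^sub>R f' x 1" for x h
    using linear_cmul[OF has_derivative_linear[OF f'(1)], of x h 1] by simp
  then have deriv: "(K has_vector_derivative f' x 1) (at x)" for x
    using f'(1)[of x] unfolding has_vector_derivative_def by (metis (no_types, lifting) ext)
  have vel: "velocity K t = f' t 1" for t by (rule vector_derivative_at[OF deriv])
  show "(K has_vector_derivative velocity K t) (at t)" using deriv by (simp add: vel)
  show "continuous_on UNIV (velocity K)" using f'(2) by (simp add: vel)
qed

lemma velocity_periodic: "velocity K (t + 1) = velocity K t"
proof -
  have "((\<lambda>s. s + 1) has_vector_derivative 1) (at t)"
    by (auto intro!: derivative_eq_intros)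
  from vector_diff_chain_at[OF this knot_velocity]
  have "(K \<circ> (\<lambda>s. s + 1) has_vector_derivative velocity K (t + 1)) (at t)" by simp
  moreover have "K \<circ> (\<lambda>s. s + 1) = K" using knot_periodic by (auto simp: fun_eq_iff)
  ultimately show ?thesis using vector_derivative_at by metis
qed

lemma range_knot: "range K = K ` {0..1}"
  by (rule range_periodic[of K, OF knot_periodic])

lemma compact_knot: "compact (range K)"
  unfolding range_knot by (intro compact_continuous_image continuous_on_subset[OF knot_continuous]) auto

lemma knot_path: "path K" "path_image K = range K" "pathstart K = pathfinish K"
  using continuous_on_subset[OF knot_continuous] knot_periodic[of 0]
  by (auto simp: path_def path_image_def range_knot pathstart_def pathfinish_def)

lemma knot_eq_iff: "K s = K t \<longleftrightarrow> frac s = frac t"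
proof
  assume "K s = K t"
  then have "K (frac s) = K (frac t)" by (simp add: periodic_frac[of K, OF knot_periodic])
  moreover have "inj_on K {0..<1}" using K by (simp add: smooth_knot_def)
  ultimately show "frac s = frac t"
    by (rule_tac inj_onD[of K "{0..<1}"]) (auto simp: frac_lt_1)
next
  assume "frac s = frac t"
  then show "K s = K t" using periodic_frac[of K, OF knot_periodic] by metis
qed

text \<open>By compactness, parameters that are not close modulo 1 give points a definite distance
  apart. The second alternative is closeness across 0 and 1, which \<open>K\<close>
  identifies.\<close>

lemma knot_close:
  assumes "\<tau> > 0"
  shows "\<exists>\<eta>>0. \<forall>s\<in>{0..1}. \<forall>t\<in>{0..1}. dist (K s) (K t) < \<eta> \<longrightarrow> \<bar>s - t\<bar> < \<tau> \<or> \<bar>s - t\<bar> > 1 - \<tau>"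
proof -
  define Z where "Z = ({0..1} \<times> {0..1}) \<inter> {z :: real \<times> real. \<tau> \<le> \<bar>fst z - snd z\<bar> \<and> \<bar>fst z - snd z\<bar> \<le> 1 - \<tau>}"
  have "closed {z :: real \<times> real. \<tau> \<le> \<bar>fst z - snd z\<bar> \<and> \<bar>fst z - snd z\<bar> \<le> 1 - \<tau>}"
    by (intro closed_Collect_conj closed_Collect_le continuous_intros)
  then have Z: "compact Z" unfolding Z_def by (intro compact_Int_closed compact_Times) auto
  have cont: "continuous_on Z (\<lambda>z. dist (K (fst z)) (K (snd z)))"
    by (intro continuous_intros continuous_on_compose2[OF knot_continuous]) auto
  have pos: "dist (K s) (K t) > 0" if "(s, t) \<in> Z" for s t
  proof -
    have "frac s \<noteq> frac t"
    proof
      assume "frac s = frac t"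
      then obtain n where "s = t + of_int n" by (rule frac_eqE)
      moreover have "0 < \<bar>s - t\<bar>" "\<bar>s - t\<bar> < 1" using that assms by (auto simp: Z_def)
      ultimately have "0 < \<bar>n\<bar>" "\<bar>n\<bar> < 1" by auto
      then show False by simp
    qed
    then show ?thesis by (simp add: knot_eq_iff)
  qed
  show ?thesis
  proof (cases "Z = {}")
    case True
    then show ?thesis by (intro exI[of _ 1]) (force simp: Z_def)
  next
    case False
    then obtain z where z: "z \<in> Z" "\<And>w. w \<in> Z \<Longrightarrow> dist (K (fst z)) (K (snd z)) \<le> dist (K (fst w)) (K (snd w))"
      using continuous_attains_inf[OF Z False cont] by blast
    show ?thesis
    proof (intro exI[of _ "dist (K (fst z)) (K (snd z))"] conjI ballI impI)
      show "0 < dist (K (fst z)) (K (snd z))" using pos[of "fst z" "snd z"] z(1) by simp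
    next
      fix s t assume "s \<in> {0..1}" "t \<in> {0..1}" "dist (K s) (K t) < dist (K (fst z)) (K (snd z))"
      then show "\<bar>s - t\<bar> < \<tau> \<or> 1 - \<tau> < \<bar>s - t\<bar>" using z(2)[of "(s, t)"] by (force simp: Z_def)
    qed
  qed
qed

text \<open>The neighbourhood must not depend on the form: later the form is obtained from a smeared curve,
  and the scale of smearing has to be small compared to the neighbourhood.\<close>

lemma primitive_near_knot:
  assumes \<rho>: "\<rho> > 0"
  shows "\<exists>\<eta>>0. \<forall>B B'. C1_on {x. infdist x (range K) < \<rho>} B B' \<longrightarrow> sym_deriv_on {x. infdist x (range K) < \<rho>} B' \<longrightarrow>
    integral {0..1} (\<lambda>t. B (K t) \<bullet> velocity K t) = 0 \<longrightarrow>
    (\<exists>G. \<forall>x. infdist x (range K) < \<eta> \<longrightarrow> (G has_derivative (\<lambda>u. B x \<bullet> u)) (at x))"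
proof -
  \<comment> \<open>One extra period on either side leaves room for shifts across the seam at 0 and
    1.\<close>
  have "uniformly_continuous_on {-1..2} K"
    by (intro compact_uniformly_continuous continuous_on_subset[OF knot_continuous]) auto
  then obtain \<tau> where \<tau>: "\<tau> > 0" and \<tau>_close0: "\<And>s t. s \<in> {-1..2} \<Longrightarrow> t \<in> {-1..2} \<Longrightarrow> dist s t < \<tau> \<Longrightarrow> dist (K s) (K t) < \<rho>"
    using \<rho> unfolding uniformly_continuous_on_def by metis
  have \<tau>_close: "dist (K t) (K s) < \<rho>" if "s \<in> {-1..2}" "t \<in> {0..1}" "\<bar>s - t\<bar> < \<tau>" for s t
    using \<tau>_close0[of t s] that by (auto simp: dist_real_def abs_minus_commute)
  obtain \<eta>1 where \<eta>1: "\<eta>1 > 0"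
    "\<And>s t. s \<in> {0..1} \<Longrightarrow> t \<in> {0..1} \<Longrightarrow> dist (K s) (K t) < \<eta>1 \<Longrightarrow> \<bar>s - t\<bar> < \<tau> \<or> \<bar>s - t\<bar> > 1 - \<tau>"
    using knot_close[OF \<tau>] by blast
  \<comment> \<open>Two points of the knot within \<open>\<eta>\<close> of the same \<open>x\<close>
    are less than \<open>\<eta>1\<close> apart, so their parameters are close modulo 1.\<close>
  define \<eta> where "\<eta> = min \<eta>1 \<rho> / 2"
  have \<eta>: "\<eta> > 0" "2 * \<eta> \<le> \<eta>1" "2 * \<eta> \<le> \<rho>" using \<eta>1(1) \<rho> by (auto simp: \<eta>_def)
  have "\<exists>G. \<forall>x. infdist x (range K) < \<eta> \<longrightarrow> (G has_derivative (\<lambda>u. B x \<bullet> u)) (at x)"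
    if B: "C1_on {x. infdist x (range K) < \<rho>} B B'" and sym: "sym_deriv_on {x. infdist x (range K) < \<rho>} B'"
      and zero: "integral {0..1} (\<lambda>t. B (K t) \<bullet> velocity K t) = 0" for B B'
  proof -
    have ball_sub: "ball (K t) \<rho> \<subseteq> {x. infdist x (range K) < \<rho>}" for t
    proof
      fix x assume "x \<in> ball (K t) \<rho>"
      then show "x \<in> {x. infdist x (range K) < \<rho>}"
        using infdist_le[of "K t" "range K" x] by (simp add: dist_commute)
    qed
    have prim: "(lint B (K t) has_derivative (\<lambda>u. B x \<bullet> u)) (at x)" if "dist (K t) x < \<rho>" for t x
    proof (rule lint_has_derivative[OF open_ball convex_ball, of "K t" \<rho>])
      show "C1_on (ball (K t) \<rho>) B B'" by (rule C1_on_subset[OF B ball_sub])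
      show "sym_deriv_on (ball (K t) \<rho>) B'" using sym ball_sub[of t] unfolding sym_deriv_on_def by blast
    qed (use that \<rho> in auto)
    have integrable: "(\<lambda>t. B (K t) \<bullet> velocity K t) integrable_on {a..b}" for a b
    proof (intro integrable_continuous_real continuous_intros C1_on_continuous_compose[OF B])
      show "K ` {a..b} \<subseteq> {x. infdist x (range K) < \<rho>}" using \<rho> by auto
    qed (auto intro: continuous_on_subset[OF knot_continuous] continuous_on_subset[OF continuous_velocity])
    \<comment> \<open>A primitive of \<open>B\<close> along the knot. The vanishing period makes it
      close up across the seam.\<close>
    define g where "g t = integral {0..t} (\<lambda>t. B (K t) \<bullet> velocity K t)" for t
    have g01: "g 0 = 0" "g 1 = 0" using zero by (simp_all add: g_def)
    have K1: "K 1 = K 0" using knot_periodic[of 0] by simp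
    have step: "g b - g a = lint B (K t) (K b) - lint B (K t) (K a)"
      if "0 \<le> a" "a \<le> b" and ball: "\<And>s. s \<in> {a..b} \<Longrightarrow> dist (K t) (K s) < \<rho>" for a b t
    proof -
      have "g b - g a = integral {a..b} (\<lambda>t. B (K t) \<bullet> velocity K t)"
        using Henstock_Kurzweil_Integration.integral_combine[OF that(1,2) integrable] by (simp add: g_def)
      also have "\<dots> = lint B (K t) (K b) - lint B (K t) (K a)"
        by (rule integral_unique, rule integral_along_curve) (use that prim knot_velocity in auto)
      finally show ?thesis .
    qed
    have jump: "g s - g t = lint B (K t) (K s)"
      if s: "s \<in> {0..1}" and t: "t \<in> {0..1}" and close: "dist (K s) (K t) < \<eta>1" for s t
    proof -
      have self: "lint B (K t) (K t) = 0" by (simp add: lint_def)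
      consider "\<bar>s - t\<bar> < \<tau>" "t \<le> s" | "\<bar>s - t\<bar> < \<tau>" "s \<le> t"
        | "t - s > 1 - \<tau>" "s \<le> t" | "s - t > 1 - \<tau>" "t \<le> s"
        using \<eta>1(2)[OF s t close] by linarith
      then show ?thesis
      proof cases
        case 1
        have "g s - g t = lint B (K t) (K s) - lint B (K t) (K t)"
          by (rule step) (use 1 s t in \<open>auto intro!: \<tau>_close\<close>)
        then show ?thesis by (simp add: self)
      next
        case 2
        have "g t - g s = lint B (K t) (K t) - lint B (K t) (K s)"
          by (rule step) (use 2 s t in \<open>auto intro!: \<tau>_close\<close>)
        then show ?thesis by (simp add: self)
      next
        \<comment> \<open>Here \<open>s\<close> is near 0 and \<open>t\<close> near 1. The short way
          from \<open>K t\<close> to \<open>K s\<close> crosses the seam and is treated in two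
          pieces.\<close>
        case 3
        have near: "dist (K t) (K a) < \<rho>" if "a \<in> {0..s}" for a
          using \<tau>_close[of "a + 1" t] knot_periodic[of a] 3 s t that by auto
        have "g 1 - g t = lint B (K t) (K 1) - lint B (K t) (K t)"
          by (rule step) (use 3 s t in \<open>auto intro!: \<tau>_close\<close>)
        moreover have "g s - g 0 = lint B (K t) (K s) - lint B (K t) (K 0)"
          by (rule step) (use s near in auto)
        ultimately show ?thesis by (simp add: self g01 K1)
      next
        case 4
        have near: "dist (K t) (K a) < \<rho>" if "a \<in> {s..1}" for a
          using \<tau>_close[of "a - 1" t] knot_periodic[of "a - 1"] 4 s t that by auto
        have "g t - g 0 = lint B (K t) (K t) - lint B (K t) (K 0)"
          by (rule step) (use 4 s t in \<open>auto intro!: \<tau>_close\<close>)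
        moreover have "g 1 - g s = lint B (K t) (K 1) - lint B (K t) (K s)"
          by (rule step) (use s near in auto)
        ultimately show ?thesis by (simp add: self g01 K1)
      qed
    qed
    have consistent: "g s + lint B (K s) x = g t + lint B (K t) x"
      if "s \<in> {0..1}" "t \<in> {0..1}" "dist (K s) x < \<eta>" "dist (K t) x < \<eta>" for s t x
    proof -
      have d: "dist (K t) (K s) < 2 * \<eta>"
        using dist_triangle2[of "K t" "K s" x] that by (simp add: dist_commute)
      have "lint B (K s) x = lint B (K t) x - lint B (K t) (K s)"
        by (rule lint_primitive[OF convex_ball, of _ "K t" \<rho>]) (use that d \<eta> prim in auto)
      moreover have "g s - g t = lint B (K t) (K s)"
        by (rule jump) (use that d \<eta> in \<open>auto simp: dist_commute\<close>)
      ultimately show ?thesis by simp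
    qed
    define near where "near x t \<longleftrightarrow> t \<in> {0..1} \<and> dist (K t) x < \<eta>" for x t
    \<comment> \<open>The primitive on the knot is extended along short segments; by
      \<open>consistent\<close> the chosen foot \<open>K t\<close> does not matter.\<close>
    define G where "G x = (let t = (SOME t. near x t) in g t + lint B (K t) x)" for x
    have G: "G x = g t + lint B (K t) x" if "near x t" for x t
    proof -
      have "near x (SOME t. near x t)" using that by (rule someI[where P = "near x"])
      with that show ?thesis unfolding G_def Let_def near_def by (intro consistent) blast+
    qed
    have "(G has_derivative (\<lambda>u. B x \<bullet> u)) (at x)" if x: "infdist x (range K) < \<eta>" for x
    proof -
      obtain t where t: "near x t"
      proof -
        have "\<exists>a\<in>range K. dist x a < \<eta>"
          using x cINF_less_iff[of "range K" "dist x" \<eta>] by (auto simp: infdist_notempty intro!: bdd_belowI2[of _ 0])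
        then show ?thesis using that unfolding range_knot near_def by (auto simp: dist_commute)
      qed
      have "((\<lambda>x. g t + lint B (K t) x) has_derivative (\<lambda>u. B x \<bullet> u)) (at x)"
        using has_derivative_add[OF has_derivative_const[of "g t"] prim[of t x]] t \<eta> \<rho> by (simp add: near_def)
      then show ?thesis
        by (rule has_derivative_transform_within_open[of _ _ _ _ "ball (K t) \<eta>"])
          (use t G[of _ t] in \<open>auto simp: near_def\<close>)
    qed
    then show ?thesis by blast
  qed
  then show ?thesis using \<eta>(1) by blast
qed

end

section \<open>The Heisenberg transport of a link with two components\<close>

text \<open>Near \<open>x\<close> the transport is \<open>- P y + P z\<close> for a
  Heisenberg-valued \<open>P\<close>. Its first two entries are primitives \<open>f\<close> and
  \<open>g\<close> of \<open>A\<close> and \<open>B\<close>; its corner is a primitive of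
  \<open>D + f B\<close>, which is closed because the curl of \<open>D\<close> cancels the product
  of \<open>A\<close> and \<open>B\<close>.\<close>

lemma flat_on_heis:
  fixes A B D :: "'a::euclidean_space \<Rightarrow> 'a"
  assumes V: "open V" and A: "C1_on V A A'" "sym_deriv_on V A'" and B: "C1_on V B B'" "sym_deriv_on V B'"
    and D: "C1_on V D D'"
    and curl: "\<And>x u v. x \<in> V \<Longrightarrow> D' x u \<bullet> v - D' x v \<bullet> u = (A x \<bullet> v) * (B x \<bullet> u) - (A x \<bullet> u) * (B x \<bullet> v)"
  shows "flat_on V (\<lambda>x y. Heis (lint A x y) (lint B x y) (lint (\<lambda>z. D z + lint A x z *\<^sub>R B z) x y))"
  unfolding flat_on_def
proof
  fix x assume "x \<in> V"
  then obtain r where r: "r > 0" "ball x r \<subseteq> V" using V openE by blast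
  let ?U = "ball x r"
  have x: "x \<in> ?U" using r by simp
  define f where "f = lint A x"
  define g where "g = lint B x"
  have AU: "C1_on ?U A A'" "sym_deriv_on ?U A'" and BU: "C1_on ?U B B'" "sym_deriv_on ?U B'" and DU: "C1_on ?U D D'"
    using r(2) A B D C1_on_subset unfolding sym_deriv_on_def by blast+
  have f: "(f has_derivative (\<lambda>u. A z \<bullet> u)) (at z)" if "z \<in> ?U" for z
    unfolding f_def by (rule lint_has_derivative[OF open_ball convex_ball AU x that])
  have g: "(g has_derivative (\<lambda>u. B z \<bullet> u)) (at z)" if "z \<in> ?U" for z
    unfolding g_def by (rule lint_has_derivative[OF open_ball convex_ball BU x that])
  define E where "E z = D z + f z *\<^sub>R B z" for z
  define E' where "E' z u = D' z u + (f z *\<^sub>R B' z u + (A z \<bullet> u) *\<^sub>R B z)" for z u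
  have "C1_on ?U f (\<lambda>z u. A z \<bullet> u)"
    unfolding C1_on_def using f C1_on_continuous[OF AU(1)] by (auto intro!: continuous_intros)
  from C1_on_add[OF DU C1_on_bilinear[OF bounded_bilinear_scaleR this BU(1)]]
  have E: "C1_on ?U E E'" by (simp add: E_def[abs_def] E'_def[abs_def])
  have "sym_deriv_on ?U E'"
    unfolding sym_deriv_on_def
  proof (intro ballI allI)
    fix z u v assume z: "z \<in> ?U"
    then have "B' z u \<bullet> v = B' z v \<bullet> u" using BU(2) unfolding sym_deriv_on_def by blast
    then show "E' z u \<bullet> v = E' z v \<bullet> u"
      using curl[of z u v] z r(2) by (auto simp: E'_def inner_add_left)
  qed
  note e = lint_has_derivative[OF open_ball convex_ball E this x]
  define e where "e = lint E x"
  have key: "Heis (lint A y z) (lint B y z) (lint (\<lambda>w. D w + lint A y w *\<^sub>R B w) y z) =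
      - Heis (f y) (g y) (e y) + Heis (f z) (g z) (e z)" if y: "y \<in> ?U" and z: "z \<in> ?U" for y z
  proof (rule heis.expand, intro conjI)
    have fy: "lint A y w = f w - f y" if "w \<in> ?U" for w
      by (rule lint_primitive[OF convex_ball y that f])
    then have "lint A y z = f z - f y" using z by blast
    moreover have "lint B y z = g z - g y" by (rule lint_primitive[OF convex_ball y z g])
    moreover have "lint (\<lambda>w. D w + lint A y w *\<^sub>R B w) y z = lint (\<lambda>w. E w - f y *\<^sub>R B w) y z"
      by (rule lint_cong[OF convex_ball y z]) (simp add: fy E_def algebra_simps)
    moreover have "\<dots> = (e z - f y * g z) - (e y - f y * g y)"
    proof (rule lint_primitive[OF convex_ball y z])
      fix w assume w: "w \<in> ?U"
      have "((\<lambda>w. e w - f y * g w) has_derivative (\<lambda>u. E w \<bullet> u - f y * (B w \<bullet> u))) (at w)"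
        unfolding e_def by (intro has_derivative_diff has_derivative_mult_right e g w)
      then show "((\<lambda>w. e w - f y * g w) has_derivative (\<lambda>u. (E w - f y *\<^sub>R B w) \<bullet> u)) (at w)"
        by (simp add: inner_diff_left)
    qed
    ultimately show "hx (Heis (lint A y z) (lint B y z) (lint (\<lambda>w. D w + lint A y w *\<^sub>R B w) y z)) =
        hx (- Heis (f y) (g y) (e y) + Heis (f z) (g z) (e z))"
      "hy (Heis (lint A y z) (lint B y z) (lint (\<lambda>w. D w + lint A y w *\<^sub>R B w) y z)) =
        hy (- Heis (f y) (g y) (e y) + Heis (f z) (g z) (e z))"
      "hz (Heis (lint A y z) (lint B y z) (lint (\<lambda>w. D w + lint A y w *\<^sub>R B w) y z)) =
        hz (- Heis (f y) (g y) (e y) + Heis (f z) (g z) (e z))"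
      by (simp_all add: algebra_simps)
  qed
  define P where "P z = Heis (f z) (g z) (e z)" for z
  have "(- P y + P z) + (- P z + P w) = - P y + P w" for y z w
    by (simp add: add.assoc)
  then show "\<exists>r>0. \<forall>y\<in>ball x r. \<forall>z\<in>ball x r. \<forall>w\<in>ball x r.
      Heis (lint A y z) (lint B y z) (lint (\<lambda>t. D t + lint A y t *\<^sub>R B t) y z) +
      Heis (lint A z w) (lint B z w) (lint (\<lambda>t. D t + lint A z t *\<^sub>R B t) z w) =
      Heis (lint A y w) (lint B y w) (lint (\<lambda>t. D t + lint A y t *\<^sub>R B t) y w)"
    using r(1) key unfolding P_def by (intro exI[of _ r] conjI ballI) (simp_all only:)
qed

text \<open>The identity div (A x B) = B . curl A - A . curl B at one point: \<open>a\<close>,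
  \<open>b\<close> are the values of the two fields, \<open>L\<close>, \<open>M\<close> their
  derivatives and \<open>k\<close>, \<open>j\<close> their curls.\<close>

lemma divergence_cross3:
  assumes L: "linear L" "linear M"
    and curl: "\<And>u v. L u \<bullet> v - L v \<bullet> u = k \<bullet> cross3 u v" "\<And>u v. M u \<bullet> v - M v \<bullet> u = j \<bullet> cross3 u v"
  shows "trace3 (\<lambda>u. cross3 a (M u) + cross3 (L u) b) = b \<bullet> k - a \<bullet> j"
proof -
  have *: "L (axis p 1) $ q - L (axis q 1) $ p = k \<bullet> cross3 (axis p 1) (axis q 1)"
    "M (axis p 1) $ q - M (axis q 1) $ p = j \<bullet> cross3 (axis p 1) (axis q 1)" for p q
    using curl[of "axis p 1" "axis q 1"] by (simp_all add: inner_axis)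
  have k: "k $ 1 = L (axis 2 1) $ 3 - L (axis 3 1) $ 2" "k $ 2 = L (axis 3 1) $ 1 - L (axis 1 1) $ 3"
    "k $ 3 = L (axis 1 1) $ 2 - L (axis 2 1) $ 1"
    and j: "j $ 1 = M (axis 2 1) $ 3 - M (axis 3 1) $ 2" "j $ 2 = M (axis 3 1) $ 1 - M (axis 1 1) $ 3"
    "j $ 3 = M (axis 1 1) $ 2 - M (axis 2 1) $ 1"
    unfolding * by (simp_all add: cross_basis inner_axis)
  show ?thesis
    unfolding trace3_def sum_3 inner_vec_def k j
    by (simp add: cross_components k j algebra_simps)
qed

text \<open>The primitive \<open>G\<close> of \<open>B\<close> is available only near the support of
  \<open>W\<close>. Extending \<open>G W\<close> by zero gives a global field, and its divergence is
  grad G . W + G div W = B . W.\<close>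

lemma C1_on_cutoff:
  fixes W :: "real^3 \<Rightarrow> real^3"
  assumes N: "open N" and F: "closed F" "F \<subseteq> N"
    and W: "C1_on UNIV W W'" "\<And>x. x \<notin> F \<Longrightarrow> W x = 0" "\<And>x. trace3 (W' x) = 0"
    and G: "\<And>x. x \<in> N \<Longrightarrow> (G has_derivative (\<lambda>u. B x \<bullet> u)) (at x)" and B: "continuous_on N B"
  shows "\<exists>Z Z'. C1_on UNIV Z Z' \<and> (\<forall>x. trace3 (Z' x) = B x \<bullet> W x) \<and> (\<forall>x. x \<notin> F \<longrightarrow> Z x = 0)"
proof -
  define Z where "Z x = (if x \<in> F then G x *\<^sub>R W x else 0)" for x
  define Z' where "Z' x u = (if x \<in> N then G x *\<^sub>R W' x u + (B x \<bullet> u) *\<^sub>R W x else 0)" for x u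
  have GN: "C1_on N G (\<lambda>x u. B x \<bullet> u)"
    unfolding C1_on_def using G B by (auto intro!: continuous_intros)
  from C1_on_bilinear[OF bounded_bilinear_scaleR this C1_on_subset[OF W(1)]]
  have GW: "C1_on N (\<lambda>x. G x *\<^sub>R W x) (\<lambda>x u. G x *\<^sub>R W' x u + (B x \<bullet> u) *\<^sub>R W x)" by simp
  have Z_eq: "Z x = G x *\<^sub>R W x" for x using W(2) by (simp add: Z_def)
  have W'0: "W' x u = 0" if "x \<notin> F" for x u
  proof -
    have "(W has_derivative (\<lambda>_. 0)) (at x)"
      by (rule has_derivative_transform_within_open[of "\<lambda>_. 0" _ _ _ "- F"]) (use that F W(2) in auto)
    from has_derivative_unique[OF this C1_onD[OF W(1)]] show ?thesis by (metis UNIV_I)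
  qed
  have Z'0: "Z' x u = 0" if "x \<notin> F" for x u using that W(2) W'0 by (simp add: Z'_def)
  have UN: "N \<union> - F = UNIV" using F by blast
  have "C1_on UNIV Z Z'"
    unfolding C1_on_def
  proof (intro conjI ballI allI)
    fix x
    show "(Z has_derivative Z' x) (at x)"
    proof (cases "x \<in> N")
      case True
      then have "Z' x = (\<lambda>u. G x *\<^sub>R W' x u + (B x \<bullet> u) *\<^sub>R W x)" by (simp add: Z'_def fun_eq_iff)
      moreover have "Z = (\<lambda>x. G x *\<^sub>R W x)" by (simp add: fun_eq_iff Z_eq)
      ultimately show ?thesis using C1_onD[OF GW True] by simp
    next
      case False
      then have x: "x \<in> - F" using F by blast
      then have "Z' x = (\<lambda>u. 0)" using Z'0 by (simp add: fun_eq_iff)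
      moreover have "(Z has_derivative (\<lambda>u. 0)) (at x)"
        by (rule has_derivative_transform_within_open[of "\<lambda>_. 0" _ _ _ "- F"]) (use x F in \<open>auto simp: Z_def\<close>)
      ultimately show ?thesis by simp
    qed
  next
    fix u
    have 1: "continuous_on N (\<lambda>x. Z' x u)"
      by (rule continuous_on_eq[of _ "\<lambda>x. G x *\<^sub>R W' x u + (B x \<bullet> u) *\<^sub>R W x"])
        (use GW in \<open>auto simp: C1_on_def Z'_def\<close>)
    have 2: "continuous_on (- F) (\<lambda>x. Z' x u)"
      by (rule continuous_on_eq[of _ "\<lambda>x. 0"]) (auto simp: Z'0)
    show "continuous_on UNIV (\<lambda>x. Z' x u)"
      using continuous_on_open_Un[OF N _ 1 2] F UN by auto
  qed
  moreover have "trace3 (Z' x) = B x \<bullet> W x" for x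
  proof (cases "x \<in> N")
    case True
    have "trace3 (Z' x) = G x * trace3 (W' x) + B x \<bullet> W x"
      unfolding inner_vec_def[of "B x" "W x"]
      using True by (simp add: trace3_def Z'_def sum.distrib sum_distrib_left inner_axis)
    then show ?thesis by (simp add: W(3))
  next
    case False
    then have "x \<notin> F" using F by blast
    then show ?thesis using Z'0 W(2) by (simp add: trace3_def)
  qed
  ultimately show ?thesis by (intro exI[of _ Z] exI[of _ Z']) (auto simp: Z_def)
qed

section \<open>The closed 1-form dual to a knot\<close>

definition knot_smear :: "real \<Rightarrow> (real \<Rightarrow> real^3) \<Rightarrow> real^3 \<Rightarrow> real^3" where
  "knot_smear d K = smear d K (velocity K)"

text \<open>A 1-form on all of space whose exterior derivative is the smeared knot. It is closed off
  the \<open>d\<close>-neighbourhood of \<open>K\<close>, and its periods there measure linking with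
  \<open>K\<close>.\<close>

definition knot_field :: "real \<Rightarrow> (real \<Rightarrow> real^3) \<Rightarrow> real^3 \<Rightarrow> real^3" where
  "knot_field d K = vector_potential (knot_smear d K)"

definition knot_field_deriv :: "real \<Rightarrow> (real \<Rightarrow> real^3) \<Rightarrow> real^3 \<Rightarrow> real^3 \<Rightarrow> real^3" where
  "knot_field_deriv d K = vector_potential_deriv (knot_smear d K) (smear_deriv d K (velocity K))"

definition off_nbhd :: "'a::metric_space set \<Rightarrow> real \<Rightarrow> 'a set" where
  "off_nbhd R d = {x. d < infdist x R}"

lemma open_off_nbhd: "open (off_nbhd R d)"
  unfolding off_nbhd_def by (intro open_Collect_less continuous_intros)

text \<open>A compact set that misses the closed set \<open>R\<close> has positive distance from it.
  Empty \<open>R\<close> is excluded because \<open>infdist\<close> is then 0 by convention.\<close>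

lemma off_nbhd_exhaust:
  fixes R :: "'a::heine_borel set"
  assumes "compact C" "C \<subseteq> - R" "closed R" "R \<noteq> {}"
  shows "\<forall>\<^sub>F d in at_right 0. C \<subseteq> off_nbhd R d"
proof -
  obtain \<delta> where \<delta>: "\<delta> > 0" "\<And>x y. x \<in> C \<Longrightarrow> y \<in> R \<Longrightarrow> \<delta> \<le> dist x y"
    using separate_compact_closed[OF assms(1,3)] assms(2) by blast
  have le: "\<delta> \<le> infdist x R" if "x \<in> C" for x
    using \<delta>(2)[OF that] assms(4) by (auto simp: infdist_notempty intro: cINF_greatest)
  show ?thesis
    using eventually_at_right_real[OF \<delta>(1)]
    by eventually_elim (auto simp: off_nbhd_def intro: less_le_trans[OF _ le])
qed

context
  fixes K :: "real \<Rightarrow> real^3"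
  assumes K: "smooth_knot K"
begin

lemma C1_on_knot_smear: "C1_on UNIV (knot_smear d K) (smear_deriv d K (velocity K))"
  unfolding knot_smear_def
  by (intro C1_on_smear continuous_on_subset[OF knot_continuous[OF K]] continuous_on_subset[OF continuous_velocity[OF K]]) auto

lemma divergence_knot_smear: "trace3 (smear_deriv d K (velocity K) x) = 0"
  using knot_periodic[OF K, of 0]
  by (intro divergence_smear knot_velocity[OF K] continuous_on_subset[OF continuous_velocity[OF K]]) auto

lemma knot_smear_eq_0:
  assumes "0 < d" "d \<le> infdist x (range K)"
  shows "knot_smear d K x = 0"
  unfolding knot_smear_def
  by (rule smear_eq_0[OF assms(1)]) (use assms(2) infdist_le[of _ "range K" x] in \<open>auto intro: order_trans\<close>)

lemma C1_on_knot_field: "C1_on UNIV (knot_field d K) (knot_field_deriv d K)"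
  unfolding knot_field_def knot_field_deriv_def by (rule C1_on_vector_potential[OF C1_on_knot_smear])

lemma curl_knot_field:
  "knot_field_deriv d K x u \<bullet> v - knot_field_deriv d K x v \<bullet> u = knot_smear d K x \<bullet> cross3 u v"
  unfolding knot_field_deriv_def by (rule curl_vector_potential[OF C1_on_knot_smear divergence_knot_smear])

lemma sym_deriv_on_knot_field:
  assumes "0 < d" "\<And>x. x \<in> V \<Longrightarrow> d \<le> infdist x (range K)"
  shows "sym_deriv_on V (knot_field_deriv d K)"
  unfolding sym_deriv_on_def
proof (intro ballI allI)
  fix x u v assume "x \<in> V"
  then show "knot_field_deriv d K x u \<bullet> v = knot_field_deriv d K x v \<bullet> u"
    using curl_knot_field[of d x u v] knot_smear_eq_0[of d x] assms by simp
qed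

lemma flat_on_knot_field: "0 < d \<Longrightarrow> flat_on (off_nbhd (range K) d) (lint (knot_field d K))"
  by (rule flat_on_lint[OF open_off_nbhd C1_on_subset[OF C1_on_knot_field] sym_deriv_on_knot_field])
    (auto simp: off_nbhd_def)

lemma flat_family_knot_field:
  "flat_family (- range K) (at_right 0) (off_nbhd (range K)) (\<lambda>d. lint (knot_field d K))"
proof
  show "\<forall>\<^sub>F d in at_right 0. flat_on (off_nbhd (range K) d) (lint (knot_field d K))"
    using eventually_at_right_less[of "0 :: real"] by eventually_elim (rule flat_on_knot_field)
qed (auto intro!: off_nbhd_exhaust compact_imp_closed compact_knot[OF K])

lemma linking_number_0_hol:
  assumes J: "smooth_knot J" "range J \<inter> range K = {}" and lk: "has_linking_number K J 0"
  shows "\<forall>\<^sub>F d in at_right 0. hol (lint (knot_field d K)) J = 0"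
proof -
  obtain p m l where p: "p \<in> - range K" and l: "l \<in> based_classes (- range K) p J"
    and eq: "derived (fundamental_group (- range K) p) (carrier (fundamental_group (- range K) p))
        #>\<^bsub>fundamental_group (- range K) p\<^esub> l =
      derived (fundamental_group (- range K) p) (carrier (fundamental_group (- range K) p))
        #>\<^bsub>fundamental_group (- range K) p\<^esub> (m [^]\<^bsub>fundamental_group (- range K) p\<^esub> (0 :: int))"
    using lk unfolding has_linking_number_def Let_def by blast
  interpret G: group "fundamental_group (- range K) p" by (rule group_fundamental_group[OF p])
  show ?thesis
    by (rule flat_family_null_homologous[OF flat_family_knot_field p l])
      (use J eq knot_path[OF J(1)] in auto)
qed

lemma linking_number_0_integral:
  assumes J: "smooth_knot J" "range J \<inter> range K = {}" and lk: "has_linking_number K J 0"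
  shows "\<forall>\<^sub>F d in at_right 0. integral {0..1} (\<lambda>t. knot_field d K (J t) \<bullet> velocity J t) = 0"
proof -
  have "\<forall>\<^sub>F d in at_right 0. range J \<subseteq> off_nbhd (range K) d"
    using J compact_knot[OF J(1)] compact_imp_closed[OF compact_knot[OF K]] by (intro off_nbhd_exhaust) auto
  with linking_number_0_hol[OF assms] eventually_at_right_less[of "0 :: real"] show ?thesis
  proof eventually_elim
    case (elim d)
    have "hol (lint (knot_field d K)) J = integral {0..1} (\<lambda>t. knot_field d K (J t) \<bullet> velocity J t)"
      by (rule hol_lint[OF open_off_nbhd[of "range K" d] C1_on_subset[OF C1_on_knot_field] sym_deriv_on_knot_field])
        (use elim knot_velocity[OF J(1)] in \<open>auto simp: off_nbhd_def intro: continuous_on_subset[OF continuous_velocity[OF J(1)]]\<close>)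
    then show ?case using elim by simp
  qed
qed

end


section \<open>The corner entry and the full transport\<close>

lemma infdist_less_iff: "A \<noteq> {} \<Longrightarrow> infdist x A < e \<longleftrightarrow> (\<exists>a\<in>A. dist x a < e)"
  using cINF_less_iff[of A "dist x" e] by (auto simp: infdist_notempty intro!: bdd_belowI2[of _ 0])

text \<open>Supplies one of the two corrections to \<open>cross3 A B\<close>. The field of
  \<open>J\<close> has zero period over \<open>K\<close>, so near \<open>K\<close> it is the
  gradient of some \<open>G\<close>, and \<open>Z\<close> is \<open>G\<close> times the smeared
  \<open>K\<close>.\<close>

lemma smear_correction:
  assumes K: "smooth_knot K" and J: "smooth_knot J" and disj: "range K \<inter> range J = {}"
    and lk: "has_linking_number J K 0"
  shows "\<forall>\<^sub>F d in at_right 0. \<exists>Z Z'. C1_on UNIV Z Z' \<and> (\<forall>x. d < infdist x (range K) \<longrightarrow> Z x = 0) \<and>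
    (\<forall>x. trace3 (Z' x) = knot_field d J x \<bullet> knot_smear d K x)"
proof -
  obtain \<delta> where \<delta>: "\<delta> > 0" "\<And>x y. x \<in> range K \<Longrightarrow> y \<in> range J \<Longrightarrow> \<delta> \<le> dist x y"
    using separate_compact_closed[OF compact_knot[OF K] compact_imp_closed[OF compact_knot[OF J]] disj] by blast
  \<comment> \<open>With half the distance, the \<open>\<rho>\<close>-neighbourhood of
    \<open>K\<close> stays at distance \<open>\<rho>\<close> from \<open>J\<close>, and the field of
    \<open>J\<close> is closed on it once \<open>d < \<rho>\<close>.\<close>
  define \<rho> where "\<rho> = \<delta> / 2"
  have \<rho>: "\<rho> > 0" using \<delta> by (simp add: \<rho>_def)
  have far: "\<rho> \<le> infdist x (range J)" if "infdist x (range K) < \<rho>" for x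
  proof (rule ccontr)
    assume "\<not> ?thesis"
    with that obtain s t where "dist x (K s) < \<rho>" "dist x (J t) < \<rho>" by (auto simp: infdist_less_iff not_le)
    then show False
      using \<delta>(2)[of "K s" "J t"] dist_triangle2[of "K s" "J t" x] by (auto simp: \<rho>_def dist_commute)
  qed
  obtain \<eta> where \<eta>: "\<eta> > 0" "\<And>B B'. C1_on {x. infdist x (range K) < \<rho>} B B' \<Longrightarrow>
      sym_deriv_on {x. infdist x (range K) < \<rho>} B' \<Longrightarrow> integral {0..1} (\<lambda>t. B (K t) \<bullet> velocity K t) = 0 \<Longrightarrow>
      \<exists>G. \<forall>x. infdist x (range K) < \<eta> \<longrightarrow> (G has_derivative (\<lambda>u. B x \<bullet> u)) (at x)"
    using primitive_near_knot[OF K \<rho>] by blast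
  have "\<forall>\<^sub>F d in at_right 0. d \<in> {0<..<min \<rho> \<eta>}"
    using \<rho> \<eta>(1) by (intro eventually_at_right_real) auto
  moreover have "\<forall>\<^sub>F d in at_right 0. integral {0..1} (\<lambda>t. knot_field d J (K t) \<bullet> velocity K t) = 0"
    by (rule linking_number_0_integral[OF J K disj lk])
  ultimately show ?thesis
  proof eventually_elim
    case (elim d)
    then have d: "0 < d" "d < \<rho>" "d < \<eta>" by auto
    have "sym_deriv_on {x. infdist x (range K) < \<rho>} (knot_field_deriv d J)"
      by (rule sym_deriv_on_knot_field[OF J d(1)]) (use d(2) in \<open>auto dest!: far\<close>)
    from \<eta>(2)[OF C1_on_subset[OF C1_on_knot_field[OF J]] this elim(2)] obtain G
      where G: "\<And>x. infdist x (range K) < \<eta> \<Longrightarrow> (G has_derivative (\<lambda>u. knot_field d J x \<bullet> u)) (at x)" by blast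
    have cont: "continuous_on S (knot_field d J)" for S
      using C1_on_continuous[OF C1_on_subset[OF C1_on_knot_field[OF J]]] by blast
    have "\<exists>Z Z'. C1_on UNIV Z Z' \<and> (\<forall>x. trace3 (Z' x) = knot_field d J x \<bullet> knot_smear d K x) \<and>
        (\<forall>x. x \<notin> {x. infdist x (range K) \<le> d} \<longrightarrow> Z x = 0)"
    proof (rule C1_on_cutoff[OF _ _ _ C1_on_knot_smear[OF K] _ divergence_knot_smear[OF K]])
      show "open {x. infdist x (range K) < \<eta>}" by (intro open_Collect_less continuous_intros)
      show "closed {x. infdist x (range K) \<le> d}" by (intro closed_Collect_le continuous_intros)
    qed (use d G cont knot_smear_eq_0[OF K d(1)] in auto)
    then show ?case by (auto simp: not_le)
  qed
qed

text \<open>Let \<open>A\<close> and \<open>B\<close> be vector potentials of the smeared curves \<open>k\<close> and \<open>j\<close>. The divergence of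
  \<open>cross3 A B\<close> is \<open>B \<bullet> k - A \<bullet> j\<close>. As the linking number vanishes, \<open>B\<close> is the gradient of a
  function \<open>G\<close> on the support of \<open>k\<close>, and \<open>A\<close> is the gradient of a function \<open>H\<close> on the support of
  \<open>j\<close>, so that \<open>cross3 A B - G k + H j\<close> is free of divergence and has a vector potential.\<close>

lemma heisenberg_third_form:
  assumes K: "smooth_knot K" and J: "smooth_knot J" and disj: "range K \<inter> range J = {}"
    and lk: "has_linking_number K J 0" "has_linking_number J K 0"
  shows "\<forall>\<^sub>F d in at_right 0. \<exists>D D'. C1_on UNIV D D' \<and>
    (\<forall>x\<in>off_nbhd (range K \<union> range J) d. \<forall>u v. D' x u \<bullet> v - D' x v \<bullet> u =
      (knot_field d K x \<bullet> v) * (knot_field d J x \<bullet> u) - (knot_field d K x \<bullet> u) * (knot_field d J x \<bullet> v))"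
proof -
  have "range J \<inter> range K = {}" using disj by blast
  from smear_correction[OF K J disj lk(2)] smear_correction[OF J K this lk(1)]
  show ?thesis
  proof eventually_elim
    case (elim d)
    let ?A = "knot_field d K" and ?B = "knot_field d J"
    obtain Z Z' where Z: "C1_on UNIV Z Z'" "\<And>x. d < infdist x (range K) \<Longrightarrow> Z x = 0"
      "\<And>x. trace3 (Z' x) = ?B x \<bullet> knot_smear d K x" using elim(1) by blast
    obtain Y Y' where Y: "C1_on UNIV Y Y'" "\<And>x. d < infdist x (range J) \<Longrightarrow> Y x = 0"
      "\<And>x. trace3 (Y' x) = ?A x \<bullet> knot_smear d J x" using elim(2) by blast
    define W where "W x = cross3 (?A x) (?B x) + (- Z x + Y x)" for x
    define X' where "X' x u = cross3 (?A x) (knot_field_deriv d J x u) + cross3 (knot_field_deriv d K x u) (?B x)" for x u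
    define W' where "W' x u = X' x u + (- Z' x u + Y' x u)" for x u
    have W: "C1_on UNIV W W'"
      unfolding W_def[abs_def] W'_def[abs_def] X'_def
      by (intro C1_on_add C1_on_minus Z Y C1_on_bilinear[OF bounded_bilinear_cross3] C1_on_knot_field K J)
    have div: "trace3 (W' x) = 0" for x
    proof -
      have "trace3 (X' x) = ?B x \<bullet> knot_smear d K x - ?A x \<bullet> knot_smear d J x"
        unfolding X'_def
        by (intro divergence_cross3 C1_on_linear[OF C1_on_knot_field] K J curl_knot_field UNIV_I)
      moreover have "trace3 (W' x) = trace3 (X' x) - trace3 (Z' x) + trace3 (Y' x)"
        by (simp add: trace3_def W'_def sum.distrib sum_subtractf sum_negf)
      ultimately show ?thesis using Z(3) Y(3) by simp
    qed
    show ?case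
    proof (intro exI conjI ballI allI)
      \<comment> \<open>The sign is the one that \<open>flat_on_heis\<close> needs: the curl of the
        corner form has to cancel \<open>cross3 A B\<close>.\<close>
      show "C1_on UNIV (\<lambda>x. - vector_potential W x) (\<lambda>x u. - vector_potential_deriv W W' x u)"
        by (intro C1_on_minus C1_on_vector_potential W)
      fix x u v assume "x \<in> off_nbhd (range K \<union> range J) d"
      then have x: "d < infdist x (range K \<union> range J)" by (simp add: off_nbhd_def)
      have "infdist x (range K \<union> range J) \<le> infdist x (range K)" "infdist x (range K \<union> range J) \<le> infdist x (range J)"
        by (auto intro!: infdist_mono)
      then have "W x = cross3 (?A x) (?B x)" using x Z(2)[of x] Y(2)[of x] by (simp add: W_def)
      then have "W x \<bullet> cross3 u v = (?A x \<bullet> u) * (?B x \<bullet> v) - (?A x \<bullet> v) * (?B x \<bullet> u)"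
        by (simp add: inner_vec_def sum_3 cross_components algebra_simps)
      with curl_vector_potential[OF W div, of x u v]
      show "- vector_potential_deriv W W' x u \<bullet> v - - vector_potential_deriv W W' x v \<bullet> u =
          ?A x \<bullet> v * (?B x \<bullet> u) - ?A x \<bullet> u * (?B x \<bullet> v)" by simp
    qed
  qed
qed

lemma heisenberg_transport:
  assumes K: "smooth_knot K" and J: "smooth_knot J" and disj: "range K \<inter> range J = {}"
    and lk: "has_linking_number K J 0" "has_linking_number J K 0"
  shows "\<exists>T. flat_family (- (range K \<union> range J)) (at_right 0) (off_nbhd (range K \<union> range J)) T \<and>
    (\<forall>d x y. hx (T d x y) = lint (knot_field d K) x y \<and> hy (T d x y) = lint (knot_field d J) x y)"
proof -
  let ?R = "range K \<union> range J"
  define P where "P d D \<longleftrightarrow> (\<exists>D'. C1_on UNIV D D' \<and>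
    (\<forall>x\<in>off_nbhd ?R d. \<forall>u v. D' x u \<bullet> v - D' x v \<bullet> u =
      (knot_field d K x \<bullet> v) * (knot_field d J x \<bullet> u) - (knot_field d K x \<bullet> u) * (knot_field d J x \<bullet> v)))"
    for d and D :: "real^3 \<Rightarrow> real^3"
  \<comment> \<open>A suitable \<open>D\<close> is known to exist for small \<open>d\<close> only;
    elsewhere the choice may be arbitrary.\<close>
  define D where "D d = (SOME D. P d D)" for d
  define T where "T d x y = Heis (lint (knot_field d K) x y) (lint (knot_field d J) x y)
      (lint (\<lambda>z. D d z + lint (knot_field d K) x z *\<^sub>R knot_field d J z) x y)" for d x y
  have "flat_family (- ?R) (at_right 0) (off_nbhd ?R) T"
  proof
    show "\<forall>\<^sub>F d in at_right 0. flat_on (off_nbhd ?R d) (T d)"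
      using heisenberg_third_form[OF assms] eventually_at_right_less[of "0 :: real"]
    proof eventually_elim
      case (elim d)
      then have "\<exists>D. P d D" unfolding P_def by blast
      then have "P d (D d)" unfolding D_def by (rule someI_ex)
      then obtain D' where D': "C1_on UNIV (D d) D'"
        "\<And>x u v. x \<in> off_nbhd ?R d \<Longrightarrow> D' x u \<bullet> v - D' x v \<bullet> u =
          (knot_field d K x \<bullet> v) * (knot_field d J x \<bullet> u) - (knot_field d K x \<bullet> u) * (knot_field d J x \<bullet> v)"
        unfolding P_def by blast
      have le: "infdist x ?R \<le> infdist x (range K)" "infdist x ?R \<le> infdist x (range J)" for x
        by (auto intro!: infdist_mono)
      have "sym_deriv_on (off_nbhd ?R d) (knot_field_deriv d K)"
        by (rule sym_deriv_on_knot_field[OF K]) (use elim le in \<open>auto simp: off_nbhd_def intro: less_imp_le less_le_trans\<close>)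
      moreover have "sym_deriv_on (off_nbhd ?R d) (knot_field_deriv d J)"
        by (rule sym_deriv_on_knot_field[OF J]) (use elim le in \<open>auto simp: off_nbhd_def intro: less_imp_le less_le_trans\<close>)
      ultimately show ?case
        unfolding T_def[abs_def]
        by (intro flat_on_heis[OF open_off_nbhd C1_on_subset[OF C1_on_knot_field[OF K]] _
              C1_on_subset[OF C1_on_knot_field[OF J]] _ C1_on_subset[OF D'(1)] D'(2)]) auto
    qed
  next
    fix C assume "compact C" "C \<subseteq> - ?R"
    moreover have "closed ?R"
      using K J by (intro closed_Un compact_imp_closed compact_knot)
    ultimately show "\<forall>\<^sub>F d in at_right 0. C \<subseteq> off_nbhd ?R d" by (intro off_nbhd_exhaust) auto
  qed
  then show ?thesis by (intro exI[of _ T]) (simp add: T_def)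
qed

section \<open>Meridians\<close>

definition circ :: "real^3 \<Rightarrow> real^3 \<Rightarrow> real \<Rightarrow> real^3" where
  "circ u v s = cos (2 * pi * s) *\<^sub>R u + sin (2 * pi * s) *\<^sub>R v"

definition circ' :: "real^3 \<Rightarrow> real^3 \<Rightarrow> real \<Rightarrow> real^3" where
  "circ' u v s = (2 * pi) *\<^sub>R (cos (2 * pi * s) *\<^sub>R v - sin (2 * pi * s) *\<^sub>R u)"

lemma polar_radius: "(r * cos x)\<^sup>2 + (r * sin x)\<^sup>2 = (r :: real)\<^sup>2"
  by (simp add: power_mult_distrib flip: distrib_left)

lemma circ_derivative: "(circ u v has_vector_derivative circ' u v s) (at s)"
proof -
  have "((\<lambda>s. cos (2 * pi * s)) has_real_derivative - sin (2 * pi * s) * (2 * pi)) (at s)"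
    and "((\<lambda>s. sin (2 * pi * s)) has_real_derivative cos (2 * pi * s) * (2 * pi)) (at s)"
    by (auto intro!: derivative_eq_intros)
  from has_vector_derivative_add[OF
      has_vector_derivative_scaleR[OF this(1) has_vector_derivative_const[of u]]
      has_vector_derivative_scaleR[OF this(2) has_vector_derivative_const[of v]]]
  show ?thesis
    unfolding circ_def[abs_def] circ'_def by (simp add: algebra_simps)
qed

lemma circ_continuous: "continuous_on S (circ u v)" "continuous_on S (circ' u v)"
  unfolding circ_def[abs_def] circ'_def[abs_def] by (intro continuous_intros)+

lemma circ_cross: "cross3 (circ u v s) (circ' u v s) = (2 * pi) *\<^sub>R cross3 u v"
proof -
  have "cross3 (a *\<^sub>R u + b *\<^sub>R v) (c *\<^sub>R (a *\<^sub>R v - b *\<^sub>R u)) = (c * (a\<^sup>2 + b\<^sup>2)) *\<^sub>R cross3 u v" for a b c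
    by (simp add: vec_eq_iff forall_3 cross_components algebra_simps power2_eq_square)
  then show ?thesis unfolding circ_def circ'_def by simp
qed

text \<open>Stokes' theorem on a round disc, infinitesimally in the radius.\<close>

lemma circle_integral_derivative:
  assumes A: "C1_on UNIV A A'" and curl: "\<And>x u v. A' x u \<bullet> v - A' x v \<bullet> u = k x \<bullet> cross3 u v"
  shows "((\<lambda>\<rho>. integral {0..1} (\<lambda>s. A (p + \<rho> *\<^sub>R circ u v s) \<bullet> (\<rho> *\<^sub>R circ' u v s))) has_real_derivative
    integral {0..1} (\<lambda>s. 2 * pi * \<rho> * (k (p + \<rho> *\<^sub>R circ u v s) \<bullet> cross3 u v))) (at \<rho>)"
proof -
  let ?x = "\<lambda>\<rho> s. p + \<rho> *\<^sub>R circ u v s"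
  define f where "f \<rho> s = A (?x \<rho> s) \<bullet> (\<rho> *\<^sub>R circ' u v s)" for \<rho> s
  define f' where "f' \<rho> s h = A (?x \<rho> s) \<bullet> (h *\<^sub>R circ' u v s) + A' (?x \<rho> s) (h *\<^sub>R circ u v s) \<bullet> (\<rho> *\<^sub>R circ' u v s)"
    for \<rho> s h
  have circ_snd: "continuous_on (UNIV \<times> {0..1}) (\<lambda>z :: real \<times> real. circ u v (snd z))"
    "continuous_on (UNIV \<times> {0..1}) (\<lambda>z :: real \<times> real. circ' u v (snd z))"
    by (rule continuous_on_compose2[OF circ_continuous(1)[of UNIV]] continuous_on_compose2[OF circ_continuous(2)[of UNIV]];
        force intro: continuous_intros)+
  have "C1_on UNIV (\<lambda>\<rho>. integral {0..1} (f \<rho>)) (\<lambda>\<rho> h. integral {0..1} (\<lambda>s. f' \<rho> s h))"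
  proof (rule C1_on_integral)
    fix \<rho> s :: real
    have "((\<lambda>\<rho>. ?x \<rho> s) has_derivative (\<lambda>h. h *\<^sub>R circ u v s)) (at \<rho>)"
      by (auto intro!: derivative_eq_intros)
    from has_derivative_compose[OF this C1_onD[OF A]]
    have 1: "((\<lambda>\<rho>. A (?x \<rho> s)) has_derivative (\<lambda>h. A' (?x \<rho> s) (h *\<^sub>R circ u v s))) (at \<rho>)" by simp
    have 2: "((\<lambda>\<rho>. \<rho> *\<^sub>R circ' u v s) has_derivative (\<lambda>h. h *\<^sub>R circ' u v s)) (at \<rho>)"
      by (auto intro!: derivative_eq_intros)
    show "((\<lambda>\<rho>. f \<rho> s) has_derivative f' \<rho> s) (at \<rho>)"
      unfolding f_def f'_def by (rule has_derivative_inner[OF 1 2])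
  next
    fix h show "continuous_on (UNIV \<times> {0..1}) (\<lambda>(\<rho>, s). f' \<rho> s h)"
      unfolding f'_def case_prod_unfold
      by (intro continuous_intros C1_on_continuous_derivative[OF A] C1_on_continuous_compose[OF A] circ_snd) auto
  next
    fix \<rho> :: real show "continuous_on {0..1} (f \<rho>)"
      unfolding f_def by (intro continuous_intros C1_on_continuous_compose[OF A] circ_continuous) auto
  qed auto
  moreover have "integral {0..1} (\<lambda>s. f' \<rho> s h) =
      h * integral {0..1} (\<lambda>s. 2 * pi * \<rho> * (k (?x \<rho> s) \<bullet> cross3 u v))" for h
  proof -
    have lin: "linear (A' x)" for x using C1_on_linear[OF A] by blast
    \<comment> \<open>The derivative in \<open>s\<close> of \<open>A \<bullet> circ\<close> around
      the circle, which integrates to 0. Subtracting it leaves the flux of the curl.\<close>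
    define g where "g s = A' (?x \<rho> s) (\<rho> *\<^sub>R circ' u v s) \<bullet> circ u v s + A (?x \<rho> s) \<bullet> circ' u v s" for s
    have "((\<lambda>s. g s) has_integral (A (?x \<rho> 1) \<bullet> circ u v 1 - A (?x \<rho> 0) \<bullet> circ u v 0)) {0..1}"
    proof (rule fundamental_theorem_of_calculus)
      fix s :: real
      have circ: "(circ u v has_derivative (\<lambda>h. h *\<^sub>R circ' u v s)) (at s)"
        using circ_derivative[of u v s] by (simp add: has_vector_derivative_def)
      then have "((\<lambda>s. ?x \<rho> s) has_derivative (\<lambda>h. h *\<^sub>R (\<rho> *\<^sub>R circ' u v s))) (at s)"
        by (auto intro!: derivative_eq_intros)
      from has_derivative_compose[OF this C1_onD[OF A]]
      have "((\<lambda>s. A (?x \<rho> s)) has_derivative (\<lambda>h. A' (?x \<rho> s) (h *\<^sub>R (\<rho> *\<^sub>R circ' u v s)))) (at s)" by simp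
      from has_derivative_inner[OF this circ]
      have "((\<lambda>s. A (?x \<rho> s) \<bullet> circ u v s) has_derivative
          (\<lambda>h. A (?x \<rho> s) \<bullet> (h *\<^sub>R circ' u v s) + A' (?x \<rho> s) (h *\<^sub>R (\<rho> *\<^sub>R circ' u v s)) \<bullet> circ u v s)) (at s)" .
      moreover have "(\<lambda>h. A (?x \<rho> s) \<bullet> (h *\<^sub>R circ' u v s) + A' (?x \<rho> s) (h *\<^sub>R (\<rho> *\<^sub>R circ' u v s)) \<bullet> circ u v s) =
          (\<lambda>h. h *\<^sub>R g s)"
        unfolding g_def linear_cmul[OF lin] by (simp add: algebra_simps)
      ultimately show "((\<lambda>s. A (?x \<rho> s) \<bullet> circ u v s) has_vector_derivative g s) (at s within {0..1})"
        unfolding has_vector_derivative_def by (simp add: has_derivative_at_withinI)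
    qed simp
    moreover have "circ u v 1 = circ u v 0" by (simp add: circ_def)
    ultimately have g0: "(g has_integral 0) {0..1}" by simp
    have f'_form: "f' \<rho> s h = h * (2 * pi * \<rho> * (k (?x \<rho> s) \<bullet> cross3 u v)) + h * g s" for s h
    proof -
      have "A' (?x \<rho> s) (circ u v s) \<bullet> circ' u v s - A' (?x \<rho> s) (circ' u v s) \<bullet> circ u v s =
          2 * pi * (k (?x \<rho> s) \<bullet> cross3 u v)"
        unfolding curl circ_cross by simp
      then have *: "A' (?x \<rho> s) (circ u v s) \<bullet> circ' u v s =
          2 * pi * (k (?x \<rho> s) \<bullet> cross3 u v) + A' (?x \<rho> s) (circ' u v s) \<bullet> circ u v s" by simp
      show ?thesis
        unfolding f'_def g_def linear_cmul[OF lin] inner_scaleR_left inner_scaleR_right * by (simp add: algebra_simps)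
    qed
    have f'_eq: "2 * pi * \<rho> * (k (?x \<rho> s) \<bullet> cross3 u v) = f' \<rho> s 1 - g s"
      "f' \<rho> s h = h * f' \<rho> s 1" for s
      unfolding f'_form by (simp_all add: distrib_left)
    have "(\<lambda>s. f' \<rho> s 1) integrable_on {0..1}"
      unfolding f'_def
      by (intro integrable_continuous_real continuous_intros C1_on_continuous_derivative[OF A]
          C1_on_continuous_compose[OF A] circ_continuous) auto
    then have "((\<lambda>s. f' \<rho> s 1 - g s) has_integral (integral {0..1} (\<lambda>s. f' \<rho> s 1) - 0)) {0..1}"
      by (intro has_integral_diff g0 integrable_integral)
    then have "integral {0..1} (\<lambda>s. f' \<rho> s 1 - g s) = integral {0..1} (\<lambda>s. f' \<rho> s 1)"
      by (simp add: integral_unique)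
    then show ?thesis unfolding f'_eq(1) by (subst f'_eq(2)) simp
  qed
  ultimately have "((\<lambda>\<rho>. integral {0..1} (f \<rho>)) has_derivative
      (\<lambda>h. h * integral {0..1} (\<lambda>s. 2 * pi * \<rho> * (k (?x \<rho> s) \<bullet> cross3 u v)))) (at \<rho>)"
    using C1_onD[of UNIV _ _ \<rho>] by fastforce
  then show ?thesis unfolding f_def[abs_def] by (simp add: has_field_derivative_def mult_commute_abs)
qed

text \<open>The circulation is 0 at radius 0. Its derivative in the radius is a flux integral, which
  is nonnegative up to \<open>r\<close> and positive at small positive radii.\<close>

lemma circle_integral_pos:
  assumes A: "C1_on UNIV A A'" and curl: "\<And>x u v. A' x u \<bullet> v - A' x v \<bullet> u = k x \<bullet> cross3 u v"
    and k: "continuous_on UNIV k" and r: "0 < r" and e: "0 < e"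
    and nonneg: "\<And>\<rho> s. 0 \<le> \<rho> \<Longrightarrow> \<rho> \<le> r \<Longrightarrow> 0 \<le> k (p + \<rho> *\<^sub>R circ u v s) \<bullet> cross3 u v"
    and pos: "\<And>\<rho> s. 0 \<le> \<rho> \<Longrightarrow> \<rho> < e \<Longrightarrow> 0 < k (p + \<rho> *\<^sub>R circ u v s) \<bullet> cross3 u v"
  shows "0 < integral {0..1} (\<lambda>s. A (p + r *\<^sub>R circ u v s) \<bullet> (r *\<^sub>R circ' u v s))"
proof -
  define \<Phi> where "\<Phi> \<rho> = integral {0..1} (\<lambda>s. A (p + \<rho> *\<^sub>R circ u v s) \<bullet> (\<rho> *\<^sub>R circ' u v s))" for \<rho>
  define \<phi> where "\<phi> \<rho> = integral {0..1} (\<lambda>s. 2 * pi * \<rho> * (k (p + \<rho> *\<^sub>R circ u v s) \<bullet> cross3 u v))" for \<rho>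
  have deriv: "(\<Phi> has_real_derivative \<phi> \<rho>) (at \<rho>)" for \<rho>
    unfolding \<Phi>_def[abs_def] \<phi>_def by (rule circle_integral_derivative[OF A curl])
  have cont: "continuous_on {0..1} (\<lambda>s. 2 * pi * \<rho> * (k (p + \<rho> *\<^sub>R circ u v s) \<bullet> cross3 u v))" for \<rho>
    by (intro continuous_intros continuous_on_compose2[OF k] circ_continuous) auto
  have "\<phi> \<rho> \<ge> 0" if "0 \<le> \<rho>" "\<rho> \<le> r" for \<rho>
    unfolding \<phi>_def using nonneg that integrable_continuous_real[OF cont] by (intro integral_nonneg) auto
  then have mono: "\<Phi> a \<le> \<Phi> b" if "0 \<le> a" "a \<le> b" "b \<le> r" for a b
    using that deriv by (intro DERIV_nonneg_imp_nondecreasing[of a b \<Phi>]) (auto intro!: exI)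
  have strict: "\<phi> \<rho> > 0" if "0 < \<rho>" "\<rho> < e" for \<rho>
  proof -
    have nn: "0 \<le> 2 * pi * \<rho> * (k (p + \<rho> *\<^sub>R circ u v s) \<bullet> cross3 u v)" for s
      using pos[of \<rho> s] that by simp
    have "\<phi> \<rho> \<noteq> 0"
      unfolding \<phi>_def integral_eq_0_iff[OF cont zero_less_one nn]
      using pos[of \<rho> 0] that by (auto intro!: bexI[of _ 0])
    moreover have "\<phi> \<rho> \<ge> 0"
      unfolding \<phi>_def using nn integrable_continuous_real[OF cont] by (intro integral_nonneg) auto
    ultimately show ?thesis by simp
  qed
  define a where "a = min r e / 2"
  have a: "0 < a" "a < e" "a \<le> r" using r e by (auto simp: a_def)
  have "\<Phi> 0 < \<Phi> a"
  proof (rule DERIV_pos_imp_increasing_open[OF a(1)])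
    fix \<rho> assume "0 < \<rho>" "\<rho> < a"
    then show "\<exists>y. (\<Phi> has_real_derivative y) (at \<rho>) \<and> 0 < y" using deriv strict a by force
  next
    show "continuous_on {0..a} \<Phi>"
      by (intro continuous_at_imp_continuous_on ballI DERIV_isCont[OF deriv])
  qed
  moreover have "\<Phi> 0 = 0" by (simp add: \<Phi>_def)
  ultimately show ?thesis using mono[of a r] a unfolding \<Phi>_def by simp
qed

lemma meridian_curveE:
  assumes "c \<in> meridian_curves S K"
  obtains t r u v where "r > 0" "norm u = 1" "norm v = 1" "orthogonal u v"
    "cross3 u v \<bullet> velocity K t > 0"
    "\<And>a b. 0 < a\<^sup>2 + b\<^sup>2 \<Longrightarrow> a\<^sup>2 + b\<^sup>2 \<le> r\<^sup>2 \<Longrightarrow> K t + a *\<^sub>R u + b *\<^sub>R v \<in> S"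
    "c = (\<lambda>s. K t + r *\<^sub>R circ u v s)"
proof -
  obtain t r u v where *: "r > 0" "norm u = 1" "norm v = 1" "orthogonal u v"
    "cross3 u v \<bullet> velocity K t > 0"
    "\<forall>a b. 0 < a\<^sup>2 + b\<^sup>2 \<and> a\<^sup>2 + b\<^sup>2 \<le> r\<^sup>2 \<longrightarrow> K t + a *\<^sub>R u + b *\<^sub>R v \<in> S"
    "c = (\<lambda>s. K t + (r * cos (2 * pi * s)) *\<^sub>R u + (r * sin (2 * pi * s)) *\<^sub>R v)"
    using assms unfolding meridian_curves_def by blast
  show ?thesis
    by (rule that[OF *(1-5)]) (use *(6,7) in \<open>auto simp: circ_def algebra_simps\<close>)
qed

lemma meridian_curve_loop:
  assumes "c \<in> meridian_curves S K"
  shows "path c" "path_image c \<subseteq> S" "pathstart c = pathfinish c"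
proof -
  obtain t r u v where *: "r > 0" "\<And>a b. 0 < a\<^sup>2 + b\<^sup>2 \<Longrightarrow> a\<^sup>2 + b\<^sup>2 \<le> r\<^sup>2 \<Longrightarrow> K t + a *\<^sub>R u + b *\<^sub>R v \<in> S"
    and c: "c = (\<lambda>s. K t + r *\<^sub>R circ u v s)"
    using meridian_curveE[OF assms] by metis
  show "path c" unfolding path_def c by (intro continuous_intros circ_continuous)
  show "pathstart c = pathfinish c" by (simp add: c circ_def pathstart_def pathfinish_def)
  have "c s \<in> S" for s
  proof -
    from *(2)[of "r * cos (2 * pi * s)" "r * sin (2 * pi * s)", unfolded polar_radius] *(1) show ?thesis
      by (simp add: c circ_def scaleR_add_right add.assoc)
  qed
  then show "path_image c \<subseteq> S" by (auto simp: path_image_def)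
qed

lemma norm_circ:
  assumes "norm u = 1" "norm v = 1" "orthogonal u v"
  shows "norm (circ u v s) = 1"
proof -
  have "circ u v s \<bullet> circ u v s = (cos (2 * pi * s))\<^sup>2 * (u \<bullet> u) + (sin (2 * pi * s))\<^sup>2 * (v \<bullet> v)
      + 2 * cos (2 * pi * s) * sin (2 * pi * s) * (u \<bullet> v)"
    by (simp add: circ_def inner_add_left inner_add_right inner_commute[of v u] power2_eq_square algebra_simps)
  then have "(norm (circ u v s))\<^sup>2 = 1"
    using assms by (simp add: orthogonal_def dot_square_norm)
  then show ?thesis using norm_ge_zero[of "circ u v s"] unfolding power2_eq_1_iff by linarith
qed

text \<open>The disc bounded by a meridian of \<open>K\<close> lies in \<open>S\<close> except for
  its centre, which is on \<open>K\<close>; so it misses \<open>J\<close> and contracts the meridian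
  in the complement of \<open>J\<close>.\<close>

lemma meridian_hol_other:
  assumes J: "smooth_knot J" and c: "c \<in> meridian_curves S K"
    and disj: "S \<inter> range J = {}" "range K \<inter> range J = {}"
  shows "\<forall>\<^sub>F d in at_right 0. hol (lint (knot_field d J)) c = 0"
proof -
  obtain t r u v where r: "r > 0" and disc: "\<And>a b. 0 < a\<^sup>2 + b\<^sup>2 \<Longrightarrow> a\<^sup>2 + b\<^sup>2 \<le> r\<^sup>2 \<Longrightarrow> K t + a *\<^sub>R u + b *\<^sub>R v \<in> S"
    and c: "c = (\<lambda>s. K t + r *\<^sub>R circ u v s)"
    using meridian_curveE[OF c] by metis
  define F where "F z = K t + fst z *\<^sub>R u + snd z *\<^sub>R v" for z :: "real \<times> real"
  define g where "g s = (r * cos (2 * pi * s), r * sin (2 * pi * s))" for s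
  have F: "continuous_on (cball 0 r) F" unfolding F_def by (intro continuous_intros)
  have "F z \<in> - range J" if "z \<in> cball 0 r" for z
  proof (cases "z = 0")
    case True
    then show ?thesis using disj by (auto simp: F_def)
  next
    case False
    then have "0 < (norm z)\<^sup>2" "(norm z)\<^sup>2 \<le> r\<^sup>2" using that by (auto simp: power_mono)
    then show ?thesis
      using disc[of "fst z" "snd z"] disj by (auto simp: F_def norm_prod_def)
  qed
  then have "F ` cball 0 r \<subseteq> - range J" by (rule image_subsetI)
  then have "\<forall>\<^sub>F d in at_right 0. F ` cball 0 r \<subseteq> off_nbhd (range J) d"
    by (intro off_nbhd_exhaust compact_continuous_image[OF F] compact_cball
        compact_imp_closed[OF compact_knot[OF J]]) simp_all
  then show ?thesis
    using eventually_at_right_less[of "0 :: real"]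
  proof eventually_elim
    case (elim d)
    have "norm (g s) = r" for s using r by (simp add: g_def norm_Pair polar_radius)
    then have "path_image g \<subseteq> cball 0 r" by (auto simp: path_image_def)
    moreover have "path g" unfolding path_def g_def by (intro continuous_intros)
    moreover have "pathstart g = pathfinish g" by (simp add: g_def pathstart_def pathfinish_def)
    ultimately have "hol (lint (knot_field d J)) (F \<circ> g) = 0"
      by (intro hol_convex_loop[OF flat_on_knot_field[OF J elim(2)] compact_cball convex_cball F elim(1)])
    moreover have "F \<circ> g = c" by (auto simp: fun_eq_iff F_def g_def c circ_def algebra_simps)
    ultimately show ?case by simp
  qed
qed

text \<open>By Stokes the holonomy is the flux of the smeared knot through the meridian disc. For
  small \<open>d\<close> only parts of \<open>K\<close> that cross in the positive direction
  contribute, and the crossing at the centre does contribute.\<close>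

lemma meridian_hol:
  assumes K: "smooth_knot K" and c: "c \<in> meridian_curves S K" and disj: "S \<inter> range K = {}"
  shows "\<forall>\<^sub>F d in at_right 0. hol (lint (knot_field d K)) c \<noteq> 0"
proof -
  obtain t r u v where r: "r > 0" and uv: "norm u = 1" "norm v = 1" "orthogonal u v"
    and n: "cross3 u v \<bullet> velocity K t > 0"
    and disc: "\<And>a b. 0 < a\<^sup>2 + b\<^sup>2 \<Longrightarrow> a\<^sup>2 + b\<^sup>2 \<le> r\<^sup>2 \<Longrightarrow> K t + a *\<^sub>R u + b *\<^sub>R v \<in> S"
    and c_eq: "c = (\<lambda>s. K t + r *\<^sub>R circ u v s)"
    by (rule meridian_curveE[OF c]) (rule that; assumption)
  define D where "D = (\<lambda>z :: real \<times> real. K t + fst z *\<^sub>R u + snd z *\<^sub>R v) ` cball 0 r"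
  \<comment> \<open>The part of the knot that runs against, or parallel to, the disc. It is compact
    and misses the disc, so it is too far away to matter once \<open>d\<close> is below the distance
    between them.\<close>
  define bad where "bad = K ` {s \<in> {0..1}. velocity K s \<bullet> cross3 u v \<le> 0}"
  have "compact D" unfolding D_def by (intro compact_continuous_image continuous_intros compact_cball)
  moreover have "compact {s \<in> {0..1}. velocity K s \<bullet> cross3 u v \<le> 0}"
  proof -
    have "closed {s. velocity K s \<bullet> cross3 u v \<le> 0}"
      by (intro closed_Collect_le continuous_intros continuous_velocity[OF K])
    then have "compact ({0..1} \<inter> {s. velocity K s \<bullet> cross3 u v \<le> 0})"
      by (intro compact_Int_closed) auto
    then show ?thesis by (simp add: Int_def)
  qed
  then have "closed bad"
    unfolding bad_def
    by (intro compact_imp_closed compact_continuous_image continuous_on_subset[OF knot_continuous[OF K]]) auto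
  moreover have "D \<inter> bad = {}"
  proof (rule ccontr)
    assume "D \<inter> bad \<noteq> {}"
    then obtain z s where z: "z \<in> cball 0 r" and zs: "K t + fst z *\<^sub>R u + snd z *\<^sub>R v = K s" and s: "velocity K s \<bullet> cross3 u v \<le> 0"
      unfolding D_def bad_def by (auto simp: image_iff)
    have "z = 0"
    proof (rule ccontr)
      assume "z \<noteq> 0"
      then have "0 < (norm z)\<^sup>2" "(norm z)\<^sup>2 \<le> r\<^sup>2" using z by (auto simp: power_mono)
      then have "K s \<in> S" using disc[of "fst z" "snd z"] zs by (auto simp: norm_prod_def)
      then show False using disj by auto
    qed
    then have "K s = K t" using zs by simp
    then have "frac s = frac t" by (simp add: knot_eq_iff[OF K])
    then have "velocity K s = velocity K t"
      using periodic_frac[of "velocity K", OF velocity_periodic[OF K]] by metis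
    then show False using s n by (simp add: inner_commute)
  qed
  ultimately obtain \<delta> where \<delta>: "\<delta> > 0" "\<And>x y. x \<in> D \<Longrightarrow> y \<in> bad \<Longrightarrow> \<delta> \<le> dist x y"
    using separate_compact_closed[of D bad] by blast
  have in_D: "K t + \<rho> *\<^sub>R circ u v s \<in> D" if "0 \<le> \<rho>" "\<rho> \<le> r" for \<rho> s
  proof -
    let ?z = "(\<rho> * cos (2 * pi * s), \<rho> * sin (2 * pi * s))"
    have "?z \<in> cball 0 r" using that by (simp add: norm_Pair polar_radius)
    moreover have "K t + \<rho> *\<^sub>R circ u v s = K t + fst ?z *\<^sub>R u + snd ?z *\<^sub>R v"
      by (simp add: circ_def algebra_simps)
    ultimately show ?thesis unfolding D_def by (rule_tac image_eqI)
  qed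
  have "\<forall>\<^sub>F d in at_right 0. path_image c \<subseteq> off_nbhd (range K) d"
    using meridian_curve_loop[OF c] disj compact_path_image
    by (intro off_nbhd_exhaust compact_imp_closed[OF compact_knot[OF K]]) auto
  with eventually_at_right_real[OF \<delta>(1)] show ?thesis
  proof eventually_elim
    case (elim d)
    then have d: "0 < d" "d < \<delta>" by auto
    have integrand: "continuous_on {0..1} (\<lambda>s. bump d (x - K s) * (velocity K s \<bullet> cross3 u v))" for x
      by (intro continuous_intros continuous_on_subset[OF knot_continuous[OF K]]
          continuous_on_subset[OF continuous_velocity[OF K]]) auto
    have k_eq: "knot_smear d K x \<bullet> cross3 u v = integral {0..1} (\<lambda>s. bump d (x - K s) * (velocity K s \<bullet> cross3 u v))" for x
    proof -
      have "(\<lambda>s. bump d (x - K s) *\<^sub>R velocity K s) integrable_on {0..1}"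
        by (intro integrable_continuous_real continuous_intros continuous_on_subset[OF knot_continuous[OF K]]
          continuous_on_subset[OF continuous_velocity[OF K]]) auto
      from has_integral_linear[OF integrable_integral[OF this] bounded_linear_inner_left, of "cross3 u v"]
      show ?thesis unfolding knot_smear_def smear_def by (simp add: o_def integral_unique)
    qed
    have nn: "0 \<le> bump d (x - K s) * (velocity K s \<bullet> cross3 u v)" if x: "x \<in> D" and s: "s \<in> {0..1}" for x s
    proof (cases "velocity K s \<bullet> cross3 u v \<le> 0")
      case True
      then have "K s \<in> bad" using s by (auto simp: bad_def)
      then have "d \<le> norm (x - K s)" using \<delta>(2)[OF x] d by (force simp: dist_norm)
      then show ?thesis using d by (simp add: bump_eq_0)
    qed (simp add: bump_nonneg)
    have "0 < integral {0..1} (\<lambda>s. knot_field d K (K t + r *\<^sub>R circ u v s) \<bullet> (r *\<^sub>R circ' u v s))"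
    proof (rule circle_integral_pos[OF C1_on_knot_field[OF K] curl_knot_field[OF K] _ r])
      show "continuous_on UNIV (knot_smear d K)" by (rule C1_on_continuous[OF C1_on_knot_smear[OF K]])
      show "0 < min d r" using d r by simp
      fix \<rho> s
      { assume "0 \<le> \<rho>" "\<rho> \<le> r"
        then show "0 \<le> knot_smear d K (K t + \<rho> *\<^sub>R circ u v s) \<bullet> cross3 u v"
          unfolding k_eq using nn[OF in_D] integrable_continuous_real[OF integrand]
          by (intro integral_nonneg) auto }
      { assume \<rho>: "0 \<le> \<rho>" "\<rho> < min d r"
        let ?x = "K t + \<rho> *\<^sub>R circ u v s"
        have x: "?x \<in> D" using in_D \<rho> by simp
        \<comment> \<open>The meridian may sit at any real parameter; \<open>frac t\<close> is its
          representative in the interval of integration.\<close>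
        have t: "frac t \<in> {0..1}" using frac_ge_0[of t] frac_lt_1[of t] by simp
        have "0 < bump d (?x - K (frac t))"
          using \<rho> norm_circ[OF uv] d by (intro bump_pos) (auto simp: periodic_frac[of K, OF knot_periodic[OF K]])
        moreover have "0 < velocity K (frac t) \<bullet> cross3 u v"
          using n by (simp add: periodic_frac[of "velocity K", OF velocity_periodic[OF K]] inner_commute)
        ultimately have "0 < bump d (?x - K (frac t)) * (velocity K (frac t) \<bullet> cross3 u v)" by simp
        moreover have "(integral {0..1} (\<lambda>s. bump d (?x - K s) * (velocity K s \<bullet> cross3 u v)) = 0) =
            (\<forall>s\<in>{0..1}. bump d (?x - K s) * (velocity K s \<bullet> cross3 u v) = 0)"
          by (rule integral_eq_0_iff[OF integrand zero_less_one nn[OF x]])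
        ultimately have "knot_smear d K ?x \<bullet> cross3 u v \<noteq> 0"
          unfolding k_eq using t by (metis less_irrefl)
        moreover have "0 \<le> knot_smear d K ?x \<bullet> cross3 u v"
          unfolding k_eq using nn[OF x] integrable_continuous_real[OF integrand]
          by (intro integral_nonneg) auto
        ultimately show "0 < knot_smear d K ?x \<bullet> cross3 u v" by simp }
    qed
    moreover have "hol (lint (knot_field d K)) c =
        integral {0..1} (\<lambda>s. knot_field d K (c s) \<bullet> (r *\<^sub>R circ' u v s))"
    proof (rule hol_lint[OF open_off_nbhd[of "range K" d] C1_on_subset[OF C1_on_knot_field[OF K]]])
      show "sym_deriv_on (off_nbhd (range K) d) (knot_field_deriv d K)"
        by (rule sym_deriv_on_knot_field[OF K d(1)]) (simp add: off_nbhd_def)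
      show "(c has_vector_derivative r *\<^sub>R circ' u v s) (at s)" for s
        unfolding c_eq using circ_derivative[of u v s] by (auto intro!: derivative_eq_intros)
      show "continuous_on {0..1} (\<lambda>s. r *\<^sub>R circ' u v s)" by (intro continuous_intros circ_continuous)
    qed (use elim in \<open>auto simp: path_image_def\<close>)
    ultimately show ?case unfolding c_eq by linarith
  qed
qed


section \<open>Detecting the triple linking number\<close>

text \<open>Conjugation preserves the two abelian coordinates, and elements with equal abelian
  coordinates commute, so holonomy kills the defining relators of the Milnor group. Vanishing
  linking numbers make the holonomy of \<open>B 3\<close> central, hence independent of the arc to
  the base point, and it can be read off from a word in meridians.\<close>

lemma heisenberg_detects:
  fixes B :: "nat \<Rightarrow> real \<Rightarrow> real^3"
  assumes B: "smooth_link {1, 2, 3} B"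
    and lk: "\<And>i j. i \<in> {1, 2, 3} \<Longrightarrow> j \<in> {1, 2, 3} \<Longrightarrow> i \<noteq> j \<Longrightarrow> has_linking_number (B i) (B j) 0"
    and \<mu>: "has_triple_linking_number B \<mu>" "\<mu> \<noteq> 0"
  obtains U and T :: "real \<Rightarrow> real^3 \<Rightarrow> real^3 \<Rightarrow> heis" where
    "flat_family (link_complement {1, 2} B) (at_right 0) U T"
    "\<forall>\<^sub>F d in at_right 0. hx (hol (T d) (B 3)) = 0 \<and> hy (hol (T d) (B 3)) = 0 \<and> hz (hol (T d) (B 3)) \<noteq> 0"
proof -
  have K: "smooth_knot (B 1)" and J: "smooth_knot (B 2)" and L: "smooth_knot (B 3)"
    using B by (auto simp: smooth_link_def)
  have disj: "range (B i) \<inter> range (B j) = {}" if "i \<in> {1, 2, 3}" "j \<in> {1, 2, 3}" "i \<noteq> j" for i j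
    using B that by (auto simp: smooth_link_def disjoint_family_on_def)
  let ?R = "range (B 1) \<union> range (B 2)"
  define S where "S = link_complement {1, 2} B"
  have S: "S = - ?R" by (simp add: S_def link_complement_def)
  obtain T where T: "flat_family S (at_right 0) (off_nbhd ?R) T"
    and hT: "\<And>d x y. hx (T d x y) = lint (knot_field d (B 1)) x y"
      "\<And>d x y. hy (T d x y) = lint (knot_field d (B 2)) x y"
    using heisenberg_transport[OF K J disj lk lk] unfolding S by auto
  interpret flat_family S "at_right 0" "off_nbhd ?R" T by (rule T)
  have hol_comp: "\<forall>\<^sub>F d in at_right 0. hx (hol (T d) c) = hol (lint (knot_field d (B 1))) c \<and>
      hy (hol (T d) c) = hol (lint (knot_field d (B 2))) c" if c: "path c" "path_image c \<subseteq> S" for c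
    using flat eventually_path_image[OF c]
  proof eventually_elim
    case (elim d)
    show ?case
      using hol_hom[OF elim(1) c(1) elim(2), of hx] hol_hom[OF elim(1) c(1) elim(2), of hy]
      by (simp add: hT)
  qed
  define G where "G = fundamental_group S"
  obtain p m l w where p: "p \<in> S" and l: "l \<in> based_classes S p (B 3)"
    and m: "\<forall>i\<in>{1, 2}. m i \<in> meridians S p (B i)" and w: "fst ` set w \<subseteq> {1, 2}"
    and eq: "milnor_kernel {1, 2} B p #>\<^bsub>G p\<^esub> eval_word (G p) m w =
      milnor_kernel {1, 2} B p #>\<^bsub>G p\<^esub> l"
    and \<mu>_eq: "\<mu> = magnus w [1, 2]"
    using \<mu>(1) unfolding has_triple_linking_number_def Let_def S_def[symmetric] G_def by blast
  have G: "group (G p)" unfolding G_def by (rule group_fundamental_group[OF p])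
  interpret G: group "G p" by (rule G)
  have hom: "eventual_hom (at_right 0) (G p) Hol" unfolding G_def by (rule eventual_hom_Hol)
  have mer_hol: "A \<in> carrier (G p) \<and> (\<forall>\<^sub>F d in at_right 0. \<exists>c. hol (lint (knot_field d (B i))) c \<noteq> 0 \<and>
      hol (lint (knot_field d (B j))) c = 0 \<and> hx (Hol d A) = hol (lint (knot_field d (B 1))) c \<and>
      hy (Hol d A) = hol (lint (knot_field d (B 2))) c)"
    if A: "A \<in> meridians S p (B i)" and ij: "i \<in> {1, 2}" "j \<in> {1, 2}" "i \<noteq> j" for A i j
  proof
    obtain c where c: "c \<in> meridian_curves S (B i)" "A \<in> based_classes S p c"
      using A by (auto simp: meridians_def)
    note loop = meridian_curve_loop[OF c(1)]
    show "A \<in> carrier (G p)" unfolding G_def by (rule based_class_Hol(1)[OF c(2) loop])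
    have knots: "smooth_knot (B i)" "smooth_knot (B j)" using ij K J by auto
    have S0: "S \<inter> range (B i) = {}" "S \<inter> range (B j) = {}" using ij unfolding S by blast+
    have "range (B i) \<inter> range (B j) = {}" by (rule disj) (use ij in auto)
    from meridian_hol_other[OF knots(2) c(1) S0(2) this] meridian_hol[OF knots(1) c(1) S0(1)]
      based_class_Hol(2)[OF c(2) loop] hol_comp[OF loop(1,2)]
    show "\<forall>\<^sub>F d in at_right 0. \<exists>c. hol (lint (knot_field d (B i))) c \<noteq> 0 \<and>
      hol (lint (knot_field d (B j))) c = 0 \<and> hx (Hol d A) = hol (lint (knot_field d (B 1))) c \<and>
      hy (Hol d A) = hol (lint (knot_field d (B 2))) c"
      by eventually_elim (rule exI[of _ c], auto)
  qed
  have mer1: "A \<in> carrier (G p)" "\<forall>\<^sub>F d in at_right 0. hx (Hol d A) \<noteq> 0 \<and> hy (Hol d A) = 0"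
    if "A \<in> meridians S p (B 1)" for A
    using mer_hol[OF that, of 2] by (auto elim: eventually_mono)
  have mer2: "A \<in> carrier (G p)" "\<forall>\<^sub>F d in at_right 0. hx (Hol d A) = 0 \<and> hy (Hol d A) \<noteq> 0"
    if "A \<in> meridians S p (B 2)" for A
    using mer_hol[OF that, of 1] by (auto elim: eventually_mono)
  have mer: "A \<in> carrier (G p)" "\<forall>\<^sub>F d in at_right 0. hx (Hol d A) = 0 \<or> hy (Hol d A) = 0"
    if "A \<in> (\<Union>i\<in>{1, 2}. meridians S p (B i))" for A
    using that mer1(1) mer2(1) eventually_mono[OF mer1(2)] eventually_mono[OF mer2(2)] by auto
  define R where "R = {m \<otimes>\<^bsub>G p\<^esub> m' \<otimes>\<^bsub>G p\<^esub> inv\<^bsub>G p\<^esub> m \<otimes>\<^bsub>G p\<^esub> inv\<^bsub>G p\<^esub> m' | m m' g.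
           m \<in> (\<Union>i\<in>{1, 2}. meridians S p (B i)) \<and> g \<in> carrier (G p) \<and>
           m' = g \<otimes>\<^bsub>G p\<^esub> m \<otimes>\<^bsub>G p\<^esub> inv\<^bsub>G p\<^esub> g}"
  have N: "milnor_kernel {1, 2} B p = normal_closure (G p) R"
    by (simp add: milnor_kernel_def Let_def R_def G_def S_def)
  have R: "R \<subseteq> carrier (G p)"
  proof
    fix a assume "a \<in> R"
    then obtain m g where "a = m \<otimes>\<^bsub>G p\<^esub> (g \<otimes>\<^bsub>G p\<^esub> m \<otimes>\<^bsub>G p\<^esub> inv\<^bsub>G p\<^esub> g) \<otimes>\<^bsub>G p\<^esub> inv\<^bsub>G p\<^esub> m \<otimes>\<^bsub>G p\<^esub>
        inv\<^bsub>G p\<^esub> (g \<otimes>\<^bsub>G p\<^esub> m \<otimes>\<^bsub>G p\<^esub> inv\<^bsub>G p\<^esub> g)" "g \<in> carrier (G p)" "m \<in> carrier (G p)"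
      using mer(1) unfolding R_def by blast
    then show "a \<in> carrier (G p)" by simp
  qed
  have R0: "\<forall>\<^sub>F d in at_right 0. Hol d a = 0" if a: "a \<in> R" for a
  proof -
    obtain m m' g where a_eq: "a = m \<otimes>\<^bsub>G p\<^esub> m' \<otimes>\<^bsub>G p\<^esub> inv\<^bsub>G p\<^esub> m \<otimes>\<^bsub>G p\<^esub> inv\<^bsub>G p\<^esub> m'"
      and m: "m \<in> (\<Union>i\<in>{1, 2}. meridians S p (B i))" and g: "g \<in> carrier (G p)"
      and m': "m' = g \<otimes>\<^bsub>G p\<^esub> m \<otimes>\<^bsub>G p\<^esub> inv\<^bsub>G p\<^esub> g"
      using a unfolding R_def by blast
    have mG: "m \<in> carrier (G p)" by (rule mer(1)[OF m])
    have "m' \<in> carrier (G p)" using mG g by (simp add: m')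
    moreover have "\<forall>\<^sub>F d in at_right 0. Hol d m + Hol d m' = Hol d m' + Hol d m"
      using eventual_hom_conj[OF G hom g mG] mer(2)[OF m]
    proof eventually_elim
      case (elim d)
      show ?case by (rule heis_commute) (use elim in \<open>auto simp: m'\<close>)
    qed
    ultimately show ?thesis unfolding a_eq by (rule eventual_hom_commutator[OF G hom mG])
  qed
  have m12: "m 1 \<in> meridians S p (B 1)" "m 2 \<in> meridians S p (B 2)" using m by blast+
  have w_carrier: "m i \<in> carrier (G p)" if "i \<in> fst ` set w" for i
    using w m mer(1) that by blast
  have "path_image (B 3) \<subseteq> S"
    using disj[of 3 1] disj[of 3 2] unfolding S knot_path(2)[OF L] by force
  note L_loop = knot_path(1)[OF L] this knot_path(3)[OF L]
  have "\<forall>\<^sub>F d in at_right 0. Hol d (eval_word (G p) m w) = Hol d l"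
    by (rule eventual_hom_r_coset[OF G hom normal_closure_carrier[OF G hom R] one_in_normal_closure[OF G hom]
          eventual_hom_normal_closure[OF G hom R R0] eval_word_carrier[OF G hom w_carrier]
          based_class_Hol(1)[OF l L_loop, folded G_def] eq[unfolded N]])
  moreover have "\<forall>\<^sub>F d in at_right 0. hol (lint (knot_field d (B 1))) (B 3) = 0"
    by (rule linking_number_0_hol[OF K L _ lk]) (use disj[of 3 1] in auto)
  moreover have "\<forall>\<^sub>F d in at_right 0. hol (lint (knot_field d (B 2))) (B 3) = 0"
    by (rule linking_number_0_hol[OF J L _ lk]) (use disj[of 3 2] in auto)
  moreover have "\<forall>\<^sub>F d in at_right 0. Hol d (eval_word (G p) m w) =
      foldr (\<lambda>(i, b) a. (if b then Hol d (m i) else - Hol d (m i)) + a) w 0"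
    by (rule eventual_hom_eval_word[OF G hom w_carrier])
  ultimately have "\<forall>\<^sub>F d in at_right 0. hx (hol (T d) (B 3)) = 0 \<and> hy (hol (T d) (B 3)) = 0 \<and> hz (hol (T d) (B 3)) \<noteq> 0"
    using hol_comp[OF L_loop(1,2)] based_class_Hol(2)[OF l L_loop] mer1(2)[OF m12(1)]
      mer2(2)[OF m12(2)]
  proof eventually_elim
    case (elim d)
    then have xy: "hx (hol (T d) (B 3)) = 0" "hy (hol (T d) (B 3)) = 0" by auto
    with elim(6) have l_eq: "Hol d l = hol (T d) (B 3)" using heis_conj_central by auto
    have M: "hy (Hol d (m 1)) = 0" "hx (Hol d (m 2)) = 0" using elim by auto
    note word = heis_word[OF M w]
    have h: "Hol d l = foldr (\<lambda>(i, b) a. (if b then Hol d (m i) else - Hol d (m i)) + a) w 0"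
      using elim(1,4) by simp
    \<comment> \<open>The linear coefficients measure linking with \<open>B 3\<close>. Once they
      vanish, only the \<open>[1, 2]\<close> term of \<open>heis_word\<close> survives in the
      corner.\<close>
    have "magnus w [1] = 0" using word(1) h xy(1) l_eq elim(7) by simp
    moreover have "magnus w [2] = 0" using word(2) h xy(2) l_eq elim(8) by simp
    ultimately have "hz (hol (T d) (B 3)) = hx (Hol d (m 1)) * hy (Hol d (m 2)) * \<mu>"
      using word(3) h l_eq \<mu>_eq by simp
    then show ?case using xy elim(7,8) \<mu>(2) by simp
  qed
  then show ?thesis by (rule that[OF T[unfolded S_def]])
qed

section \<open>Words of transition elements\<close>

lemma path_cover_partition:
  fixes l :: "real \<Rightarrow> 'a::metric_space"
  assumes l: "path l" "path_image l \<subseteq> (\<Union>v\<in>W. ball v \<rho>)"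
  obtains N :: nat and v where "N > 0" "\<And>i. i < N \<Longrightarrow> v i \<in> W"
    "\<And>i t. i < N \<Longrightarrow> t \<in> {real i / N..real (Suc i) / N} \<Longrightarrow> l t \<in> ball (v i) \<rho>"
proof -
  define good where "good A \<longleftrightarrow> open A \<and> (\<exists>v\<in>W. l ` (A \<inter> {0..1}) \<subseteq> ball v \<rho>)" for A
  have cont: "continuous_on {0..1} l" using l(1) by (simp add: path_def)
  have "{0..1} \<subseteq> \<Union>{A. good A}"
  proof
    fix t :: real assume t: "t \<in> {0..1}"
    then have "l t \<in> path_image l" by (simp add: path_image_def)
    then obtain v where v: "v \<in> W" "l t \<in> ball v \<rho>" using l(2) by blast
    obtain A where A: "open A" "{0..1} \<inter> l -` ball v \<rho> = {0..1} \<inter> A"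
      using continuous_openin_preimage_gen[OF cont open_ball[of v \<rho>]] unfolding openin_open by blast
    then have "good A" unfolding good_def using v(1) by blast
    moreover have "t \<in> A" using A t v(2) by blast
    ultimately show "t \<in> \<Union>{A. good A}" by blast
  qed
  then obtain e where e: "e > 0" "\<And>t. t \<in> {0..1} \<Longrightarrow> \<exists>A\<in>{A. good A}. ball t e \<subseteq> A"
    using Heine_Borel_lemma[OF compact_Icc, of 0 1 "{A. good A}"] unfolding good_def by blast
  obtain N :: nat where N: "N > 0" "1 / N < e"
    using reals_Archimedean[OF e(1)] by (metis inverse_eq_divide of_nat_0_less_iff zero_less_Suc)
  have "\<exists>v\<in>W. \<forall>t\<in>{real i / N..real (Suc i) / N}. l t \<in> ball v \<rho>" if i: "i < N" for i
  proof -
    have "real i / N \<in> {0..1}" using i by simp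
    then obtain A where A: "good A" "ball (real i / N) e \<subseteq> A" using e(2) by blast
    then obtain v where v: "v \<in> W" "l ` (A \<inter> {0..1}) \<subseteq> ball v \<rho>" unfolding good_def by blast
    have "l t \<in> ball v \<rho>" if t: "t \<in> {real i / N..real (Suc i) / N}" for t
    proof -
      have "real (Suc i) / N \<le> 1" "0 \<le> real i / N" using i by auto
      then have "t \<in> {0..1}" using t unfolding atLeastAtMost_iff by linarith
      moreover have "real (Suc i) / N = real i / N + 1 / N" by (simp add: add_divide_distrib)
      then have "t \<in> ball (real i / N) e" using t N(2) by (auto simp: dist_real_def)
      ultimately show ?thesis using A(2) v(2) by blast
    qed
    then show ?thesis using v(1) by blast
  qed
  then obtain v where "\<And>i. i < N \<Longrightarrow> v i \<in> W \<and> (\<forall>t\<in>{real i / N..real (Suc i) / N}. l t \<in> ball (v i) \<rho>)"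
    by metis
  then show ?thesis using that[OF N(1)] by blast
qed

text \<open>The order of quantifiers is essential: the word depends on the loop and the cover alone
  and serves every transport and every map \<open>F\<close>. On each piece of the loop,
  \<open>q\<close> is a constant followed by a local development, and these constants change by
  transition elements.\<close>

lemma hol_transition_word:
  fixes l :: "real \<Rightarrow> 'b::real_normed_vector"
  assumes l: "path l" "path_image l \<subseteq> (\<Union>v\<in>W. ball v \<rho>)" "pathstart l = pathfinish l"
  shows "\<exists>es. set es \<subseteq> W \<times> W \<and>
    (\<forall>(T :: 'a::metric_space \<Rightarrow> 'a \<Rightarrow> 'h::group_add) F q Q E.
      develops T (F \<circ> l) {0..1} q \<longrightarrow> (\<forall>v\<in>W. develops T F (cball v \<rho>) (Q v)) \<longrightarrow>
      (\<forall>v\<in>W. \<forall>v'\<in>W. \<forall>x\<in>cball v \<rho> \<inter> cball v' \<rho>. E (v, v') = Q v x - Q v' x) \<longrightarrow>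
      (\<exists>y. hol T (F \<circ> l) = - y + sum_list (map E es) + y))"
proof -
  obtain N :: nat and v where N: "N > 0" and vW: "\<And>i. i < N \<Longrightarrow> v i \<in> W"
    and v: "\<And>i t. i < N \<Longrightarrow> t \<in> {real i / N..real (Suc i) / N} \<Longrightarrow> l t \<in> ball (v i) \<rho>"
    by (rule path_cover_partition[OF l(1,2)]) (rule that; assumption)
  define pre where "pre i = map (\<lambda>i. (v i, v (Suc i))) [0..<i]" for i
  \<comment> \<open>The last letter returns from the final ball to the first one and closes the
    loop.\<close>
  define es where "es = pre (N - 1) @ [(v (N - 1), v 0)]"
  have "set es \<subseteq> W \<times> W" using vW N by (auto simp: es_def pre_def)
  moreover have "\<exists>y. hol T (F \<circ> l) = - y + sum_list (map E es) + y"
    if q: "develops T (F \<circ> l) {0..1} q" and Q: "\<forall>v\<in>W. develops T F (cball v \<rho>) (Q v)"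
      and E: "\<forall>v\<in>W. \<forall>v'\<in>W. \<forall>x\<in>cball v \<rho> \<inter> cball v' \<rho>. E (v, v') = Q v x - Q v' x"
    for T :: "'a \<Rightarrow> 'a \<Rightarrow> 'h" and F q Q E
  proof -
    have part: "real (Suc i) / N \<le> 1" "0 \<le> real i / N" "real i / N \<le> real (Suc i) / N" if "i < N" for i
      using that by (auto simp: divide_right_mono)
    have const: "q s - Q (v i) (l s) = q t - Q (v i) (l t)"
      if i: "i < N" and st: "s \<in> {real i / N..real (Suc i) / N}" "t \<in> {real i / N..real (Suc i) / N}" for i s t
    proof -
      let ?I = "{real i / N..real (Suc i) / N}"
      have sub: "?I \<subseteq> {0..1}" using part[OF i] by auto
      have img: "l ` ?I \<subseteq> cball (v i) \<rho>" using v[OF i] less_imp_le by fastforce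
      have cont: "continuous_on ?I l"
        using l(1) continuous_on_subset[OF _ sub] by (simp add: path_def)
      have "develops T (\<lambda>t. F (l t)) ?I (\<lambda>t. Q (v i) (l t))"
        by (rule develops_compose[OF Q[rule_format, OF vW[OF i]] cont img])
      moreover have "develops T (\<lambda>t. F (l t)) ?I q"
        using develops_subset[OF q sub] by (simp add: o_def)
      ultimately show ?thesis
        by (intro develops_unique[of T "\<lambda>t. F (l t)" ?I q "\<lambda>t. Q (v i) (l t)"] st) auto
    qed
    \<comment> \<open>On piece \<open>i\<close>, \<open>q\<close> is \<open>X i\<close> followed by
      the local development, and passing to the next piece appends one transition element on the
      right.\<close>
    define X where "X i = q (real i / N) - Q (v i) (l (real i / N))" for i
    have E_at: "E (v i, v j) = Q (v i) (l t) - Q (v j) (l t)"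
      if "i < N" "j < N" "l t \<in> ball (v i) \<rho>" "l t \<in> ball (v j) \<rho>" for i j t
    proof -
      have "l t \<in> cball (v i) \<rho> \<inter> cball (v j) \<rho>" using that by (auto simp: less_imp_le)
      then show ?thesis using E vW that by blast
    qed
    have X: "X i = X 0 + sum_list (map E (pre i))" if "i < N" for i
      using that
    proof (induction i)
      case (Suc i)
      let ?t = "real (Suc i) / N"
      have "q ?t - Q (v i) (l ?t) = X i"
        unfolding X_def using Suc.prems part[of i] by (intro const[of i]) auto
      moreover have "E (v i, v (Suc i)) = Q (v i) (l ?t) - Q (v (Suc i)) (l ?t)"
        using Suc.prems part[of i] part[of "Suc i"] by (intro E_at v) auto
      ultimately have "X i + E (v i, v (Suc i)) = X (Suc i)"
        unfolding X_def by (metis add_diff_eq diff_add_cancel)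
      then show ?case using Suc by (simp add: pre_def flip: add.assoc)
    qed (simp add: pre_def)
    let ?n = "N - 1" and ?y = "Q (v 0) (l 0)"
    have n: "?n < N" "real (Suc ?n) / N = 1" using N by auto
    have l01: "l 1 = l 0" using l(3) by (simp add: pathstart_def pathfinish_def)
    have "q 1 - Q (v ?n) (l 1) = X ?n"
      unfolding X_def using n part[OF n(1)] by (intro const[of ?n]) auto
    then have q1: "q 1 = X ?n + Q (v ?n) (l 0)" unfolding l01 by (metis diff_add_cancel)
    have "l 0 \<in> ball (v ?n) \<rho>" using v[OF n(1), of 1] n part[OF n(1)] l01 by auto
    moreover have "l 0 \<in> ball (v 0) \<rho>" using v[of 0 0] N by auto
    ultimately have "E (v ?n, v 0) = Q (v ?n) (l 0) - ?y" using n N by (intro E_at) auto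
    then have "Q (v ?n) (l 0) = E (v ?n, v 0) + ?y" by simp
    then have q1': "q 1 = X 0 + sum_list (map E es) + ?y"
      using q1 X[OF n(1)] by (simp add: es_def add.assoc)
    have q0: "q 0 = X 0 + ?y" by (simp add: X_def)
    have "hol T (F \<circ> l) = - q 0 + q 1" by (rule hol_eq[OF q])
    also have "\<dots> = - ?y + sum_list (map E es) + ?y"
      unfolding q0 q1' by (simp add: minus_add add.assoc diff_conv_add_uminus del: add_uminus_conv_diff)
    finally show ?thesis by blast
  qed
  ultimately show ?thesis by blast
qed


section \<open>Packed copies\<close>

text \<open>Needed so that the image of a component is the whole target component; with injectivity
  of the ambient map, points off the one then go to points off the other.\<close>

lemma surj_degree_one:
  fixes \<phi> :: "real \<Rightarrow> real"
  assumes \<phi>: "continuous_on UNIV \<phi>" "\<And>t. \<phi> (t + 1) = \<phi> t + 1"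
  shows "surj \<phi>"
proof -
  have "\<exists>t. \<phi> t = y" for y
  proof -
    define n where "n = \<lfloor>y - \<phi> 0\<rfloor>"
    have shift: "\<phi> (of_int k) = \<phi> 0 + of_int k" for k
      using periodic_add_int[of "\<lambda>t. \<phi> t - t" 0 k] \<phi>(2) by simp
    have "\<phi> (of_int n) \<le> y" "y \<le> \<phi> (of_int (n + 1))"
      unfolding shift n_def by linarith+
    then show ?thesis
      using IVT'[of \<phi> "of_int n" y "of_int (n + 1)"] continuous_on_subset[OF \<phi>(1)] by auto
  qed
  then show ?thesis by (metis surjI)
qed

text \<open>Only the end map of the isotopy is retained, and of its smoothness only continuity and
  injectivity.\<close>

lemma isotopic_links_homeo:
  assumes "isotopic_links I L L'"
  obtains \<psi> where "continuous_on UNIV \<psi>" "inj \<psi>"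
    "\<And>i. i \<in> I \<Longrightarrow> \<exists>\<phi>. continuous_on UNIV \<phi> \<and> (\<forall>t. \<phi> (t + 1) = \<phi> t + 1) \<and> (\<forall>t. \<psi> (L i t) = L' i (\<phi> t))"
proof -
  obtain H :: "real \<times> (real^3) \<Rightarrow> real^3" where "\<forall>t. diffeomorphism (\<lambda>x. H (t, x))"
    and "\<forall>i\<in>I. same_oriented_curve (\<lambda>s. H (1, L i s)) (L' i)"
    using assms unfolding isotopic_links_def by blast
  then have H: "diffeomorphism (\<lambda>x. H (1, x))"
    and curves: "\<And>i. i \<in> I \<Longrightarrow> same_oriented_curve (\<lambda>s. H (1, L i s)) (L' i)"
    by blast+
  show ?thesis
  proof (rule that[of "\<lambda>x. H (1, x)"])
    show "continuous_on UNIV (\<lambda>x. H (1, x))"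
      using H unfolding diffeomorphism_def by (blast intro: smooth_imp_continuous)
    show "inj (\<lambda>x. H (1, x))" using H unfolding diffeomorphism_def by (metis injI)
    show "\<exists>\<phi>. continuous_on UNIV \<phi> \<and> (\<forall>t. \<phi> (t + 1) = \<phi> t + 1) \<and> (\<forall>t. H (1, L i t) = L' i (\<phi> t))"
      if "i \<in> I" for i
      using curves[OF that] unfolding same_oriented_curve_def by (blast intro: smooth_imp_continuous)
  qed
qed

lemma isotopic_links_complement:
  fixes \<phi> :: "real \<Rightarrow> real"
  assumes "inj \<psi>" "continuous_on UNIV \<phi>" "\<And>t. \<phi> (t + 1) = \<phi> t + 1" "\<And>t. \<psi> (K t) = K' (\<phi> t)"
    and "x \<notin> range K"
  shows "\<psi> x \<notin> range K'"
proof
  assume "\<psi> x \<in> range K'"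
  then obtain s where s: "\<psi> x = K' s" by blast
  obtain t where "s = \<phi> t" using surj_degree_one[OF assms(2,3)] by (metis surjD)
  then have "\<psi> x = \<psi> (K t)" using s assms(4) by simp
  then show False using assms(1,5) by (auto dest: injD)
qed

text \<open>What the holonomy argument needs of a map from copy \<open>j\<close> to
  \<open>B\<close>. The last clause says that the third component of every other copy becomes
  contractible in the complement of \<open>B 1\<close> and \<open>B 2\<close>: in the application
  \<open>C\<close> is its ball in split position, and \<open>F\<close> carries split position to
  \<open>B\<close>.\<close>

definition carries_copy ::
    "nat \<Rightarrow> (nat \<Rightarrow> real \<Rightarrow> real^3) \<Rightarrow> (nat \<times> nat \<Rightarrow> real \<Rightarrow> real^3) \<Rightarrow> nat \<Rightarrow> (real^3 \<Rightarrow> real^3) \<Rightarrow> (real \<Rightarrow> real) \<Rightarrow> bool" where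
  "carries_copy n B L j \<psi> \<phi> \<longleftrightarrow> continuous_on UNIV \<psi> \<and>
    (\<forall>x. x \<notin> range (L (j, 1)) \<longrightarrow> x \<notin> range (L (j, 2)) \<longrightarrow> \<psi> x \<in> link_complement {1, 2} B) \<and>
    continuous_on UNIV \<phi> \<and> \<phi> 1 = \<phi> 0 + 1 \<and> (\<forall>t. \<psi> (L (j, 3) t) = B 3 (\<phi> t)) \<and>
    (\<forall>k\<in>{1..n}. k \<noteq> j \<longrightarrow> (\<exists>F C g. compact C \<and> convex C \<and> continuous_on C F \<and>
        F ` C \<subseteq> link_complement {1, 2} B \<and> path g \<and> path_image g \<subseteq> C \<and> pathstart g = pathfinish g \<and>
        \<psi> \<circ> L (k, 3) = (F :: real^3 \<Rightarrow> real^3) \<circ> g))"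

text \<open>The map first brings the whole link into split position and then takes copy
  \<open>j\<close> to \<open>B\<close>. In between, any other copy lies in a ball disjoint from the
  ball of copy \<open>j\<close>.\<close>

lemma split_type_carries_copy:
  fixes B :: "nat \<Rightarrow> real \<Rightarrow> real^3"
  assumes split: "has_split_type n B L" and j: "j \<in> {1..n}"
  shows "\<exists>\<psi> \<phi>. carries_copy n B L j \<psi> \<phi>"
proof -
  obtain L' c r where L': "smooth_link ({1..n} \<times> {1, 2, 3}) L'"
    and iso: "isotopic_links ({1..n} \<times> {1, 2, 3}) L L'"
    and balls: "disjoint_family_on (\<lambda>j. cball (c j) (r j)) {1..n}"
    and inside: "\<forall>j\<in>{1..n}. \<forall>i\<in>{1, 2, 3}. range (L' (j, i)) \<subseteq> ball (c j) (r j)"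
    and isoB: "\<forall>j\<in>{1..n}. isotopic_links {1, 2, 3} (\<lambda>i. L' (j, i)) B"
    using split unfolding has_split_type_def by blast
  obtain \<Psi> where \<Psi>: "continuous_on UNIV \<Psi>" "inj \<Psi>"
    "\<And>i. i \<in> {1..n} \<times> {1, 2, 3} \<Longrightarrow> \<exists>\<phi>. continuous_on UNIV \<phi> \<and> (\<forall>t. \<phi> (t + 1) = \<phi> t + 1) \<and> (\<forall>t. \<Psi> (L i t) = L' i (\<phi> t))"
    using isotopic_links_homeo[OF iso] by blast
  obtain \<omega> where \<omega>: "continuous_on UNIV \<omega>" "inj \<omega>"
    "\<And>i. i \<in> {1, 2, 3} \<Longrightarrow> \<exists>\<phi>. continuous_on UNIV \<phi> \<and> (\<forall>t. \<phi> (t + 1) = \<phi> t + 1) \<and> (\<forall>t. \<omega> (L' (j, i) t) = B i (\<phi> t))"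
    using isotopic_links_homeo[OF isoB[rule_format, OF j]] by blast
  have \<omega>_compl: "\<omega> x \<notin> range (B i)" if "i \<in> {1, 2, 3}" "x \<notin> range (L' (j, i))" for x i
    using \<omega>(3)[OF that(1)] isotopic_links_complement[OF \<omega>(2) _ _ _ that(2), of _ "B i"] by blast
  have \<Psi>_compl: "\<Psi> x \<notin> range (L' (j, i))" if "i \<in> {1, 2, 3}" "x \<notin> range (L (j, i))" for x i
    using \<Psi>(3)[of "(j, i)"] that(1) j isotopic_links_complement[OF \<Psi>(2) _ _ _ that(2), of _ "L' (j, i)"] by blast
  obtain \<phi>1 where \<phi>1: "continuous_on UNIV \<phi>1" "\<And>t. \<phi>1 (t + 1) = \<phi>1 t + 1" "\<And>t. \<omega> (L' (j, 3) t) = B 3 (\<phi>1 t)"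
    using \<omega>(3)[of 3] by blast
  obtain \<phi>2 where \<phi>2: "continuous_on UNIV \<phi>2" "\<And>t. \<phi>2 (t + 1) = \<phi>2 t + 1" "\<And>t. \<Psi> (L (j, 3) t) = L' (j, 3) (\<phi>2 t)"
    using \<Psi>(3)[of "(j, 3)"] j by blast
  show ?thesis
    unfolding carries_copy_def
  proof (rule exI[of _ "\<omega> \<circ> \<Psi>"], rule exI[of _ "\<phi>1 \<circ> \<phi>2"], intro conjI allI impI ballI)
    show "continuous_on UNIV (\<omega> \<circ> \<Psi>)"
      by (rule continuous_on_compose[OF \<Psi>(1) continuous_on_subset[OF \<omega>(1)]]) simp
    show "continuous_on UNIV (\<phi>1 \<circ> \<phi>2)"
      by (rule continuous_on_compose[OF \<phi>2(1) continuous_on_subset[OF \<phi>1(1)]]) simp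
    show "(\<phi>1 \<circ> \<phi>2) 1 = (\<phi>1 \<circ> \<phi>2) 0 + 1" using \<phi>1(2)[of "\<phi>2 0"] \<phi>2(2)[of 0] by simp
    show "(\<omega> \<circ> \<Psi>) (L (j, 3) t) = B 3 ((\<phi>1 \<circ> \<phi>2) t)" for t by (simp add: \<phi>1(3) \<phi>2(3))
    show "(\<omega> \<circ> \<Psi>) x \<in> link_complement {1, 2} B" if "x \<notin> range (L (j, 1))" "x \<notin> range (L (j, 2))" for x
      using \<omega>_compl[OF _ \<Psi>_compl[OF _ that(1)]] \<omega>_compl[OF _ \<Psi>_compl[OF _ that(2)]]
      by (auto simp: link_complement_def)
    fix k assume k: "k \<in> {1..n}" "k \<noteq> j"
    obtain \<phi> where \<phi>: "continuous_on UNIV \<phi>" "\<And>t. \<phi> (t + 1) = \<phi> t + 1" "\<And>t. \<Psi> (L (k, 3) t) = L' (k, 3) (\<phi> t)"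
      using \<Psi>(3)[of "(k, 3)"] k by blast
    have knot: "smooth_knot (L' (k, 3))" using L' k by (auto simp: smooth_link_def)
    let ?C = "cball (c k) (r k)" and ?g = "\<lambda>t. L' (k, 3) (\<phi> t)"
    have "\<omega> x \<in> link_complement {1, 2} B" if "x \<in> ?C" for x
    proof -
      have "cball (c k) (r k) \<inter> cball (c j) (r j) = {}"
        using balls k j unfolding disjoint_family_on_def by blast
      moreover have "range (L' (j, i)) \<subseteq> cball (c j) (r j)" if "i \<in> {1, 2}" for i
        using inside j that ball_subset_cball[of "c j" "r j"] by blast
      ultimately have "x \<notin> range (L' (j, i))" if "i \<in> {1, 2}" for i
        using that \<open>x \<in> ?C\<close> by blast
      then show ?thesis using \<omega>_compl[of _ x] unfolding link_complement_def by blast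
    qed
    moreover have "path ?g"
      unfolding path_def
      by (rule continuous_on_compose2[OF knot_continuous[OF knot] continuous_on_subset[OF \<phi>(1)]]) auto
    moreover have "path_image ?g \<subseteq> ?C"
      using inside k ball_subset_cball[of "c k" "r k"] unfolding path_image_def by blast
    moreover have "pathstart ?g = pathfinish ?g"
      using \<phi>(2)[of 0] knot_periodic[OF knot, of "\<phi> 0"] by (simp add: pathstart_def pathfinish_def)
    moreover have "(\<omega> \<circ> \<Psi>) \<circ> L (k, 3) = \<omega> \<circ> ?g" by (simp add: fun_eq_iff \<phi>(3))
    ultimately show "\<exists>F C g. compact C \<and> convex C \<and> continuous_on C F \<and>
        F ` C \<subseteq> link_complement {1, 2} B \<and> path g \<and> path_image g \<subseteq> C \<and> pathstart g = pathfinish g \<and>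
        (\<omega> \<circ> \<Psi>) \<circ> L (k, 3) = (F :: real^3 \<Rightarrow> real^3) \<circ> g"
      using continuous_on_subset[OF \<omega>(1)] by (intro exI[of _ \<omega>] exI[of _ ?C] exI[of _ ?g]) auto
  qed
qed

text \<open>Among copies whose third components run through the same balls, the matrix of the holonomies of
  the \<open>k\<close>-th loop in the \<open>j\<close>-th transport is diagonal, and its rank is bounded by the number of words
  of length at most two in the transition elements.\<close>

lemma card_copies_same_balls:
  fixes B :: "nat \<Rightarrow> real \<Rightarrow> real^3"
  assumes T: "flat_family (link_complement {1, 2} B) (at_right 0) U (T :: real \<Rightarrow> real^3 \<Rightarrow> real^3 \<Rightarrow> heis)"
    and hol: "\<forall>\<^sub>F d in at_right 0. hx (hol (T d) (B 3)) = 0 \<and> hy (hol (T d) (B 3)) = 0 \<and> hz (hol (T d) (B 3)) \<noteq> 0"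
    and B: "smooth_link {1, 2, 3} B"
    and L: "smooth_link ({1..n} \<times> {1, 2, 3}) L" and split: "has_split_type n B L"
    and J: "J \<subseteq> {1..n}" and W: "finite W"
    and cover: "\<And>j. j \<in> J \<Longrightarrow> range (L (j, 3)) \<subseteq> (\<Union>v\<in>W. ball v \<rho>)"
    and avoid: "\<And>j v. j \<in> J \<Longrightarrow> v \<in> W \<Longrightarrow> cball v \<rho> \<inter> (range (L (j, 1)) \<union> range (L (j, 2))) = {}"
  shows "card J \<le> (card W)\<^sup>2 + (card W) ^ 4"
proof -
  interpret flat_family "link_complement {1, 2} B" "at_right 0" U T by (rule T)
  let ?S = "link_complement {1, 2} B"
  have J_fin: "finite J" using J finite_subset by blast
  have "\<forall>j\<in>J. \<exists>\<psi> \<phi>. carries_copy n B L j \<psi> \<phi>"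
    using split_type_carries_copy[OF split] J by blast
  then obtain \<psi> \<phi> where carries: "\<And>j. j \<in> J \<Longrightarrow> carries_copy n B L j (\<psi> j) (\<phi> j)"
    by metis
  note c = carries[unfolded carries_copy_def]
  have \<psi>_cont: "continuous_on UNIV (\<psi> j)" and \<phi>: "continuous_on UNIV (\<phi> j)" "\<phi> j 1 = \<phi> j 0 + 1"
    and \<psi>_B: "\<psi> j (L (j, 3) t) = B 3 (\<phi> j t)" if "j \<in> J" for j t
    using c[OF that] by simp_all
  have \<psi>_compl: "\<psi> j x \<in> ?S" if "j \<in> J" "x \<notin> range (L (j, 1))" "x \<notin> range (L (j, 2))" for j x
    using c[OF that(1)] that(2,3) by blast
  have other: "\<exists>F C g. compact C \<and> convex C \<and> continuous_on C F \<and>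
      F ` C \<subseteq> ?S \<and> path g \<and> path_image g \<subseteq> C \<and> pathstart g = pathfinish g \<and>
      \<psi> j \<circ> L (k, 3) = (F :: real^3 \<Rightarrow> real^3) \<circ> g" if "j \<in> J" "k \<in> {1..n}" "k \<noteq> j" for j k
    using c[OF that(1)] that(2,3) by blast
  have B3: "smooth_knot (B 3)" using B by (simp add: smooth_link_def)
  have "range (B 3) \<subseteq> ?S"
    using B by (fastforce simp: smooth_link_def disjoint_family_on_def link_complement_def)
  then have B3_U: "\<forall>\<^sub>F d in at_right 0. range (B 3) \<subseteq> U d"
    by (rule exhaust[OF compact_knot[OF B3]])
  have loop: "path (L (k, 3))" "path_image (L (k, 3)) \<subseteq> (\<Union>v\<in>W. ball v \<rho>)"
    "pathstart (L (k, 3)) = pathfinish (L (k, 3))" if "k \<in> J" for k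
  proof -
    have "smooth_knot (L (k, 3))" using L J that by (auto simp: smooth_link_def)
    note knot_path[OF this]
    then show "path (L (k, 3))" "path_image (L (k, 3)) \<subseteq> (\<Union>v\<in>W. ball v \<rho>)"
      "pathstart (L (k, 3)) = pathfinish (L (k, 3))" using cover[OF that] by simp_all
  qed
  have balls: "\<forall>\<^sub>F d in at_right 0. \<psi> j ` cball v \<rho> \<subseteq> U d" if "j \<in> J" "v \<in> W" for j v
  proof (rule exhaust)
    show "compact (\<psi> j ` cball v \<rho>)"
      by (intro compact_continuous_image continuous_on_subset[OF \<psi>_cont[OF that(1)]]) auto
    show "\<psi> j ` cball v \<rho> \<subseteq> ?S" using avoid[OF that] \<psi>_compl[OF that(1)] by blast
  qed
  have off_diag: "\<forall>\<^sub>F d in at_right 0. hol (T d) (\<psi> j \<circ> L (k, 3)) = 0" if jk: "j \<in> J" "k \<in> J" "j \<noteq> k" for j k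
  proof -
    obtain F :: "real^3 \<Rightarrow> real^3" and C g where F: "compact C" "convex C" "continuous_on C F" "F ` C \<subseteq> ?S"
      and g: "path g" "path_image g \<subseteq> C" "pathstart g = pathfinish g" and eq: "\<psi> j \<circ> L (k, 3) = F \<circ> g"
      using other[OF jk(1), of k] jk J by blast
    from flat exhaust[OF compact_continuous_image[OF F(3,1)] F(4)] show ?thesis
      by eventually_elim (use F g in \<open>simp add: eq hol_convex_loop\<close>)
  qed
  have diag: "\<forall>\<^sub>F d in at_right 0. hol (T d) (\<psi> j \<circ> L (j, 3)) = hol (T d) (B 3)" if j: "j \<in> J" for j
    using flat B3_U hol
  proof eventually_elim
    case (elim d)
    obtain x where "hol (T d) (\<lambda>t. B 3 (\<phi> j t)) = - x + hol (T d) (B 3) + x"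
      using hol_reparametrize[OF elim(1) knot_continuous[OF B3] elim(2) knot_periodic[OF B3] \<phi>(1)[OF j] \<phi>(2)[OF j]]
      by blast
    moreover have "\<psi> j \<circ> L (j, 3) = (\<lambda>t. B 3 (\<phi> j t))" using \<psi>_B[OF j] by (simp add: fun_eq_iff)
    ultimately show ?case using heis_conj_central[of "hol (T d) (B 3)" "- x"] elim(3) by simp
  qed
  have "\<forall>\<^sub>F d in at_right 0. \<forall>j\<in>J. \<forall>v\<in>W. \<psi> j ` cball v \<rho> \<subseteq> U d"
    by (intro eventually_ball_finite J_fin W ballI balls)
  moreover have "\<forall>\<^sub>F d in at_right 0. \<forall>j\<in>J. \<forall>k\<in>J - {j}. hol (T d) (\<psi> j \<circ> L (k, 3)) = 0"
    by (intro eventually_ball_finite J_fin finite_Diff ballI off_diag) auto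
  moreover have "\<forall>\<^sub>F d in at_right 0. \<forall>j\<in>J. hol (T d) (\<psi> j \<circ> L (j, 3)) = hol (T d) (B 3)"
    by (intro eventually_ball_finite J_fin ballI diag)
  ultimately have "\<forall>\<^sub>F d in at_right 0. flat_on (U d) (T d) \<and> hx (hol (T d) (B 3)) = 0 \<and> hy (hol (T d) (B 3)) = 0 \<and>
      hz (hol (T d) (B 3)) \<noteq> 0 \<and> (\<forall>j\<in>J. \<forall>v\<in>W. \<psi> j ` cball v \<rho> \<subseteq> U d) \<and>
      (\<forall>j\<in>J. \<forall>k\<in>J - {j}. hol (T d) (\<psi> j \<circ> L (k, 3)) = 0) \<and>
      (\<forall>j\<in>J. hol (T d) (\<psi> j \<circ> L (j, 3)) = hol (T d) (B 3))"
    (is "eventually ?P _")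
    using flat hol by eventually_elim blast
  \<comment> \<open>The conditions are finite in number, so a single \<open>d\<close> meets all of
    them; from here on the transport is fixed.\<close>
  then obtain d where d: "?P d"
    by (rule exE[OF eventually_happens'[OF trivial_limit_at_right_real]])
  have flat_d: "flat_on (U d) (T d)"
    and B3_hol: "hx (hol (T d) (B 3)) = 0" "hy (hol (T d) (B 3)) = 0" "hz (hol (T d) (B 3)) \<noteq> 0"
    using d by simp_all
  have balls_d: "\<psi> j ` cball v \<rho> \<subseteq> U d" if "j \<in> J" "v \<in> W" for j v
    using d that by blast
  have off_d: "hol (T d) (\<psi> j \<circ> L (k, 3)) = 0" if "j \<in> J" "k \<in> J" "j \<noteq> k" for j k
    using d that by blast
  have diag_d: "hol (T d) (\<psi> j \<circ> L (j, 3)) = hol (T d) (B 3)" if "j \<in> J" for j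
    using d that by blast
  have "\<exists>q. develops (T d) (\<psi> j) (cball v \<rho>) q" if "j \<in> J" "v \<in> W" for j v
    by (rule develops_exists[OF flat_d compact_cball convex_cball continuous_on_subset[OF \<psi>_cont[OF that(1)]]])
      (use balls_d[OF that] in auto)
  then obtain Q where Q: "\<And>j v. j \<in> J \<Longrightarrow> v \<in> W \<Longrightarrow> develops (T d) (\<psi> j) (cball v \<rho>) (Q j v)"
    by metis
  \<comment> \<open>Balls meet in a convex, hence connected set, on which the quotient of two
    developments is constant; any point of it may be used. For balls that do not meet the value is
    arbitrary and the demand on it is vacuous.\<close>
  define E where "E j = (\<lambda>(v, v'). let x = (SOME x. x \<in> cball v \<rho> \<inter> cball v' \<rho>) in Q j v x - Q j v' x)" for j
  have E: "E j (v, v') = Q j v x - Q j v' x"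
    if j: "j \<in> J" and v: "v \<in> W" "v' \<in> W" and x: "x \<in> cball v \<rho> \<inter> cball v' \<rho>" for j v v' x
  proof -
    have "(SOME x. x \<in> cball v \<rho> \<inter> cball v' \<rho>) \<in> cball v \<rho> \<inter> cball v' \<rho>" using x by (rule someI)
    moreover have "develops (T d) (\<psi> j) (cball v \<rho> \<inter> cball v' \<rho>) (Q j v)"
      "develops (T d) (\<psi> j) (cball v \<rho> \<inter> cball v' \<rho>) (Q j v')"
      using Q[OF j v(1)] Q[OF j v(2)] develops_subset by blast+
    moreover have "connected (cball v \<rho> \<inter> cball v' \<rho>)"
      by (intro convex_connected convex_Int convex_cball)
    ultimately show ?thesis
      unfolding E_def Let_def split_conv using develops_unique x by blast
  qed
  have "\<forall>k\<in>J. \<exists>es. set es \<subseteq> W \<times> W \<and> (\<forall>j\<in>J. \<exists>y. hol (T d) (\<psi> j \<circ> L (k, 3)) = - y + sum_list (map (E j) es) + y)"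
  proof
    fix k assume k: "k \<in> J"
    \<comment> \<open>The word of the \<open>k\<close>-th loop is fixed before \<open>j\<close>
      enters.\<close>
    obtain es where es: "set es \<subseteq> W \<times> W \<and>
        (\<forall>(T :: real^3 \<Rightarrow> real^3 \<Rightarrow> heis) F q Q E. develops T (F \<circ> L (k, 3)) {0..1} q \<longrightarrow>
          (\<forall>v\<in>W. develops T F (cball v \<rho>) (Q v)) \<longrightarrow>
          (\<forall>v\<in>W. \<forall>v'\<in>W. \<forall>x\<in>cball v \<rho> \<inter> cball v' \<rho>. E (v, v') = Q v x - Q v' x) \<longrightarrow>
          (\<exists>y. hol T (F \<circ> L (k, 3)) = - y + sum_list (map E es) + y))"
      by (rule exE[OF hol_transition_word[OF loop[OF k]]])
    note word = es[THEN conjunct2, rule_format]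
    have "\<exists>y. hol (T d) (\<psi> j \<circ> L (k, 3)) = - y + sum_list (map (E j) es) + y" if j: "j \<in> J" for j
    proof -
      have "path (\<psi> j \<circ> L (k, 3))"
        by (rule path_continuous_image[OF loop(1)[OF k] continuous_on_subset[OF \<psi>_cont[OF j]]]) simp
      moreover have "path_image (\<psi> j \<circ> L (k, 3)) \<subseteq> U d"
        using loop(2)[OF k] balls_d[OF j] ball_subset_cball unfolding path_image_compose by blast
      ultimately obtain q where "develops (T d) (\<psi> j \<circ> L (k, 3)) {0..1} q"
        using path_develops[OF flat_d] by blast
      then show ?thesis
        by (rule word[of "T d" "\<psi> j" q "Q j" "E j"]) (use Q E j in auto)
    qed
    then show "\<exists>es. set es \<subseteq> W \<times> W \<and> (\<forall>j\<in>J. \<exists>y. hol (T d) (\<psi> j \<circ> L (k, 3)) = - y + sum_list (map (E j) es) + y)"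
      using es by blast
  qed
  then obtain es where es: "\<And>k. k \<in> J \<Longrightarrow> set (es k) \<subseteq> W \<times> W"
    "\<And>k j. k \<in> J \<Longrightarrow> j \<in> J \<Longrightarrow> \<exists>y. hol (T d) (\<psi> j \<circ> L (k, 3)) = - y + sum_list (map (E j) (es k)) + y"
    by metis
  \<comment> \<open>The conjugation by \<open>y\<close> is harmless because the holonomies are 0 off
    the diagonal and central on it.\<close>
  have sums: "hz (sum_list (map (E j) (es k))) = 0 \<longleftrightarrow> j \<noteq> k" if jk: "j \<in> J" "k \<in> J" for j k
  proof -
    obtain y where y: "hol (T d) (\<psi> j \<circ> L (k, 3)) = - y + sum_list (map (E j) (es k)) + y"
      using es(2)[OF jk(2,1)] by blast
    then have sum: "sum_list (map (E j) (es k)) = y + hol (T d) (\<psi> j \<circ> L (k, 3)) - y"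
      by (simp add: add.assoc diff_conv_add_uminus del: add_uminus_conv_diff)
    show ?thesis
    proof (cases "j = k")
      case True
      then show ?thesis
        using sum diag_d[OF jk(1)] heis_conj_central[OF B3_hol(1,2)] B3_hol(3) by simp
    next
      case False
      then show ?thesis using sum off_d[OF jk] by simp
    qed
  qed
  let ?D = "W \<times> W"
  have "finite ?D" using W by simp
  from heis_sum_list_bilinear[OF this]
  have "\<forall>k\<in>J. \<exists>n1 n2. \<forall>F :: (real^3) \<times> (real^3) \<Rightarrow> heis. hz (sum_list (map F (es k))) =
      (\<Sum>d\<in>?D. n1 d * hz (F d)) + (\<Sum>d\<in>?D. \<Sum>d'\<in>?D. n2 d d' * (hx (F d) * hy (F d')))"
    using es(1) by blast
  then obtain n1 n2 where n12: "\<And>k (F :: (real^3) \<times> (real^3) \<Rightarrow> heis). k \<in> J \<Longrightarrow> hz (sum_list (map F (es k))) =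
      (\<Sum>d\<in>?D. n1 k d * hz (F d)) + (\<Sum>d\<in>?D. \<Sum>d'\<in>?D. n2 k d d' * (hx (F d) * hy (F d')))"
    unfolding bchoice_iff by blast
  \<comment> \<open>\<open>f j\<close> records the transition elements of the \<open>j\<close>-th
    transport, \<open>g k\<close> the letter and pair counts of the \<open>k\<close>-th
    word.\<close>
  define f where "f j = case_sum (\<lambda>d. hz (E j d)) (\<lambda>(d, d'). hx (E j d) * hy (E j d'))" for j
  define g where "g k = case_sum (n1 k) (\<lambda>(d, d'). n2 k d d')" for k
  have "card J \<le> card (?D <+> (?D \<times> ?D))"
  proof (rule card_le_of_pairing[OF _ J_fin])
    fix j k assume jk: "j \<in> J" "k \<in> J"
    have "(\<Sum>x\<in>?D <+> (?D \<times> ?D). f j x * g k x) = hz (sum_list (map (E j) (es k)))"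
      using W by (simp add: sum.Plus n12[OF jk(2)] f_def g_def sum.cartesian_product mult_ac case_prod_unfold)
    then show "(\<Sum>x\<in>?D <+> (?D \<times> ?D). f j x * g k x) = 0 \<longleftrightarrow> j \<noteq> k" using sums[OF jk] by simp
  qed (use W in auto)
  also have "\<dots> = (card W)\<^sup>2 + (card W) ^ 4"
    using W by (simp add: card_Plus card_cartesian_product power2_eq_square power4_eq_xxxx mult.assoc)
  finally show ?thesis .
qed

section \<open>Counting\<close>

lemma cube_cover:
  fixes \<rho> :: real
  assumes "\<rho> > 0"
  obtains V :: "(real^3) set" where "finite V" "cbox 0 One \<subseteq> (\<Union>v\<in>V. ball v \<rho>)"
    "card V \<le> (nat \<lceil>4 / \<rho>\<rceil> + 1) ^ 3"
proof -
  \<comment> \<open>In a grid of mesh \<open>1 / m\<close> each coordinate is off by at most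
    \<open>1 / m\<close>, so a grid point lies within \<open>3 / m\<close>. The 4 in place of 3
    makes the last distance strictly less than \<open>\<rho>\<close>.\<close>
  define m where "m = nat \<lceil>4 / \<rho>\<rceil>"
  have m: "m > 0" "3 / m < \<rho>"
  proof -
    have "4 / \<rho> \<le> m" unfolding m_def by linarith
    moreover have "4 / \<rho> > 0" using assms by simp
    ultimately show "m > 0" by (cases "m = 0") auto
    then show "3 / m < \<rho>" using \<open>4 / \<rho> \<le> m\<close> assms by (simp add: field_simps)
  qed
  define p :: "nat \<times> nat \<times> nat \<Rightarrow> real^3" where "p = (\<lambda>(a, b, c). vector [a / m, b / m, c / m])"
  define V where "V = p ` ({0..m} \<times> {0..m} \<times> {0..m})"
  have "cbox 0 One \<subseteq> (\<Union>v\<in>V. ball v \<rho>)"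
  proof
    fix x :: "real^3" assume x: "x \<in> cbox 0 One"
    have coord: "0 \<le> x $ i" "x $ i \<le> 1" for i
    proof -
      have b: "axis i 1 \<in> (Basis :: (real^3) set)" by simp
      have One: "(One :: real^3) \<bullet> axis i 1 = 1" using inner_sum_left_Basis[OF b, of "\<lambda>_. 1"] by simp
      from bspec[OF x[unfolded mem_box(2)] b, unfolded One] show "0 \<le> x $ i" "x $ i \<le> 1"
        by (simp_all add: inner_axis)
    qed
    have "\<exists>a\<in>{0..m}. \<bar>real a / m - x $ i\<bar> \<le> 1 / m" for i
    proof
      let ?a = "nat \<lfloor>x $ i * m\<rfloor>"
      have "x $ i * m \<le> m" using coord[of i] m(1) by simp
      then show "?a \<in> {0..m}" by (simp add: nat_le_iff floor_le_iff le_less_trans)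
      have "0 \<le> x $ i * m" using coord[of i] by simp
      then have "real ?a = of_int \<lfloor>x $ i * m\<rfloor>" by simp
      then have "\<bar>real ?a - x $ i * m\<bar> \<le> 1" by linarith
      then have "\<bar>real ?a - x $ i * m\<bar> / m \<le> 1 / m" by (simp add: divide_right_mono)
      moreover have "\<bar>real ?a - x $ i * m\<bar> / m = \<bar>real ?a / m - x $ i\<bar>"
      proof -
        have "real ?a / m - x $ i = (real ?a - x $ i * m) / m" using m(1) by (simp add: field_simps)
        then show ?thesis by (simp add: abs_divide)
      qed
      ultimately show "\<bar>real ?a / m - x $ i\<bar> \<le> 1 / m" by simp
    qed
    then obtain a where a: "\<And>i. a i \<in> {0..m}" "\<And>i. \<bar>real (a i) / m - x $ i\<bar> \<le> 1 / m" by metis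
    let ?v = "p (a 1, a 2, a 3)"
    have "norm (?v - x) \<le> (\<Sum>i\<in>UNIV. \<bar>(?v - x) $ i\<bar>)" by (rule norm_le_l1_cart)
    also have "\<dots> \<le> 3 / m" using a(2)[of 1] a(2)[of 2] a(2)[of 3] by (simp add: sum_3 p_def)
    finally have "x \<in> ball ?v \<rho>" using m(2) by (simp add: dist_norm)
    moreover have "?v \<in> V" using a(1) by (auto simp: V_def)
    ultimately show "x \<in> (\<Union>v\<in>V. ball v \<rho>)" by blast
  qed
  moreover have "card V \<le> card ({0..m} \<times> {0..m} \<times> {0..m})" unfolding V_def by (rule card_image_le) simp
  then have "card V \<le> (m + 1) ^ 3" by (simp add: card_cartesian_product power3_eq_cube algebra_simps)
  ultimately show ?thesis using that[of V] unfolding V_def m_def by simp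
qed

lemma packing_bound:
  fixes B :: "nat \<Rightarrow> real \<Rightarrow> real^3"
  assumes B: "smooth_link {1, 2, 3} B"
    and lk: "\<And>i j. i \<in> {1, 2, 3} \<Longrightarrow> j \<in> {1, 2, 3} \<Longrightarrow> i \<noteq> j \<Longrightarrow> has_linking_number (B i) (B j) 0"
    and \<mu>: "has_triple_linking_number B \<mu>" "\<mu> \<noteq> 0"
    and \<epsilon>: "\<epsilon> > 0" and pack: "packs_in_cube B \<epsilon> n"
  defines "N \<equiv> (nat \<lceil>12 / \<epsilon>\<rceil> + 1) ^ 3"
  shows "n \<le> 2 ^ N * (N\<^sup>2 + N ^ 4)"
proof -
  obtain U and T :: "real \<Rightarrow> real^3 \<Rightarrow> real^3 \<Rightarrow> heis" where
    T: "flat_family (link_complement {1, 2} B) (at_right 0) U T"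
    and hol: "\<forall>\<^sub>F d in at_right 0. hx (hol (T d) (B 3)) = 0 \<and> hy (hol (T d) (B 3)) = 0 \<and> hz (hol (T d) (B 3)) \<noteq> 0"
    using heisenberg_detects[OF B lk \<mu>] by blast
  obtain L where L: "smooth_link ({1..n} \<times> {1, 2, 3}) L" and split: "has_split_type n B L"
    and cube: "\<forall>c\<in>{1..n} \<times> {1, 2, 3}. range (L c) \<subseteq> cbox 0 One" and diag: "diagonal_condition n \<epsilon> L"
    using pack unfolding packs_in_cube_def by blast
  \<comment> \<open>Two points of a closed ball of radius \<open>\<epsilon> / 3\<close> are less
    than \<open>\<epsilon>\<close> apart, so a ball met by the third component of a copy misses the
    other two.\<close>
  define \<rho> where "\<rho> = \<epsilon> / 3"
  have \<rho>: "\<rho> > 0" "4 / \<rho> = 12 / \<epsilon>" using \<epsilon> by (simp_all add: \<rho>_def)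
  obtain V :: "(real^3) set" where V: "finite V" "cbox 0 One \<subseteq> (\<Union>v\<in>V. ball v \<rho>)" "card V \<le> N"
    using cube_cover[OF \<rho>(1)] unfolding \<rho>(2) N_def by blast
  define W where "W j = {v \<in> V. ball v \<rho> \<inter> range (L (j, 3)) \<noteq> {}}" for j
  define J where "J X = {j \<in> {1..n}. W j = X}" for X
  have card_J: "card (J X) \<le> N\<^sup>2 + N ^ 4" if X: "X \<in> Pow V" for X
  proof -
    have "card (J X) \<le> (card X)\<^sup>2 + (card X) ^ 4"
    proof (rule card_copies_same_balls[OF T hol B L split])
      show "J X \<subseteq> {1..n}" "finite X" using X V(1) finite_subset by (auto simp: J_def)
      fix j assume j: "j \<in> J X"
      then have j': "j \<in> {1..n}" "W j = X" by (auto simp: J_def)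
      have "range (L (j, 3)) \<subseteq> (\<Union>v\<in>V. ball v \<rho>)" using cube V(2) j' by blast
      then show "range (L (j, 3)) \<subseteq> (\<Union>v\<in>X. ball v \<rho>)" unfolding j'(2)[symmetric] W_def by blast
      fix v assume v: "v \<in> X"
      then obtain y where y: "y \<in> ball v \<rho>" "y \<in> range (L (j, 3))" unfolding j'(2)[symmetric] W_def by blast
      have far: "\<epsilon> \<le> dist x y" if "x \<in> range (L (j, i))" "i \<in> {1, 2}" for x i
      proof -
        have "\<epsilon> \<le> setdist (range (L (j, i))) (range (L (j, 3)))"
          using diag j'(1) that(2) unfolding diagonal_condition_def by auto
        also have "\<dots> \<le> dist x y" by (rule setdist_le_dist[OF that(1) y(2)])
        finally show ?thesis .
      qed
      show "cball v \<rho> \<inter> (range (L (j, 1)) \<union> range (L (j, 2))) = {}"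
      proof (rule ccontr)
        assume "\<not> ?thesis"
        then obtain x i where x: "x \<in> cball v \<rho>" "x \<in> range (L (j, i))" "i \<in> {1, 2}" by blast
        have "dist x y \<le> dist v x + dist v y" using dist_triangle3[of x y v] by simp
        also have "\<dots> < \<epsilon>" using x(1) y(1) \<rho> by (simp add: \<rho>_def)
        finally show False using far[OF x(2,3)] by simp
      qed
    qed
    also have "\<dots> \<le> N\<^sup>2 + N ^ 4"
      using card_mono[OF V(1), of X] X V(3) by (intro add_mono power_mono) auto
    finally show ?thesis .
  qed
  \<comment> \<open>The copies are sorted by the set of balls that their third components meet,
    which gives at most \<open>2 ^ N\<close> classes.\<close>
  have "{1..n} = (\<Union>X\<in>Pow V. J X)" by (auto simp: J_def W_def)
  then have "n = card (\<Union>X\<in>Pow V. J X)" by (metis card_atLeastAtMost diff_Suc_1)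
  also have "\<dots> \<le> (\<Sum>X\<in>Pow V. card (J X))" using V(1) by (intro card_UN_le) simp
  also have "\<dots> \<le> card (Pow V) * (N\<^sup>2 + N ^ 4)" 
    using sum_bounded_above[of "Pow V" "\<lambda>X. card (J X)" "N\<^sup>2 + N ^ 4"] card_J by simp
  also have "\<dots> \<le> 2 ^ N * (N\<^sup>2 + N ^ 4)" using V by (intro mult_right_mono) (auto simp: card_Pow)
  finally show ?thesis .
qed


section \<open>Asymptotics of the bound\<close>

lemma exponential_bound:
  fixes N :: nat
  shows "real (2 ^ N * (N\<^sup>2 + N ^ 4)) \<le> 2 * exp (5 * real N)"
proof -
  have 2: "(2 :: real) ^ N \<le> exp (real N)"
    using power_mono[of 2 "exp 1 :: real" N] exp_ge_add_one_self[of 1] by (simp add: exp_of_nat_mult[symmetric])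
  have N: "real N \<le> exp (real N)" using exp_ge_add_one_self[of "real N"] by linarith
  have "real N ^ 4 \<le> exp (real N) ^ 4" by (rule power_mono[OF N]) simp
  then have 4: "real N ^ 4 \<le> exp (4 * real N)" by (simp add: exp_of_nat_mult[symmetric])
  have "real N ^ 2 \<le> real N ^ 4" by (cases "N = 0") (auto intro: power_increasing)
  then have "real N ^ 2 + real N ^ 4 \<le> 2 * exp (4 * real N)" using 4 by linarith
  then have "2 ^ N * (real N ^ 2 + real N ^ 4) \<le> exp (real N) * (2 * exp (4 * real N))"
    by (intro mult_mono 2) auto
  also have "\<dots> = 2 * exp (5 * real N)" by (simp add: mult_exp_exp)
  finally show ?thesis by simp
qed

text \<open>The number of balls is O(1/\<epsilon>^3), which for \<epsilon> < 1 is relaxed to the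
  ninth power. Rounding up and the extra grid point turn 12 into 14, again because \<epsilon> <
  1.\<close>

lemma cube_count_bound:
  fixes \<epsilon> :: real
  assumes "0 < \<epsilon>" "\<epsilon> < 1"
  shows "real ((nat \<lceil>12 / \<epsilon>\<rceil> + 1) ^ 3) \<le> 14 ^ 3 * \<epsilon> powi (-9)"
proof -
  have "0 \<le> 12 / \<epsilon>" using assms by simp
  then have "real (nat \<lceil>12 / \<epsilon>\<rceil> + 1) \<le> 12 / \<epsilon> + 2" by linarith
  also have "\<dots> \<le> 14 / \<epsilon>" using assms by (simp add: field_simps)
  finally have "real (nat \<lceil>12 / \<epsilon>\<rceil> + 1) ^ 3 \<le> (14 / \<epsilon>) ^ 3" by (rule power_mono) simp
  also have "\<dots> \<le> 14 ^ 3 / \<epsilon> ^ 9"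
    using assms power_decreasing[of 3 9 \<epsilon>] by (simp add: power_divide frac_le)
  also have "\<dots> = 14 ^ 3 * \<epsilon> powi (-9)" by (simp add: power_int_minus divide_inverse)
  finally show ?thesis by simp
qed

theorem theorem2:
  fixes B :: "nat \<Rightarrow> real \<Rightarrow> real^3" and \<mu> :: int
  assumes "smooth_link {1, 2, 3} B"
    and "\<And>i j. i \<in> {1, 2, 3} \<Longrightarrow> j \<in> {1, 2, 3} \<Longrightarrow> i \<noteq> j \<Longrightarrow> has_linking_number (B i) (B j) 0"
    and "has_triple_linking_number B \<mu>"
    and "\<not> [\<mu> = 0] (mod 3)"
  shows "(\<forall>\<epsilon>>0. packing_number B \<epsilon> \<noteq> \<infinity>) \<and>
    (\<exists>a>0. \<exists>C>0. \<exists>\<epsilon>\<^sub>0>0. \<forall>\<epsilon>. 0 < \<epsilon> \<and> \<epsilon> < \<epsilon>\<^sub>0 \<longrightarrow>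
      ereal_of_enat (packing_number B \<epsilon>) \<le> ereal (C * exp (a * \<epsilon> powi (-9))))"
proof -
  have "\<mu> \<noteq> 0" using assms(4) by auto
  define N where "N \<epsilon> = (nat \<lceil>12 / \<epsilon>\<rceil> + 1) ^ 3" for \<epsilon> :: real
  have le: "packing_number B \<epsilon> \<le> enat (2 ^ N \<epsilon> * ((N \<epsilon>)\<^sup>2 + N \<epsilon> ^ 4))" if "\<epsilon> > 0" for \<epsilon>
    unfolding packing_number_def
  proof (rule Sup_least)
    fix x assume "x \<in> enat ` {n. packs_in_cube B \<epsilon> n}"
    then obtain n where n: "x = enat n" "packs_in_cube B \<epsilon> n" by blast
    show "x \<le> enat (2 ^ N \<epsilon> * ((N \<epsilon>)\<^sup>2 + N \<epsilon> ^ 4))"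
      using packing_bound[OF assms(1-3) \<open>\<mu> \<noteq> 0\<close> that n(2)] unfolding n(1) N_def enat_ord_simps .
  qed
  have "ereal_of_enat (packing_number B \<epsilon>) \<le> ereal (2 * exp (5 * 14 ^ 3 * \<epsilon> powi (-9)))"
    if \<epsilon>: "0 < \<epsilon>" "\<epsilon> < 1" for \<epsilon>
  proof -
    have "ereal_of_enat (packing_number B \<epsilon>) \<le> ereal_of_enat (enat (2 ^ N \<epsilon> * ((N \<epsilon>)\<^sup>2 + N \<epsilon> ^ 4)))"
      using le[OF \<epsilon>(1)] by (simp only: ereal_of_enat_le_iff)
    also have "\<dots> = ereal (real (2 ^ N \<epsilon> * ((N \<epsilon>)\<^sup>2 + N \<epsilon> ^ 4)))" by simp
    also have "\<dots> \<le> ereal (2 * exp (5 * real (N \<epsilon>)))"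
      using exponential_bound by (simp only: ereal_less_eq)
    also have "\<dots> \<le> ereal (2 * exp (5 * 14 ^ 3 * \<epsilon> powi (-9)))"
      using cube_count_bound[OF \<epsilon>] by (simp add: N_def)
    finally show ?thesis .
  qed
  then have "\<exists>a>0. \<exists>C>0. \<exists>\<epsilon>\<^sub>0>0. \<forall>\<epsilon>. 0 < \<epsilon> \<and> \<epsilon> < \<epsilon>\<^sub>0 \<longrightarrow>
      ereal_of_enat (packing_number B \<epsilon>) \<le> ereal (C * exp (a * \<epsilon> powi (-9)))"
    \<comment> \<open>The exponent combines the 5 of \<open>exponential_bound\<close> with the
      \<open>14 ^ 3\<close> of \<open>cube_count_bound\<close>; the threshold 1 comes from the
      latter.\<close>
    by (intro exI[of _ "5 * 14 ^ 3"] exI[of _ 2] exI[of _ 1] conjI) auto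
  moreover have "packing_number B \<epsilon> \<noteq> \<infinity>" if "\<epsilon> > 0" for \<epsilon>
    using le[OF that] by (metis enat_ord_code(5) infinity_ileE)
  ultimately show ?thesis by blast
qed

end
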